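(* Let $m\ge 1$ be an integer, $\varphi_j=\pi j/m$, $\omega_j=(\cos\varphi_j,\sin\varphi_j)$ for $j\in\mathbb{Z}$, and let $\psi\in C^\infty(S^1)$ be even. Let $f\in\mathcal{E}'(\mathbb{R}^2)$ and set $$f_{\psi,\delta}(x)=\frac{2\pi}{m}\sum_{j=1}^{m}\psi(\omega_j)\,(\mathcal{H}\mathcal{R}f)(\omega_j,x\cdot\omega_j).$$ Then $\mathrm{WF}(f_{\psi,\delta})$ is included in the union of the conormal bundles (with the zero section removed) of all lines $\{x\in\mathbb{R}^2:\ (x-x_0)\cdot\omega_j=0\}$ for which $(x_0,\omega_j)\in\mathrm{WF}(f)$ for some $j\in\{1,\dots,2m\}$.
   Context: The Radon transform in the plane is $\mathcal{R}f(\omega,p)=\int_{x\cdot\omega=p}f\,d\ell$, $\omega\in S^1$, $p\in\mathbb{R}$, with $d\ell$ the Euclidean length measure. For a compactly supported distribution $f$ and fixed $\omega$, $\mathcal{R}f(\omega,\cdot)$ is the compactly supported distribution on $\mathbb{R}$ obtained by pushing $f$ forward under $x\mapsto x\cdot\omega$. The operator $\mathcal{H}=\frac1{4\pi}H\,\partial_p$ acts in the $p$ variable, where $Hg(p)=\frac1\pi\,\mathrm{pv}\!\int\frac{g(s)}{p-s}\,ds$ is the Hilbert transform; equivalently $\mathcal{H}=\frac1{4\pi}|D_p|$, $D_p=-i\partial_p$. The expression $(\mathcal{H}\mathcal{R}f)(\omega_j,x\cdot\omega_j)$ is the pull-back of the distribution $(\mathcal{H}\mathcal{R}f)(\omega_j,\cdot)$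 on $\mathbb{R}$ under $x\mapsto x\cdot\omega_j$. $\mathrm{WF}$ is the classical ($C^\infty$) wave front set, and covectors are identified with vectors of $\mathbb{R}^2$. The set $\{\omega_j\}_{j=1}^{2m}$ is symmetric under $\omega\mapsto-\omega$. *)

theory Defs
  imports "HOL-Analysis.Analysis"
begin

section \<open>Smooth functions and distributions\<close>

definition partial_deriv :: "'a::euclidean_space \<Rightarrow> ('a \<Rightarrow> complex) \<Rightarrow> 'a \<Rightarrow> complex" where
  "partial_deriv b \<phi> x = frechet_derivative \<phi> (at x) b"

text \<open>A list of basis vectors plays the role of a multi-index.\<close>

definition partial_derivs :: "'a::euclidean_space list \<Rightarrow> ('a \<Rightarrow> complex) \<Rightarrow> 'a \<Rightarrow> complex" where
  "partial_derivs bs \<phi> = foldr partial_deriv bs \<phi>"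

text \<open>Since differentiability at every order entails continuity of the partial derivatives of
  the order before, this is the class of functions having continuous partial derivatives of all
  orders.\<close>

definition smooth :: "('a::euclidean_space \<Rightarrow> complex) \<Rightarrow> bool" where
  "smooth \<phi> \<longleftrightarrow>
     (\<forall>bs. set bs \<subseteq> Basis \<longrightarrow> (\<forall>x. partial_derivs bs \<phi> differentiable (at x)))"

definition test_function :: "('a::euclidean_space \<Rightarrow> complex) \<Rightarrow> bool" where
  "test_function \<phi> \<longleftrightarrow> smooth \<phi> \<and> compact (closure {x. \<phi> x \<noteq> 0})"

text \<open>
  A distribution is represented by a functional on functions, of which only the values at test
  functions are meaningful. A compactly supported distribution is a continuous linear functional
  on the space of all smooth functions; its values at all smooth functions are meaningful, and its
  restriction to test functions is the underlying distribution. Continuity is stated with the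
  seminorms of the space of smooth functions: for some compact \<open>K\<close>, some order \<open>N\<close> and some \<open>C\<close>,
  \<open>\<bar>u \<phi>\<bar>\<close> is at most \<open>C\<close> times the maximum over \<open>K\<close> of the absolute values of the derivatives of
  \<open>\<phi>\<close> up to order \<open>N\<close>. Bounds \<open>M\<close> of that maximum are used so that an empty \<open>K\<close> gives \<open>0\<close>.\<close>

definition compact_distribution :: "(('a::euclidean_space \<Rightarrow> complex) \<Rightarrow> complex) \<Rightarrow> bool" where
  "compact_distribution u \<longleftrightarrow>
     (\<forall>\<phi> \<psi>. smooth \<phi> \<longrightarrow> smooth \<psi> \<longrightarrow> u (\<lambda>x. \<phi> x + \<psi> x) = u \<phi> + u \<psi>) \<and>
     (\<forall>c \<phi>. smooth \<phi> \<longrightarrow> u (\<lambda>x. c * \<phi> x) = c * u \<phi>) \<and>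
     (\<exists>K C N. compact K \<and>
        (\<forall>\<phi> M. smooth \<phi> \<longrightarrow> 0 \<le> M \<longrightarrow>
           (\<forall>bs. set bs \<subseteq> Basis \<longrightarrow> length bs \<le> N \<longrightarrow>
              (\<forall>x\<in>K. norm (partial_derivs bs \<phi> x) \<le> M)) \<longrightarrow>
           norm (u \<phi>) \<le> C * M))"


section \<open>Wave front sets and conormal bundles\<close>

definition open_cone :: "'a::real_normed_vector set \<Rightarrow> bool" where
  "open_cone \<Gamma> \<longleftrightarrow> open \<Gamma> \<and> (\<forall>\<xi>\<in>\<Gamma>. \<forall>t>0. t *\<^sub>R \<xi> \<in> \<Gamma>)"

text \<open>The Fourier transform of the compactly supported distribution \<open>\<eta> u\<close>, for a test
  function \<open>\<eta>\<close>.\<close>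

definition localized_fourier ::
  "(('a::euclidean_space \<Rightarrow> complex) \<Rightarrow> complex) \<Rightarrow> ('a \<Rightarrow> complex) \<Rightarrow> 'a \<Rightarrow> complex" where
  "localized_fourier u \<eta> \<xi> = u (\<lambda>x. \<eta> x * exp (- \<i> * complex_of_real (x \<bullet> \<xi>)))"

definition WF :: "(('a::euclidean_space \<Rightarrow> complex) \<Rightarrow> complex) \<Rightarrow> ('a \<times> 'a) set" where
  "WF u = {(x\<^sub>0, \<xi>\<^sub>0). \<xi>\<^sub>0 \<noteq> 0 \<and>
     \<not> (\<exists>\<eta> \<Gamma>. test_function \<eta> \<and> \<eta> x\<^sub>0 \<noteq> 0 \<and> open_cone \<Gamma> \<and> \<xi>\<^sub>0 \<in> \<Gamma> \<and>
          (\<forall>N::nat. \<exists>C. \<forall>\<xi>\<in>\<Gamma>. (1 + norm \<xi>) ^ N * norm (localized_fourier u \<eta> \<xi>) \<le> C))}"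

text \<open>For affine \<open>L\<close>, where the tangent space at \<open>x \<in> L\<close> consists of the differences \<open>y - x\<close> with
  \<open>y \<in> L\<close>. Covectors are identified with vectors by the inner product.\<close>

definition conormal_bundle :: "'a::euclidean_space set \<Rightarrow> ('a \<times> 'a) set" where
  "conormal_bundle L = {(x, \<xi>). x \<in> L \<and> (\<forall>y\<in>L. (y - x) \<bullet> \<xi> = 0)}"


section \<open>Radon transform and filtered backprojection\<close>

definition unit_vec :: "real \<Rightarrow> real^2" where
  "unit_vec t = vector [cos t, sin t]"

definition smooth_on_circle :: "(real^2 \<Rightarrow> complex) \<Rightarrow> bool" where
  "smooth_on_circle \<psi> \<longleftrightarrow> smooth (\<lambda>t. \<psi> (unit_vec t))"

definition perp :: "real^2 \<Rightarrow> real^2" where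
  "perp \<omega> = vector [- (\<omega> $ 2), \<omega> $ 1]"

text \<open>For a unit vector \<open>\<omega>\<close>, \<open>t \<mapsto> p \<omega> + t \<omega>\<^sup>\<bottom>\<close> parametrizes the line \<open>x \<bullet> \<omega> = p\<close> by arc length.\<close>

definition radon :: "(real^2 \<Rightarrow> complex) \<Rightarrow> real^2 \<Rightarrow> real \<Rightarrow> complex" where
  "radon \<phi> \<omega> p = (LINT t|lborel. \<phi> (p *\<^sub>R \<omega> + t *\<^sub>R perp \<omega>))"

text \<open>The Radon transform of a compactly supported distribution at a fixed direction: the push
  forward under \<open>x \<mapsto> x \<bullet> \<omega>\<close>.\<close>

definition radon_dist ::
  "((real^2 \<Rightarrow> complex) \<Rightarrow> complex) \<Rightarrow> real^2 \<Rightarrow> (real \<Rightarrow> complex) \<Rightarrow> complex" where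
  "radon_dist u \<omega> g = u (\<lambda>x. g (x \<bullet> \<omega>))"

text \<open>The pull-back of a distribution on the line under \<open>x \<mapsto> x \<bullet> \<omega>\<close>, for a unit vector \<open>\<omega>\<close>: by
  Fubini, \<open>\<integral> v (x \<bullet> \<omega>) \<phi> x dx = \<integral> v p (radon \<phi> \<omega> p) dp\<close> for functions \<open>v\<close>.\<close>

definition pullback_dist ::
  "real^2 \<Rightarrow> ((real \<Rightarrow> complex) \<Rightarrow> complex) \<Rightarrow> (real^2 \<Rightarrow> complex) \<Rightarrow> complex" where
  "pullback_dist \<omega> v \<phi> = v (radon \<phi> \<omega>)"

definition deriv_dist :: "((real \<Rightarrow> complex) \<Rightarrow> complex) \<Rightarrow> (real \<Rightarrow> complex) \<Rightarrow> complex" where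
  "deriv_dist u \<phi> = - u (\<lambda>p. vector_derivative \<phi> (at p))"

definition hilbert :: "(real \<Rightarrow> complex) \<Rightarrow> real \<Rightarrow> complex" where
  "hilbert g p = complex_of_real (1 / pi) *
     Lim (at_right 0)
       (\<lambda>\<epsilon>. LINT s:{s. \<epsilon> < \<bar>p - s\<bar>}|lborel. g s / complex_of_real (p - s))"

text \<open>The Hilbert transform of a compactly supported distribution, by antisymmetry of the Hilbert
  transform of functions. The Hilbert transform of a test function is smooth but in general not
  compactly supported.\<close>

definition hilbert_dist :: "((real \<Rightarrow> complex) \<Rightarrow> complex) \<Rightarrow> (real \<Rightarrow> complex) \<Rightarrow> complex" where
  "hilbert_dist u \<phi> = - u (hilbert \<phi>)"

definition filter_dist :: "((real \<Rightarrow> complex) \<Rightarrow> complex) \<Rightarrow> (real \<Rightarrow> complex) \<Rightarrow> complex" where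
  "filter_dist u \<phi> = complex_of_real (1 / (4 * pi)) * hilbert_dist (deriv_dist u) \<phi>"

definition direction :: "nat \<Rightarrow> int \<Rightarrow> real^2" where
  "direction m j = unit_vec (pi * real_of_int j / real m)"

definition discrete_fbp ::
  "nat \<Rightarrow> (real^2 \<Rightarrow> complex) \<Rightarrow> ((real^2 \<Rightarrow> complex) \<Rightarrow> complex)
    \<Rightarrow> (real^2 \<Rightarrow> complex) \<Rightarrow> complex" where
  "discrete_fbp m \<psi> f \<phi> = complex_of_real (2 * pi / real m) *
     (\<Sum>j\<in>{1..int m}. \<psi> (direction m j) *
        pullback_dist (direction m j) (filter_dist (radon_dist f (direction m j))) \<phi>)"

end

theory Submission
  imports Defs
begin

text \<open>
  For a fixed direction \<open>\<omega>\<close> and a cutoff \<open>\<eta>\<close>, the Radon transform of \<open>\<eta> x e\<^sup>-\<^sup>i\<^sup>x\<^sup>\<xi>\<close> is \<open>e\<^sup>-\<^sup>i\<^sup>\<alpha>\<^sup>p g p\<close> with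
  \<open>\<alpha> = \<omega> \<bullet> \<xi>\<close> and \<open>\<tau> = perp \<omega> \<bullet> \<xi>\<close>, where \<open>g\<close> and its derivatives decay rapidly in \<open>\<tau>\<close>. If the covector is
  not parallel to \<open>\<omega>\<close>, then \<open>\<bar>\<tau>\<bar>\<close> is comparable with \<open>norm \<xi>\<close> in a cone, and continuity of \<open>f\<close> suffices. If it is
  parallel, the Hilbert kernel is split into a smooth part, whose contribution decays in \<open>\<alpha>\<close> by partial
  integration, and a part supported near \<open>0\<close>. The latter yields a function of \<open>x \<bullet> \<omega>\<close> supported in a thin strip
  around the line through the base point; on this strip \<open>f\<close> is microlocally smooth in the relevant direction, which
  is exploited with a partition of unity subordinate to the cutoffs provided by the definition of \<open>WF\<close>.
  Multiplication by smooth functions is analysed by Fourier series, so that neither Fourier inversion nor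
  superposition integrals of distributions are needed.\<close>

section \<open>The class of smooth functions\<close>

text \<open>The functional \<open>f\<close> is linear over finite sums and bounded by finitely many
  seminorms, so a superposition can pass through it only as a series whose tails are small in these
  seminorms. The frequency \<open>\<xi>\<close> enters the filtered functions through both \<alpha>
  and \<tau>; hence constants must not depend on these functions themselves, only on bounds for
  their derivatives. The Hilbert transform is nonlocal, so its output meets singularities of
  \<open>f\<close> everywhere; the splitting leaves only a smooth kernel to act at a distance. The
  width of the near kernel and the size of the cutoff are each half the width of the strip on which
  \<open>f\<close> is known to be good. Continuity of \<open>f\<close> costs a fixed power of 1 +
  |\<alpha>| and the filter two more; decay of every order leaves room for both. Wave front sets are
  one-sided: the sum runs over \<open>m\<close> directions, but a covector opposite to one of them
  belongs to the index shifted by \<open>m\<close>, which is why the claim ranges over twice as many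
  indices.\<close>

lemma partial_derivs_simps [simp]:
  "partial_derivs [] \<phi> = \<phi>"
  "partial_derivs (b # bs) \<phi> = partial_deriv b (partial_derivs bs \<phi>)"
  by (simp_all add: partial_derivs_def)

lemma partial_derivs_append:
  "partial_derivs (bs @ cs) \<phi> = partial_derivs bs (partial_derivs cs \<phi>)"
  by (simp add: partial_derivs_def)

lemma partial_derivI:
  assumes "\<And>x. (\<phi> has_derivative \<phi>' x) (at x)"
  shows "partial_deriv b \<phi> = (\<lambda>x. \<phi>' x b)"
  unfolding partial_deriv_def using frechet_derivative_at[OF assms] by (metis (no_types))

text \<open>\<open>smooth\<close> describes the largest set of differentiable functions stable under
  partial derivatives, so one such set around \<open>\<phi>\<close> is enough.\<close>

lemma smooth_coinduct:
  assumes "\<phi> \<in> S"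
    and "\<And>\<phi> x. \<phi> \<in> S \<Longrightarrow> \<phi> differentiable at x"
    and "\<And>\<phi> b. \<phi> \<in> S \<Longrightarrow> b \<in> Basis \<Longrightarrow> partial_deriv b \<phi> \<in> S"
  shows "smooth \<phi>"
proof -
  have "partial_derivs bs \<phi> \<in> S" if "set bs \<subseteq> Basis" for bs
    using that by (induction bs) (auto simp: assms)
  then show ?thesis
    unfolding smooth_def using assms(2) by blast
qed

lemma smooth_differentiable: "smooth \<phi> \<Longrightarrow> \<phi> differentiable at x"
  unfolding smooth_def by (metis empty_subsetI list.set(1) partial_derivs_simps(1))

lemma smooth_has_derivative: "smooth \<phi> \<Longrightarrow> (\<phi> has_derivative frechet_derivative \<phi> (at x)) (at x)"
  using smooth_differentiable frechet_derivative_works by blast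

lemma smooth_partial_deriv_Basis:
  assumes "smooth \<phi>" "b \<in> Basis"
  shows "smooth (partial_deriv b \<phi>)"
  unfolding smooth_def
proof (intro allI impI)
  fix bs :: "'a list" and x
  assume "set bs \<subseteq> Basis"
  then have "set (bs @ [b]) \<subseteq> Basis" using assms by auto
  then have "partial_derivs (bs @ [b]) \<phi> differentiable at x"
    using assms(1) unfolding smooth_def by blast
  then show "partial_derivs bs (partial_deriv b \<phi>) differentiable at x"
    by (simp add: partial_derivs_append)
qed

lemma smooth_partial_derivs:
  assumes "smooth \<phi>" "set bs \<subseteq> Basis"
  shows "smooth (partial_derivs bs \<phi>)"
  using assms(2) by (induction bs) (auto simp: assms smooth_partial_deriv_Basis)

lemma smooth_continuous_on: "smooth \<phi> \<Longrightarrow> continuous_on A \<phi>"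
  by (meson continuous_at_imp_continuous_on differentiable_imp_continuous_within smooth_differentiable)

text \<open>Closing under all operations at once reduces the closure properties of smoothness to a
  single coinduction. In \<open>compose\<close> the inner function has to be real, hence
  \<open>Re\<close>; its derivative is half of a sum with a conjugate, which is where
  \<open>cnj\<close> enters.\<close>

inductive_set smooth_closure :: "('a::euclidean_space \<Rightarrow> complex) set" where
  base: "smooth \<phi> \<Longrightarrow> \<phi> \<in> smooth_closure"
| lin: "bounded_linear \<phi> \<Longrightarrow> \<phi> \<in> smooth_closure"
| const: "(\<lambda>x. c) \<in> smooth_closure"
| add: "\<phi> \<in> smooth_closure \<Longrightarrow> \<psi> \<in> smooth_closure \<Longrightarrow> (\<lambda>x. \<phi> x + \<psi> x) \<in> smooth_closure"
| mult: "\<phi> \<in> smooth_closure \<Longrightarrow> \<psi> \<in> smooth_closure \<Longrightarrow> (\<lambda>x. \<phi> x * \<psi> x) \<in> smooth_closure"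
| cnj: "\<phi> \<in> smooth_closure \<Longrightarrow> (\<lambda>x. cnj (\<phi> x)) \<in> smooth_closure"
| exp: "\<phi> \<in> smooth_closure \<Longrightarrow> (\<lambda>x. exp (\<phi> x)) \<in> smooth_closure"
| inverse: "\<phi> \<in> smooth_closure \<Longrightarrow> (\<And>x. \<phi> x \<noteq> 0) \<Longrightarrow> (\<lambda>x. inverse (\<phi> x)) \<in> smooth_closure"
| compose: "smooth (g :: real \<Rightarrow> complex) \<Longrightarrow> \<phi> \<in> smooth_closure \<Longrightarrow>
    (\<lambda>x. g (Re (\<phi> x))) \<in> smooth_closure"

text \<open>Each differentiation rule expresses the derivative of a compound by its parts and their
  derivatives, all of which stay in the closure. Both claims about the parts enter, hence the
  conjunction.\<close>

lemma smooth_closure_deriv: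
  assumes "\<phi> \<in> smooth_closure"
  shows "(\<forall>x. \<phi> differentiable at x) \<and> (\<forall>b\<in>Basis. partial_deriv b \<phi> \<in> smooth_closure)"
  using assms
proof induction
  case (base \<phi>)
  then show ?case
    by (auto intro: smooth_closure.base smooth_partial_deriv_Basis smooth_differentiable)
next
  case (lin \<phi>)
  then have D: "(\<phi> has_derivative \<phi>) (at x)" for x
    by (rule bounded_linear_imp_has_derivative)
  then have "partial_deriv b \<phi> = (\<lambda>x. \<phi> b)" for b
    by (rule partial_derivI)
  with D show ?case
    by (auto intro: smooth_closure.const simp: differentiable_def)
next
  case (const c)
  have D: "((\<lambda>x::'a. c) has_derivative (\<lambda>h. 0)) (at x)" for x
    by (auto intro!: derivative_eq_intros)
  then have "partial_deriv b (\<lambda>x::'a. c) = (\<lambda>x. 0)" for b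
    by (rule partial_derivI)
  with D show ?case
    by (metis differentiable_def smooth_closure.const)
next
  case (add \<phi> \<psi>)
  then have "(\<phi> has_derivative frechet_derivative \<phi> (at x)) (at x)"
    "(\<psi> has_derivative frechet_derivative \<psi> (at x)) (at x)" for x
    by (auto simp: frechet_derivative_works)
  then have D: "((\<lambda>x. \<phi> x + \<psi> x) has_derivative
     (\<lambda>h. frechet_derivative \<phi> (at x) h + frechet_derivative \<psi> (at x) h)) (at x)" for x
    by (rule has_derivative_add)
  then have "partial_deriv b (\<lambda>x. \<phi> x + \<psi> x) = (\<lambda>x. partial_deriv b \<phi> x + partial_deriv b \<psi> x)" for b
    unfolding partial_deriv_def[of b \<phi>] partial_deriv_def[of b \<psi>] by (rule partial_derivI)
  with D add show ?case
    by (auto intro: smooth_closure.add simp: differentiable_def)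
next
  case (mult \<phi> \<psi>)
  then have "(\<phi> has_derivative frechet_derivative \<phi> (at x)) (at x)"
    "(\<psi> has_derivative frechet_derivative \<psi> (at x)) (at x)" for x
    by (auto simp: frechet_derivative_works)
  then have D: "((\<lambda>x. \<phi> x * \<psi> x) has_derivative
     (\<lambda>h. \<phi> x * frechet_derivative \<psi> (at x) h + frechet_derivative \<phi> (at x) h * \<psi> x)) (at x)" for x
    by (rule has_derivative_mult)
  then have "partial_deriv b (\<lambda>x. \<phi> x * \<psi> x) =
      (\<lambda>x. \<phi> x * partial_deriv b \<psi> x + partial_deriv b \<phi> x * \<psi> x)" for b
    unfolding partial_deriv_def[of b \<phi>] partial_deriv_def[of b \<psi>] by (rule partial_derivI)
  with D mult show ?case
    by (auto intro!: smooth_closure.add smooth_closure.mult simp: differentiable_def)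
next
  case (cnj \<phi>)
  then have "(\<phi> has_derivative frechet_derivative \<phi> (at x)) (at x)" for x
    by (auto simp: frechet_derivative_works)
  then have D: "((\<lambda>x. cnj (\<phi> x)) has_derivative (\<lambda>h. cnj (frechet_derivative \<phi> (at x) h))) (at x)" for x
    by (rule has_derivative_cnj)
  then have "partial_deriv b (\<lambda>x. cnj (\<phi> x)) = (\<lambda>x. cnj (partial_deriv b \<phi> x))" for b
    unfolding partial_deriv_def[of b \<phi>] by (rule partial_derivI)
  with D cnj show ?case
    by (auto intro!: smooth_closure.cnj simp: differentiable_def)
next
  case (exp \<phi>)
  then have *: "(\<phi> has_derivative frechet_derivative \<phi> (at x)) (at x)" for x
    by (auto simp: frechet_derivative_works)
  have D: "((\<lambda>x. exp (\<phi> x)) has_derivative (\<lambda>h. exp (\<phi> x) * frechet_derivative \<phi> (at x) h)) (at x)" for x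
    by (rule has_derivative_compose[OF *, where g=exp]) (rule DERIV_exp[unfolded has_field_derivative_def])
  then have "partial_deriv b (\<lambda>x. exp (\<phi> x)) = (\<lambda>x. exp (\<phi> x) * partial_deriv b \<phi> x)" for b
    unfolding partial_deriv_def[of b \<phi>] by (rule partial_derivI)
  with D exp show ?case
    by (auto intro!: smooth_closure.mult smooth_closure.exp simp: differentiable_def)
next
  case (inverse \<phi>)
  then have *: "(\<phi> has_derivative frechet_derivative \<phi> (at x)) (at x)" for x
    by (auto simp: frechet_derivative_works)
  have D: "((\<lambda>x. inverse (\<phi> x)) has_derivative
      (\<lambda>h. - (inverse (\<phi> x) * frechet_derivative \<phi> (at x) h * inverse (\<phi> x)))) (at x)" for x
    by (rule Deriv.has_derivative_inverse) (use inverse.hyps * in auto)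
  then have "partial_deriv b (\<lambda>x. inverse (\<phi> x)) =
      (\<lambda>x. (-1) * (inverse (\<phi> x) * partial_deriv b \<phi> x * inverse (\<phi> x)))" for b
    unfolding partial_deriv_def[of b \<phi>] by (simp add: partial_derivI[OF D])
  moreover have "(\<lambda>x. inverse (\<phi> x)) \<in> smooth_closure"
    using inverse.hyps by (intro smooth_closure.inverse) auto
  ultimately have "partial_deriv b (\<lambda>x. inverse (\<phi> x)) \<in> smooth_closure" if "b \<in> Basis" for b
    using inverse.IH that by (simp only:) (intro smooth_closure.mult smooth_closure.const; simp)
  with D show ?case
    unfolding differentiable_def by blast
next
  case (compose g \<phi>)
  then have *: "(\<phi> has_derivative frechet_derivative \<phi> (at x)) (at x)" for x
    by (auto simp: frechet_derivative_works)
  have R: "((\<lambda>x. Re (\<phi> x)) has_derivative (\<lambda>h. Re (frechet_derivative \<phi> (at x) h))) (at x)" for x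
    by (rule has_derivative_Re[OF *])
  have g: "(g has_derivative (\<lambda>h. complex_of_real h * partial_deriv 1 g t)) (at t)" for t
  proof -
    have d: "(g has_derivative frechet_derivative g (at t)) (at t)"
      using compose.hyps(1) by (rule smooth_has_derivative)
    have "frechet_derivative g (at t) h = complex_of_real h * partial_deriv 1 g t" for h
      using linear_cmul[OF has_derivative_linear[OF d], of h 1]
      by (simp add: partial_deriv_def scaleR_conv_of_real)
    then have "frechet_derivative g (at t) = (\<lambda>h. complex_of_real h * partial_deriv 1 g t)" by blast
    with d show ?thesis by simp
  qed
  have D: "((\<lambda>x. g (Re (\<phi> x))) has_derivative
      (\<lambda>h. complex_of_real (Re (frechet_derivative \<phi> (at x) h)) * partial_deriv 1 g (Re (\<phi> x)))) (at x)" for x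
    by (rule has_derivative_compose[OF R g])
  have "partial_deriv b (\<lambda>x. g (Re (\<phi> x))) =
      (\<lambda>x. ((1/2) * (partial_deriv b \<phi> x + cnj (partial_deriv b \<phi> x))) * partial_deriv 1 g (Re (\<phi> x)))" for b
    by (simp add: partial_derivI[OF D] complex_add_cnj partial_deriv_def)
  moreover have "(\<lambda>x. partial_deriv 1 g (Re (\<phi> x))) \<in> smooth_closure"
    using compose by (intro smooth_closure.compose smooth_partial_deriv_Basis) auto
  ultimately have "partial_deriv b (\<lambda>x. g (Re (\<phi> x))) \<in> smooth_closure" if "b \<in> Basis" for b
    using compose.IH that
    by (simp only:) (intro smooth_closure.mult smooth_closure.add smooth_closure.cnj smooth_closure.const; simp)
  with D show ?case
    unfolding differentiable_def by blast
qed

lemma smooth_iff_closure: "smooth \<phi> \<longleftrightarrow> \<phi> \<in> smooth_closure"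
  using smooth_coinduct[of \<phi> smooth_closure] smooth_closure_deriv smooth_closure.base by blast

section \<open>Closure properties of smoothness and rules for partial derivatives\<close>

lemma smooth_linear: "bounded_linear \<phi> \<Longrightarrow> smooth \<phi>"
  by (simp add: smooth_iff_closure smooth_closure.lin)

lemma smooth_const [simp]: "smooth (\<lambda>x. c)"
  by (simp add: smooth_iff_closure smooth_closure.const)

lemma smooth_add: "smooth \<phi> \<Longrightarrow> smooth \<psi> \<Longrightarrow> smooth (\<lambda>x. \<phi> x + \<psi> x)"
  by (simp add: smooth_iff_closure smooth_closure.add)

lemma smooth_mult: "smooth \<phi> \<Longrightarrow> smooth \<psi> \<Longrightarrow> smooth (\<lambda>x. \<phi> x * \<psi> x)"
  by (simp add: smooth_iff_closure smooth_closure.mult)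

lemma smooth_cnj: "smooth \<phi> \<Longrightarrow> smooth (\<lambda>x. cnj (\<phi> x))"
  by (simp add: smooth_iff_closure smooth_closure.cnj)

lemma smooth_exp: "smooth \<phi> \<Longrightarrow> smooth (\<lambda>x. exp (\<phi> x))"
  by (simp add: smooth_iff_closure smooth_closure.exp)

lemma smooth_inverse: "smooth \<phi> \<Longrightarrow> (\<And>x. \<phi> x \<noteq> 0) \<Longrightarrow> smooth (\<lambda>x. inverse (\<phi> x))"
  by (simp add: smooth_iff_closure smooth_closure.inverse)

lemma smooth_divide: "smooth \<phi> \<Longrightarrow> smooth \<psi> \<Longrightarrow> (\<And>x. \<psi> x \<noteq> 0) \<Longrightarrow> smooth (\<lambda>x. \<phi> x / \<psi> x)"
  unfolding divide_inverse by (intro smooth_mult smooth_inverse)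

lemma smooth_compose:
  fixes q :: "'a::euclidean_space \<Rightarrow> real"
  assumes "smooth g" "smooth (\<lambda>x. complex_of_real (q x))"
  shows "smooth (\<lambda>x. g (q x))"
  using smooth_closure.compose[OF assms(1)] assms(2) by (fastforce simp: smooth_iff_closure)

lemma smooth_of_real_inner [simp]: "smooth (\<lambda>x. complex_of_real (x \<bullet> a))"
  by (intro smooth_linear bounded_linear_compose[OF bounded_linear_of_real bounded_linear_inner_left])

lemma smooth_of_real_ident [simp]: "smooth complex_of_real"
  by (intro smooth_linear bounded_linear_of_real)

lemma smooth_diff: "smooth \<phi> \<Longrightarrow> smooth \<psi> \<Longrightarrow> smooth (\<lambda>x. \<phi> x - \<psi> x)"
  using smooth_add[of \<phi> "\<lambda>x. (-1) * \<psi> x"] smooth_mult[OF smooth_const[of "-1"], of \<psi>] by simp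

lemma smooth_cmult: "smooth \<phi> \<Longrightarrow> smooth (\<lambda>x. c * \<phi> x)"
  by (intro smooth_mult) auto

lemma smooth_sum: "(\<And>i. i \<in> I \<Longrightarrow> smooth (\<phi> i)) \<Longrightarrow> smooth (\<lambda>x. \<Sum>i\<in>I. \<phi> i x)"
  by (induction I rule: infinite_finite_induct) (auto intro: smooth_add)

lemma smooth_norm_power2: "smooth (\<lambda>x. complex_of_real ((norm (x - a))\<^sup>2))"
proof -
  have "complex_of_real ((norm (x - a))\<^sup>2) =
     (\<Sum>b\<in>Basis. (complex_of_real (x \<bullet> b) - complex_of_real (a \<bullet> b)) * (complex_of_real (x \<bullet> b) - complex_of_real (a \<bullet> b)))" for x
    unfolding power2_norm_eq_inner euclidean_inner[of "x - a" "x - a"] by (simp add: inner_diff_left)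
  then show ?thesis
    by (simp only:) (intro smooth_sum smooth_mult smooth_diff smooth_of_real_inner smooth_const)
qed

lemma smooth_plane_wave: "smooth (\<lambda>x. exp (- \<i> * complex_of_real (x \<bullet> \<xi>)))"
  by (intro smooth_exp smooth_cmult smooth_of_real_inner)

lemma partial_deriv_plane_wave:
  "partial_deriv b (\<lambda>x. exp (- \<i> * complex_of_real (x \<bullet> \<xi>))) =
    (\<lambda>x. (- \<i> * complex_of_real (b \<bullet> \<xi>)) * exp (- \<i> * complex_of_real (x \<bullet> \<xi>)))"
proof (rule partial_derivI)
  fix x
  have "((\<lambda>x. - \<i> * complex_of_real (x \<bullet> \<xi>)) has_derivative (\<lambda>x. - \<i> * complex_of_real (x \<bullet> \<xi>))) (at x)"
    by (auto intro!: derivative_eq_intros)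
  from has_derivative_compose[OF this, where g=exp, OF DERIV_exp[unfolded has_field_derivative_def]]
  show "((\<lambda>x. exp (- \<i> * complex_of_real (x \<bullet> \<xi>))) has_derivative
      (\<lambda>b. (- \<i> * complex_of_real (b \<bullet> \<xi>)) * exp (- \<i> * complex_of_real (x \<bullet> \<xi>)))) (at x)"
    by (simp add: mult.commute)
qed

lemma partial_deriv_add:
  "smooth \<phi> \<Longrightarrow> smooth \<psi> \<Longrightarrow>
   partial_deriv b (\<lambda>x. \<phi> x + \<psi> x) = (\<lambda>x. partial_deriv b \<phi> x + partial_deriv b \<psi> x)"
  unfolding partial_deriv_def[of b \<phi>] partial_deriv_def[of b \<psi>]
  by (intro partial_derivI has_derivative_add smooth_has_derivative)

lemma partial_deriv_mult:
  "smooth \<phi> \<Longrightarrow> smooth \<psi> \<Longrightarrow>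
   partial_deriv b (\<lambda>x. \<phi> x * \<psi> x) = (\<lambda>x. \<phi> x * partial_deriv b \<psi> x + partial_deriv b \<phi> x * \<psi> x)"
  unfolding partial_deriv_def[of b \<phi>] partial_deriv_def[of b \<psi>]
  by (intro partial_derivI has_derivative_mult smooth_has_derivative)

lemma partial_deriv_cmult:
  "smooth \<phi> \<Longrightarrow> partial_deriv b (\<lambda>x. c * \<phi> x) = (\<lambda>x. c * partial_deriv b \<phi> x)"
  unfolding partial_deriv_def[of b \<phi>]
  by (intro partial_derivI has_derivative_mult_right smooth_has_derivative)

lemma partial_derivs_add:
  assumes "smooth \<phi>" "smooth \<psi>" "set bs \<subseteq> Basis"
  shows "partial_derivs bs (\<lambda>x. \<phi> x + \<psi> x) = (\<lambda>x. partial_derivs bs \<phi> x + partial_derivs bs \<psi> x)"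
  using assms(3) by (induction bs) (auto simp: partial_deriv_add smooth_partial_derivs assms)

lemma partial_derivs_cmult:
  assumes "smooth \<phi>" "set bs \<subseteq> Basis"
  shows "partial_derivs bs (\<lambda>x. c * \<phi> x) = (\<lambda>x. c * partial_derivs bs \<phi> x)"
  using assms(2) by (induction bs) (auto simp: partial_deriv_cmult smooth_partial_derivs assms)

lemma partial_derivs_sum:
  assumes "\<And>i. i \<in> I \<Longrightarrow> smooth (\<phi> i)" "set bs \<subseteq> Basis"
  shows "partial_derivs bs (\<lambda>x. \<Sum>i\<in>I. \<phi> i x) = (\<lambda>x. \<Sum>i\<in>I. partial_derivs bs (\<phi> i) x)"
  using assms(1)
proof (induction I rule: infinite_finite_induct)
  case (insert i I)
  then show ?case
    by (simp add: partial_derivs_add[OF _ _ assms(2)] smooth_sum)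
qed (use partial_derivs_cmult[OF smooth_const[of 0] assms(2), of 0] in simp_all)

text \<open>Multi-indices use basis vectors only, whereas the directions \<open>\<omega>\<close> and
  \<open>perp \<omega>\<close> of a frame are arbitrary; linearity of the derivative links the
  two.\<close>

lemma partial_deriv_eq_sum:
  assumes "smooth \<phi>"
  shows "partial_deriv v \<phi> = (\<lambda>x. \<Sum>b\<in>Basis. complex_of_real (v \<bullet> b) * partial_deriv b \<phi> x)"
proof
  fix x
  have "linear (frechet_derivative \<phi> (at x))"
    using smooth_has_derivative[OF assms] has_derivative_linear by blast
  then have "frechet_derivative \<phi> (at x) (\<Sum>b\<in>Basis. (v \<bullet> b) *\<^sub>R b) =
      (\<Sum>b\<in>Basis. (v \<bullet> b) *\<^sub>R frechet_derivative \<phi> (at x) b)"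
    by (simp add: linear_sum linear_cmul)
  then show "partial_deriv v \<phi> x = (\<Sum>b\<in>Basis. complex_of_real (v \<bullet> b) * partial_deriv b \<phi> x)"
    by (simp add: partial_deriv_def euclidean_representation scaleR_conv_of_real)
qed

lemma smooth_partial_deriv:
  assumes "smooth \<phi>"
  shows "smooth (partial_deriv v \<phi>)"
  unfolding partial_deriv_eq_sum[OF assms, of v]
  by (intro smooth_sum smooth_cmult smooth_partial_deriv_Basis assms)

text \<open>Having a derivative is a local property, so \<open>\<psi>\<close> inherits on
  \<open>U\<close> what is known of \<open>\<phi>\<close>.\<close>

lemma partial_derivs_cong_open:
  assumes "open U" "\<And>x. x \<in> U \<Longrightarrow> \<phi> x = \<psi> x" "x \<in> U"
    "smooth \<phi>" "set bs \<subseteq> Basis"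
  shows "partial_derivs bs \<phi> x = partial_derivs bs \<psi> x"
  using assms(5) assms(3)
proof (induction bs arbitrary: x)
  case Nil
  then show ?case using assms(2) by simp
next
  case (Cons b bs)
  have "smooth (partial_derivs bs \<phi>)"
    using Cons.prems assms(4) by (intro smooth_partial_derivs) auto
  then have D: "(partial_derivs bs \<phi> has_derivative frechet_derivative (partial_derivs bs \<phi>) (at x)) (at x)"
    by (rule smooth_has_derivative)
  have "(partial_derivs bs \<psi> has_derivative frechet_derivative (partial_derivs bs \<phi>) (at x)) (at x)"
    by (rule has_derivative_transform_within_open[OF D assms(1)]) (use Cons in auto)
  then have "frechet_derivative (partial_derivs bs \<psi>) (at x) = frechet_derivative (partial_derivs bs \<phi>) (at x)"
    by (rule frechet_derivative_at[symmetric])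
  then show ?case by (simp add: partial_deriv_def)
qed

section \<open>Sequences of derivatives and functions of one linear coordinate\<close>

lemma smooth_has_vector_derivative:
  assumes "smooth g"
  shows "(g has_vector_derivative partial_deriv 1 g t) (at t)"
proof -
  have d: "(g has_derivative frechet_derivative g (at t)) (at t)"
    using assms by (rule smooth_has_derivative)
  have "frechet_derivative g (at t) h = h *\<^sub>R partial_deriv 1 g t" for h
    using linear_cmul[OF has_derivative_linear[OF d], of h 1] by (simp add: partial_deriv_def)
  with d show ?thesis by (metis has_vector_derivative_def ext)
qed

lemma partial_deriv_ridge:
  assumes "\<And>t. (g has_vector_derivative g' t) (at t)"
  shows "((\<lambda>x. c * g (x \<bullet> \<omega>)) has_derivative (\<lambda>h. c * complex_of_real (h \<bullet> \<omega>) * g' (x \<bullet> \<omega>))) (at x)"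
    "partial_deriv b (\<lambda>x. c * g (x \<bullet> \<omega>)) = (\<lambda>x. (c * complex_of_real (b \<bullet> \<omega>)) * g' (x \<bullet> \<omega>))"
proof -
  have D: "((\<lambda>x. c * g (x \<bullet> \<omega>)) has_derivative (\<lambda>h. c * complex_of_real (h \<bullet> \<omega>) * g' (x \<bullet> \<omega>))) (at x)" for x
  proof -
    have "((\<lambda>x. x \<bullet> \<omega>) has_derivative (\<lambda>x. x \<bullet> \<omega>)) (at x)"
      by (auto intro!: derivative_eq_intros)
    from has_derivative_compose[OF this, where g=g, OF assms[unfolded has_vector_derivative_def]]
    have "((\<lambda>x. g (x \<bullet> \<omega>)) has_derivative (\<lambda>h. (h \<bullet> \<omega>) *\<^sub>R g' (x \<bullet> \<omega>))) (at x)" .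
    from has_derivative_mult_right[OF this, of c] show ?thesis
      by (simp add: scaleR_conv_of_real mult.assoc)
  qed
  then show "((\<lambda>x. c * g (x \<bullet> \<omega>)) has_derivative (\<lambda>h. c * complex_of_real (h \<bullet> \<omega>) * g' (x \<bullet> \<omega>))) (at x)" .
  show "partial_deriv b (\<lambda>x. c * g (x \<bullet> \<omega>)) = (\<lambda>x. (c * complex_of_real (b \<bullet> \<omega>)) * g' (x \<bullet> \<omega>))"
    using partial_derivI[OF D] by simp
qed

text \<open>Here \<open>g 0\<close> is the function and \<open>g k\<close> its derivative of order
  \<open>k\<close>: every differentiation releases a factor and moves one step along the
  sequence.\<close>

lemma partial_derivs_ridge:
  assumes "\<And>k t. (g k has_vector_derivative g (Suc k) t) (at t)"
  shows "partial_derivs bs (\<lambda>x. g 0 (x \<bullet> \<omega>)) =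
     (\<lambda>x. complex_of_real (\<Prod>b\<leftarrow>bs. b \<bullet> \<omega>) * g (length bs) (x \<bullet> \<omega>))"
proof (induction bs)
  case (Cons b bs)
  show ?case
    unfolding partial_derivs_simps Cons.IH partial_deriv_ridge(2)[OF assms] by (simp add: mult_ac)
qed simp

lemma smooth_ridge:
  assumes "\<And>k t. (g k has_vector_derivative g (Suc k) t) (at t)"
  shows "smooth (\<lambda>x. g 0 (x \<bullet> \<omega>))"
  unfolding smooth_def partial_derivs_ridge[of g, OF assms]
  using partial_deriv_ridge(1)[OF assms] unfolding differentiable_def by blast

text \<open>The case \<open>\<omega> = 1\<close> of the previous two lemmas; on the line a
  multi-index is determined by its length.\<close>

lemma smooth_sequence:
  fixes g :: "nat \<Rightarrow> real \<Rightarrow> complex"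
  assumes "\<And>k t. (g k has_vector_derivative g (Suc k) t) (at t)"
  shows "smooth (g 0)" "set bs \<subseteq> Basis \<Longrightarrow> partial_derivs bs (g 0) = g (length bs)"
proof -
  show "smooth (g 0)" using smooth_ridge[of g, OF assms, of "1::real"] by (simp add: inner_real_def)
  assume "set bs \<subseteq> Basis"
  then have "(\<Prod>b\<leftarrow>bs. b) = 1" by (induction bs) auto
  then show "partial_derivs bs (g 0) = g (length bs)"
    using partial_derivs_ridge[of g, OF assms, of bs "1::real"] by (simp add: inner_real_def)
qed

section \<open>Seminorm bounds for distributions\<close>

definition linear_on_smooth :: "(('a::euclidean_space \<Rightarrow> complex) \<Rightarrow> complex) \<Rightarrow> bool" where
  "linear_on_smooth u \<longleftrightarrow>
     (\<forall>\<phi> \<psi>. smooth \<phi> \<longrightarrow> smooth \<psi> \<longrightarrow> u (\<lambda>x. \<phi> x + \<psi> x) = u \<phi> + u \<psi>) \<and>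
     (\<forall>c \<phi>. smooth \<phi> \<longrightarrow> u (\<lambda>x. c * \<phi> x) = c * u \<phi>)"

text \<open>A relation instead of a supremum, so that no maximum has to be attained. Balls replace
  general compact sets, which reduces comparisons with supports and periods to comparisons of
  radii.\<close>

definition derivs_bounded :: "real \<Rightarrow> nat \<Rightarrow> ('a::euclidean_space \<Rightarrow> complex) \<Rightarrow> real \<Rightarrow> bool" where
  "derivs_bounded R N \<phi> M \<longleftrightarrow>
     (\<forall>bs. set bs \<subseteq> Basis \<longrightarrow> length bs \<le> N \<longrightarrow> (\<forall>x\<in>cball 0 R. norm (partial_derivs bs \<phi> x) \<le> M))"

text \<open>Continuity with its constants named: later estimates rely on the radius \<open>R\<close>
  and the order \<open>N\<close> surviving multiplication and push forward.\<close>

definition seminorm_bound ::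
  "(('a::euclidean_space \<Rightarrow> complex) \<Rightarrow> complex) \<Rightarrow> real \<Rightarrow> real \<Rightarrow> nat \<Rightarrow> bool" where
  "seminorm_bound u R C N \<longleftrightarrow> 0 < R \<and> 0 < C \<and>
     (\<forall>\<phi> M. smooth \<phi> \<longrightarrow> 0 \<le> M \<longrightarrow> derivs_bounded R N \<phi> M \<longrightarrow> norm (u \<phi>) \<le> C * M)"

lemma compact_distributionE:
  assumes "compact_distribution u"
  obtains R C N where "linear_on_smooth u" "seminorm_bound u R C N"
proof -
  obtain K C N where K: "compact K" and
    b: "\<And>\<phi> M. smooth \<phi> \<Longrightarrow> 0 \<le> M \<Longrightarrow>
           (\<forall>bs. set bs \<subseteq> Basis \<longrightarrow> length bs \<le> N \<longrightarrow>
              (\<forall>x\<in>K. norm (partial_derivs bs \<phi> x) \<le> M)) \<Longrightarrow>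
           norm (u \<phi>) \<le> C * M"
    using assms unfolding compact_distribution_def by blast
  obtain R where R: "0 < R" "K \<subseteq> cball 0 R"
    using K compact_imp_bounded bounded_subset_ballD ball_subset_cball by (metis subset_trans)
  have "norm (u \<phi>) \<le> max C 1 * M"
    if "smooth \<phi>" "0 \<le> M" "derivs_bounded R N \<phi> M" for \<phi> M
  proof -
    have "norm (u \<phi>) \<le> C * M"
      using that R b[of \<phi> M] unfolding derivs_bounded_def by blast
    also have "\<dots> \<le> max C 1 * M" using that by (intro mult_right_mono) auto
    finally show ?thesis .
  qed
  then have "seminorm_bound u R (max C 1) N"
    using R unfolding seminorm_bound_def by auto
  moreover have "linear_on_smooth u"
    using assms unfolding compact_distribution_def linear_on_smooth_def by blast
  ultimately show thesis using that by blast
qed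

lemma seminorm_boundD:
  "seminorm_bound u R C N \<Longrightarrow> smooth \<phi> \<Longrightarrow> 0 \<le> M \<Longrightarrow> derivs_bounded R N \<phi> M \<Longrightarrow> norm (u \<phi>) \<le> C * M"
  unfolding seminorm_bound_def by blast

context
  fixes u :: "('a::euclidean_space \<Rightarrow> complex) \<Rightarrow> complex"
  assumes lin: "linear_on_smooth u"
begin

lemma linear_on_smooth_add: "smooth \<phi> \<Longrightarrow> smooth \<psi> \<Longrightarrow> u (\<lambda>x. \<phi> x + \<psi> x) = u \<phi> + u \<psi>"
  using lin unfolding linear_on_smooth_def by blast

lemma linear_on_smooth_cmult: "smooth \<phi> \<Longrightarrow> u (\<lambda>x. c * \<phi> x) = c * u \<phi>"
  using lin unfolding linear_on_smooth_def by blast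

lemma linear_on_smooth_diff: "smooth \<phi> \<Longrightarrow> smooth \<psi> \<Longrightarrow> u (\<lambda>x. \<phi> x - \<psi> x) = u \<phi> - u \<psi>"
  using linear_on_smooth_add[of \<phi> "\<lambda>x. (-1) * \<psi> x"] linear_on_smooth_cmult[of \<psi> "-1"]
    smooth_cmult[of \<psi> "-1"] by simp

lemma linear_on_smooth_zero: "u (\<lambda>x. 0) = 0"
  using linear_on_smooth_cmult[of "\<lambda>x. 0" 0] by simp

lemma linear_on_smooth_sum:
  "(\<And>i. i \<in> I \<Longrightarrow> smooth (\<phi> i)) \<Longrightarrow> u (\<lambda>x. \<Sum>i\<in>I. \<phi> i x) = (\<Sum>i\<in>I. u (\<phi> i))"
proof (induction I rule: infinite_finite_induct)
  case (insert i I)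
  then show ?case by (simp add: linear_on_smooth_add smooth_sum)
qed (simp_all add: linear_on_smooth_zero)

text \<open>The difference vanishes on an open neighbourhood of the ball of radius \<open>R\<close>,
  hence so do its derivatives; the strict inequality of radii supplies the neighbourhood.\<close>

lemma seminorm_bound_local:
  assumes "seminorm_bound u R C N" "smooth \<phi>" "smooth \<psi>" "R < R'"
    "\<And>x. norm x < R' \<Longrightarrow> \<phi> x = \<psi> x"
  shows "u \<phi> = u \<psi>"
proof -
  have sm: "smooth (\<lambda>x. \<phi> x - \<psi> x)" using assms by (intro smooth_diff)
  have "derivs_bounded R N (\<lambda>x. \<phi> x - \<psi> x) 0"
    unfolding derivs_bounded_def
  proof (intro allI impI ballI)
    fix bs :: "'a list" and x :: 'a
    assume bs: "set bs \<subseteq> Basis" "length bs \<le> N" "x \<in> cball 0 R"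
    have z: "partial_derivs bs (\<lambda>x. 0) = (\<lambda>x. 0)"
      using partial_derivs_cmult[of "\<lambda>x. 0" bs 0] bs by simp
    have "partial_derivs bs (\<lambda>x. \<phi> x - \<psi> x) x = partial_derivs bs (\<lambda>x. 0) x"
      by (rule partial_derivs_cong_open[of "ball 0 R'"]) (use sm assms bs in auto)
    then show "norm (partial_derivs bs (\<lambda>x. \<phi> x - \<psi> x) x) \<le> 0" using z by simp
  qed
  from seminorm_boundD[OF assms(1) sm _ this] have "u (\<lambda>x. \<phi> x - \<psi> x) = 0" by simp
  then show ?thesis using linear_on_smooth_diff assms by simp
qed

end

lemma derivs_boundedD:
  "derivs_bounded R N \<phi> M \<Longrightarrow> set bs \<subseteq> Basis \<Longrightarrow> length bs \<le> N \<Longrightarrow> x \<in> cball 0 R \<Longrightarrow>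
    norm (partial_derivs bs \<phi> x) \<le> M"
  unfolding derivs_bounded_def by blast

lemma derivs_bounded_mono: "derivs_bounded R N \<phi> M \<Longrightarrow> n \<le> N \<Longrightarrow> M \<le> M' \<Longrightarrow> derivs_bounded R n \<phi> M'"
  unfolding derivs_bounded_def by (meson order_trans)

lemma derivs_bounded_partial_deriv:
  fixes \<phi> :: "'a::euclidean_space \<Rightarrow> complex"
  assumes "derivs_bounded R (Suc N) \<phi> M" "b \<in> Basis"
  shows "derivs_bounded R N (partial_deriv b \<phi>) M"
  unfolding derivs_bounded_def
proof (intro allI impI ballI)
  fix bs :: "'a list" and x :: 'a
  assume "set bs \<subseteq> Basis" "length bs \<le> N" "x \<in> cball 0 R"
  then show "norm (partial_derivs bs (partial_deriv b \<phi>) x) \<le> M"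
    using derivs_boundedD[OF assms(1), of "bs @ [b]" x] assms(2) by (simp add: partial_derivs_append)
qed

lemma derivs_bounded_add:
  assumes "derivs_bounded R N \<phi> M" "derivs_bounded R N \<psi> M'" "smooth \<phi>" "smooth \<psi>"
  shows "derivs_bounded R N (\<lambda>x. \<phi> x + \<psi> x) (M + M')"
  using assms unfolding derivs_bounded_def
  by (auto simp: partial_derivs_add intro!: norm_triangle_mono)

lemma derivs_bounded_cmult:
  assumes "derivs_bounded R N \<phi> M" "smooth \<phi>"
  shows "derivs_bounded R N (\<lambda>x. c * \<phi> x) (norm c * M)"
  using assms unfolding derivs_bounded_def
  by (auto simp: partial_derivs_cmult norm_mult intro!: mult_left_mono)

text \<open>The derivative split off is the innermost one, acting on \<open>\<phi>\<close> itself,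
  where inductions on the order can apply the product rule.\<close>

lemma derivs_bounded_SucI:
  fixes \<phi> :: "'a::euclidean_space \<Rightarrow> complex"
  assumes "\<And>x. x \<in> cball 0 R \<Longrightarrow> norm (\<phi> x) \<le> M"
    and "\<And>b. b \<in> Basis \<Longrightarrow> derivs_bounded R N (partial_deriv b \<phi>) M"
  shows "derivs_bounded R (Suc N) \<phi> M"
  unfolding derivs_bounded_def
proof (intro allI impI ballI)
  fix bs :: "'a list" and x :: 'a
  assume bs: "set bs \<subseteq> Basis" "length bs \<le> Suc N" "x \<in> cball 0 R"
  show "norm (partial_derivs bs \<phi> x) \<le> M"
  proof (cases bs rule: rev_cases)
    case Nil
    then show ?thesis using assms(1) bs by simp
  next
    case (snoc cs b)
    then show ?thesis
      using derivs_boundedD[OF assms(2), of b cs x] bs by (simp add: partial_derivs_append)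
  qed
qed

lemma bounded_on_cball:
  fixes \<phi> :: "'a::euclidean_space \<Rightarrow> 'b::real_normed_vector"
  assumes "continuous_on (cball 0 R) \<phi>"
  obtains A where "A > 0" "\<And>x. x \<in> cball 0 R \<Longrightarrow> norm (\<phi> x) \<le> A"
proof -
  have "bounded (\<phi> ` cball 0 R)"
    by (intro compact_imp_bounded compact_continuous_image assms compact_cball)
  then obtain A where "A > 0" "\<forall>y\<in>\<phi> ` cball 0 R. norm y \<le> A"
    by (auto simp: bounded_pos)
  then show thesis by (intro that[of A]) simp_all
qed

text \<open>The Leibniz rule by induction on the order; \<open>a\<close> must vary in the induction,
  because the rule replaces it by its partial derivatives.\<close>

lemma derivs_bounded_mult:
  fixes a :: "'a::euclidean_space \<Rightarrow> complex"
  assumes "smooth a"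
  shows "\<exists>A>0. \<forall>\<phi> M. smooth \<phi> \<longrightarrow> 0 \<le> M \<longrightarrow> derivs_bounded R N \<phi> M \<longrightarrow>
     derivs_bounded R N (\<lambda>x. a x * \<phi> x) (A * M)"
  using assms
proof (induction N arbitrary: a)
  case 0
  obtain A where A: "A > 0" "\<And>x. x \<in> cball 0 R \<Longrightarrow> norm (a x) \<le> A"
    using bounded_on_cball[OF smooth_continuous_on[OF 0], where R=R] by metis
  then show ?case
    by (intro exI[of _ A]) (auto simp: derivs_bounded_def norm_mult intro!: mult_mono)
next
  case (Suc N)
  obtain A where A: "A > 0" "\<And>x. x \<in> cball 0 R \<Longrightarrow> norm (a x) \<le> A"
    using bounded_on_cball[OF smooth_continuous_on[OF Suc.prems], where R=R] by metis
  obtain A1 where A1: "A1 > 0" "\<And>\<phi> M. smooth \<phi> \<Longrightarrow> 0 \<le> M \<Longrightarrow> derivs_bounded R N \<phi> M \<Longrightarrow>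
     derivs_bounded R N (\<lambda>x. a x * \<phi> x) (A1 * M)"
    using Suc.IH[OF Suc.prems] by blast
  have "\<forall>b\<in>Basis. \<exists>A2>0. \<forall>\<phi> M. smooth \<phi> \<longrightarrow> 0 \<le> M \<longrightarrow> derivs_bounded R N \<phi> M \<longrightarrow>
     derivs_bounded R N (\<lambda>x. partial_deriv b a x * \<phi> x) (A2 * M)"
    using Suc.IH smooth_partial_deriv_Basis Suc.prems by blast
  then obtain A2 where A2: "\<And>b. b \<in> Basis \<Longrightarrow> A2 b > 0"
    "\<And>b \<phi> M. b \<in> Basis \<Longrightarrow> smooth \<phi> \<Longrightarrow> 0 \<le> M \<Longrightarrow> derivs_bounded R N \<phi> M \<Longrightarrow>
     derivs_bounded R N (\<lambda>x. partial_deriv b a x * \<phi> x) (A2 b * M)"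
    by metis
  define B where "B = A + A1 + (\<Sum>b\<in>Basis. A2 b)"
  have S: "0 \<le> (\<Sum>b\<in>Basis. A2 b)" using A2(1) by (intro sum_nonneg) (auto intro: less_imp_le)
  have "derivs_bounded R (Suc N) (\<lambda>x. a x * \<phi> x) (B * M)"
    if \<phi>: "smooth \<phi>" "0 \<le> M" "derivs_bounded R (Suc N) \<phi> M" for \<phi> M
  proof (rule derivs_bounded_SucI)
    fix x :: 'a assume x: "x \<in> cball 0 R"
    have "norm (a x * \<phi> x) \<le> A * M"
      unfolding norm_mult using A x derivs_boundedD[OF \<phi>(3), of "[]" x] by (intro mult_mono) auto
    also have "\<dots> \<le> B * M" using that S A1 by (intro mult_right_mono) (auto simp: B_def)
    finally show "norm (a x * \<phi> x) \<le> B * M" .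
  next
    fix b :: 'a assume b: "b \<in> Basis"
    have 1: "derivs_bounded R N (\<lambda>x. a x * partial_deriv b \<phi> x) (A1 * M)"
      using \<phi> b by (intro A1 smooth_partial_deriv_Basis derivs_bounded_partial_deriv)
    have 2: "derivs_bounded R N (\<lambda>x. partial_deriv b a x * \<phi> x) (A2 b * M)"
      using \<phi> b derivs_bounded_mono[OF \<phi>(3), of N M] by (intro A2) auto
    have "A2 b \<le> (\<Sum>b\<in>Basis. A2 b)"
      using b A2(1) by (intro member_le_sum) (auto intro: less_imp_le)
    then have "(A1 + A2 b) * M \<le> B * M"
      using \<phi> A by (intro mult_right_mono) (auto simp: B_def)
    moreover have "derivs_bounded R N (partial_deriv b (\<lambda>x. a x * \<phi> x)) (A1 * M + A2 b * M)"
      unfolding partial_deriv_mult[OF Suc.prems \<phi>(1)]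
      using 1 2 by (rule derivs_bounded_add)
        (intro smooth_mult Suc.prems \<phi> smooth_partial_deriv_Basis b)+
    ultimately show "derivs_bounded R N (partial_deriv b (\<lambda>x. a x * \<phi> x)) (B * M)"
      by (auto elim!: derivs_bounded_mono simp: algebra_simps)
  qed
  moreover have "B > 0" using A A1 S by (simp add: B_def)
  ultimately show ?case by blast
qed

lemma linear_on_smooth_mult:
  fixes a :: "'a::euclidean_space \<Rightarrow> complex"
  assumes "linear_on_smooth u" "smooth a"
  shows "linear_on_smooth (\<lambda>\<phi>. u (\<lambda>x. a x * \<phi> x))"
  unfolding linear_on_smooth_def
proof (intro conjI allI impI)
  fix \<phi> \<psi> :: "'a \<Rightarrow> complex" and c assume "smooth \<phi>"
  then show "u (\<lambda>x. a x * (c * \<phi> x)) = c * u (\<lambda>x. a x * \<phi> x)"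
    using linear_on_smooth_cmult[OF assms(1) smooth_mult[OF assms(2)], of \<phi> c] by (simp add: mult_ac)
  assume "smooth \<psi>"
  with \<open>smooth \<phi>\<close> show "u (\<lambda>x. a x * (\<phi> x + \<psi> x)) = u (\<lambda>x. a x * \<phi> x) + u (\<lambda>x. a x * \<psi> x)"
    using linear_on_smooth_add[OF assms(1) smooth_mult[OF assms(2)] smooth_mult[OF assms(2)], of \<phi> \<psi>]
    by (simp add: algebra_simps)
qed

lemma seminorm_bound_mult:
  assumes "seminorm_bound u R C N" "smooth a"
  shows "\<exists>C'. seminorm_bound (\<lambda>\<phi>. u (\<lambda>x. a x * \<phi> x)) R C' N"
proof -
  obtain A where A: "A > 0" "\<And>\<phi> M. smooth \<phi> \<Longrightarrow> 0 \<le> M \<Longrightarrow> derivs_bounded R N \<phi> M \<Longrightarrow>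
     derivs_bounded R N (\<lambda>x. a x * \<phi> x) (A * M)"
    using derivs_bounded_mult[OF assms(2)] by blast
  have "norm (u (\<lambda>x. a x * \<phi> x)) \<le> (C * A) * M"
    if "smooth \<phi>" "0 \<le> M" "derivs_bounded R N \<phi> M" for \<phi> M
    using seminorm_boundD[OF assms(1) smooth_mult[OF assms(2) that(1)] _ A(2)[OF that]] A(1) that
    by (simp add: mult.assoc)
  moreover have "0 < C * A" "0 < R" using assms(1) A by (auto simp: seminorm_bound_def)
  ultimately show ?thesis unfolding seminorm_bound_def by blast
qed

text \<open>Treating the wave as a general smooth factor would hide its frequency. A derivative of
  wave times \<open>\<phi>\<close> is again the wave times some \<open>\<psi>\<close>, larger by at
  most the factor \<open>1 + norm \<xi>\<close>, so each order costs one such factor.\<close>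

lemma derivs_bounded_plane_wave_mult:
  fixes \<phi> :: "'a::euclidean_space \<Rightarrow> complex"
  assumes "smooth \<phi>" "0 \<le> M" "derivs_bounded R N \<phi> M"
  shows "derivs_bounded R N (\<lambda>x. exp (- \<i> * complex_of_real (x \<bullet> \<xi>)) * \<phi> x) ((1 + norm \<xi>) ^ N * M)"
  using assms
proof (induction N arbitrary: \<phi> M)
  case 0
  then show ?case by (auto simp: derivs_bounded_def norm_mult)
next
  case (Suc N)
  let ?e = "\<lambda>x. exp (- \<i> * complex_of_real (x \<bullet> \<xi>))"
  have 1: "(1 + norm \<xi>) ^ Suc N \<ge> 1" by (rule one_le_power) simp
  show ?case
  proof (rule derivs_bounded_SucI)
    fix x :: 'a assume "x \<in> cball 0 R"
    then have "norm (?e x * \<phi> x) \<le> 1 * M"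
      using derivs_boundedD[OF Suc.prems(3), of "[]" x] by (simp add: norm_mult)
    also have "\<dots> \<le> (1 + norm \<xi>) ^ Suc N * M" using 1 Suc.prems by (intro mult_right_mono) auto
    finally show "norm (?e x * \<phi> x) \<le> (1 + norm \<xi>) ^ Suc N * M" .
  next
    fix b :: 'a assume b: "b \<in> Basis"
    define \<psi> where "\<psi> = (\<lambda>x. partial_deriv b \<phi> x + (- \<i> * complex_of_real (b \<bullet> \<xi>)) * \<phi> x)"
    have sm: "smooth \<psi>"
      unfolding \<psi>_def by (intro smooth_add smooth_cmult smooth_partial_deriv_Basis Suc.prems b)
    have "norm (- \<i> * complex_of_real (b \<bullet> \<xi>)) * M \<le> norm \<xi> * M"
      using Suc.prems(2) Basis_le_norm[OF b, of \<xi>]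
      by (intro mult_right_mono) (auto simp: norm_mult inner_commute)
    moreover have "derivs_bounded R N \<psi> (M + norm (- \<i> * complex_of_real (b \<bullet> \<xi>)) * M)"
      unfolding \<psi>_def
      using Suc.prems b derivs_bounded_mono[OF Suc.prems(3), of N M]
      by (intro derivs_bounded_add derivs_bounded_cmult smooth_cmult smooth_partial_deriv_Basis
          derivs_bounded_partial_deriv) auto
    ultimately have "derivs_bounded R N \<psi> ((1 + norm \<xi>) * M)"
      by (auto elim!: derivs_bounded_mono simp: algebra_simps)
    from Suc.IH[OF sm _ this] Suc.prems(2)
    have "derivs_bounded R N (\<lambda>x. ?e x * \<psi> x) ((1 + norm \<xi>) ^ Suc N * M)"
      by (simp add: mult_ac)
    moreover have "partial_deriv b (\<lambda>x. ?e x * \<phi> x) = (\<lambda>x. ?e x * \<psi> x)"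
      unfolding partial_deriv_mult[OF smooth_plane_wave Suc.prems(1)] partial_deriv_plane_wave
      by (simp add: \<psi>_def algebra_simps)
    ultimately show "derivs_bounded R N (partial_deriv b (\<lambda>x. ?e x * \<phi> x)) ((1 + norm \<xi>) ^ Suc N * M)"
      by simp
  qed
qed

lemma derivs_bounded_const_one: "derivs_bounded R N (\<lambda>x::'a::euclidean_space. 1) 1"
proof -
  have "partial_derivs bs (\<lambda>x. 1) = (\<lambda>x::'a. 0)" if "bs \<noteq> []" for bs
    using that
  proof (induction bs)
    case (Cons b bs)
    have "partial_deriv b (\<lambda>x::'a. c) = (\<lambda>x. 0)" for c
      by (rule partial_derivI) (rule has_derivative_const)
    then show ?case using Cons by (cases "bs = []") auto
  qed simp
  then show ?thesis unfolding derivs_bounded_def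
    by (metis norm_one norm_zero order_refl partial_derivs_simps(1) zero_le_one)
qed

text \<open>The Paley-Wiener-Schwartz growth bound at real frequencies: the Fourier transform of a
  compactly supported distribution grows at most polynomially.\<close>

lemma seminorm_bound_plane_wave:
  assumes "seminorm_bound u R C N"
  shows "norm (u (\<lambda>x. exp (- \<i> * complex_of_real (x \<bullet> \<xi>)))) \<le> C * (1 + norm \<xi>) ^ N"
  using seminorm_boundD[OF assms smooth_plane_wave[of \<xi>], of "(1 + norm \<xi>) ^ N"]
    derivs_bounded_plane_wave_mult[OF smooth_const[of 1] _ derivs_bounded_const_one, of R N \<xi>]
  by simp

lemma smooth_radon_pullback:
  assumes "smooth (g :: real \<Rightarrow> complex)"
  shows "smooth (\<lambda>x. g (x \<bullet> \<omega>))"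
  using assms smooth_of_real_inner by (rule smooth_compose)

lemma smooth_derivative_sequence:
  assumes "smooth (g :: real \<Rightarrow> complex)"
  shows "((partial_deriv 1 ^^ k) g has_vector_derivative (partial_deriv 1 ^^ Suc k) g t) (at t)"
proof -
  have "smooth ((partial_deriv 1 ^^ k) g)"
    by (induction k) (auto simp: assms smooth_partial_deriv_Basis)
  then show ?thesis by (simp add: smooth_has_vector_derivative)
qed

text \<open>Neither the bound nor the radius deteriorates: the components of \<open>\<omega>\<close>
  are at most \<open>1\<close> in absolute value, and
  \<open>\<bar>x \<bullet> \<omega>\<bar>\<close> does not exceed \<open>norm x\<close>.\<close>

lemma derivs_bounded_ridge:
  fixes \<omega> :: "'a::euclidean_space"
  assumes "smooth g" "derivs_bounded R N g M" "norm \<omega> \<le> 1"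
  shows "derivs_bounded R N (\<lambda>x. g (x \<bullet> \<omega>)) M"
  unfolding derivs_bounded_def
proof (intro allI impI ballI)
  fix bs :: "'a list" and x :: 'a
  assume bs: "set bs \<subseteq> Basis" "length bs \<le> N" and x: "x \<in> cball 0 R"
  define G where "G k = (partial_deriv 1 ^^ k) g" for k
  have G: "(G k has_vector_derivative G (Suc k) t) (at t)" for k t
    using smooth_derivative_sequence[OF assms(1)] by (simp add: G_def)
  have e: "G 0 = g" by (simp add: G_def)
  have p: "\<bar>\<Prod>b\<leftarrow>bs. b \<bullet> \<omega>\<bar> \<le> 1" using bs(1)
  proof (induction bs)
    case (Cons b bs)
    have "\<bar>b \<bullet> \<omega>\<bar> \<le> 1"
      using Basis_le_norm[of b \<omega>] Cons.prems assms(3) by (simp add: inner_commute)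
    then show ?case using Cons by (simp add: abs_mult mult_le_one)
  qed simp
  have "\<bar>x \<bullet> \<omega>\<bar> \<le> norm x * norm \<omega>" by (rule Cauchy_Schwarz_ineq2)
  also have "\<dots> \<le> R * 1" using x assms(3) order_trans[OF norm_ge_zero[of x]] by (intro mult_mono) auto
  finally have "x \<bullet> \<omega> \<in> cball 0 R" by simp
  then have "norm (partial_derivs (replicate (length bs) 1) g (x \<bullet> \<omega>)) \<le> M"
    using bs by (intro derivs_boundedD[OF assms(2)]) auto
  moreover have "set (replicate (length bs) (1::real)) \<subseteq> Basis" by auto
  ultimately have g: "norm (G (length bs) (x \<bullet> \<omega>)) \<le> M"
    using smooth_sequence(2)[of G, OF G] e by (metis length_replicate)
  have "norm (partial_derivs bs (\<lambda>x. G 0 (x \<bullet> \<omega>)) x) \<le> 1 * M"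
    unfolding partial_derivs_ridge[of G, OF G] norm_mult norm_of_real
    using p g by (intro mult_mono) auto
  then show "norm (partial_derivs bs (\<lambda>x. g (x \<bullet> \<omega>)) x) \<le> M" using e by simp
qed

lemma linear_on_smooth_radon_dist:
  assumes "linear_on_smooth u"
  shows "linear_on_smooth (radon_dist u \<omega>)"
  unfolding linear_on_smooth_def radon_dist_def
  by (intro conjI allI impI linear_on_smooth_add[OF assms] linear_on_smooth_cmult[OF assms]
      smooth_radon_pullback)

lemma seminorm_bound_radon_dist:
  assumes "seminorm_bound u R C N" "norm \<omega> \<le> 1"
  shows "seminorm_bound (radon_dist u \<omega>) R C N"
  using assms derivs_bounded_ridge[OF _ _ assms(2)] smooth_radon_pullback
  unfolding seminorm_bound_def radon_dist_def by blast

lemma derivs_bounded_sequence: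
  fixes g :: "nat \<Rightarrow> real \<Rightarrow> complex"
  assumes "\<And>k t. (g k has_vector_derivative g (Suc k) t) (at t)"
    and "\<And>k t. k \<le> N \<Longrightarrow> \<bar>t\<bar> \<le> R \<Longrightarrow> norm (g k t) \<le> M"
  shows "derivs_bounded R N (g 0) M"
  using smooth_sequence(2)[of g, OF assms(1)] assms(2) unfolding derivs_bounded_def by auto

section \<open>Bump functions and shifts of cones\<close>

text \<open>Derivatives of \<open>exp (- (1 / t))\<close> are products with polynomials in
  \<open>1 / t\<close>; admitting all polynomials makes the family stable under
  differentiation.\<close>

definition flat :: "real poly \<Rightarrow> real \<Rightarrow> real" where
  "flat p t = (if 0 < t then poly p (1 / t) * exp (- (1 / t)) else 0)"

lemma poly_div_exp_tendsto_0: "((\<lambda>x::real. poly p x / exp x) \<longlongrightarrow> 0) at_top"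
proof -
  have "((\<lambda>x::real. \<Sum>i\<le>degree p. coeff p i * (x ^ i / exp x)) \<longlongrightarrow> (\<Sum>i\<le>degree p. coeff p i * 0)) at_top"
    by (intro tendsto_sum tendsto_mult tendsto_const tendsto_power_div_exp_0)
  then show ?thesis by (simp add: poly_altdef sum_divide_distrib)
qed

text \<open>For positive \<open>t\<close> this is the chain rule in the variable
  \<open>1 / t\<close>, whose own derivative supplies \<open>monom 1 2\<close>. At \<open>0\<close>
  the exponential beats every polynomial.\<close>

lemma flat_deriv: "(flat p has_real_derivative flat (monom 1 2 * (p - pderiv p)) t) (at t)"
proof -
  consider "t < 0" | "t = 0" | "0 < t" by linarith
  then show ?thesis
  proof cases
    case 1
    have "((\<lambda>_. 0) has_real_derivative 0) (at t)" by simp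
    then have "(flat p has_real_derivative 0) (at t)"
      by (rule has_field_derivative_transform_within_open[of _ _ _ "{..<0}"]) (use 1 in \<open>auto simp: flat_def\<close>)
    then show ?thesis using 1 by (simp add: flat_def)
  next
    case 2
    \<comment> \<open>\<open>pCons 0 p\<close> is \<open>p\<close> times its variable; it absorbs
      the division by \<open>h\<close> in the difference quotient.\<close>
    have "((\<lambda>h. poly (pCons 0 p) (inverse h) / exp (inverse h)) \<longlongrightarrow> 0) (at_right 0)"
      using filterlim_compose[OF poly_div_exp_tendsto_0 filterlim_inverse_at_top_right] .
    then have "((\<lambda>h. flat p h / h) \<longlongrightarrow> 0) (at_right 0)"
      by (rule Lim_transform_eventually)
        (auto simp: flat_def eventually_at_filter exp_minus divide_simps intro!: always_eventually)
    moreover have "((\<lambda>h. flat p h / h) \<longlongrightarrow> 0) (at_left 0)"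
      by (rule Lim_transform_eventually[OF tendsto_const])
        (auto simp: flat_def eventually_at_filter intro!: always_eventually)
    ultimately have "((\<lambda>h. flat p h / h) \<longlongrightarrow> 0) (at 0)"
      by (simp add: filterlim_split_at)
    then show ?thesis using 2 by (simp add: has_field_derivative_iff flat_def)
  next
    case 3
    have "((\<lambda>t. poly p (1 / t) * exp (- (1 / t))) has_real_derivative
       flat (monom 1 2 * (p - pderiv p)) t) (at t)"
      using 3
      by (auto intro!: derivative_eq_intros simp: flat_def poly_monom)
        (simp add: field_simps power2_eq_square)
    then show ?thesis
      by (rule has_field_derivative_transform_within_open[of _ _ _ "{0<..}"]) (use 3 in \<open>auto simp: flat_def\<close>)
  qed
qed

lemma smooth_flat: "smooth (\<lambda>t. complex_of_real (flat p t))"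
proof (rule smooth_coinduct[where S = "range (\<lambda>p t. complex_of_real (flat p t))"])
  have D: "((\<lambda>t. complex_of_real (flat p t)) has_derivative
      (\<lambda>h. complex_of_real (h * flat (monom 1 2 * (p - pderiv p)) t))) (at t)" for p t
  proof -
    have "(\<lambda>h. h * flat (monom 1 2 * (p - pderiv p)) t) = (*) (flat (monom 1 2 * (p - pderiv p)) t)"
      by (rule ext) (rule mult.commute)
    then show ?thesis
      using flat_deriv[of p t] unfolding has_field_derivative_def
      by (intro has_derivative_of_real) (simp only:)
  qed
  fix \<phi> assume "\<phi> \<in> range (\<lambda>p t. complex_of_real (flat p t))"
  then obtain p where p: "\<phi> = (\<lambda>t. complex_of_real (flat p t))" by blast
  show "\<phi> differentiable at t" for t
    using D unfolding p differentiable_def by blast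
  fix b :: real assume "b \<in> Basis"
  then have "partial_deriv b \<phi> = (\<lambda>t. complex_of_real (flat (monom 1 2 * (p - pderiv p)) t))"
    using partial_derivI[OF D] by (simp add: p)
  then show "partial_deriv b \<phi> \<in> range (\<lambda>p t. complex_of_real (flat p t))" by blast
qed blast

text \<open>Positive exactly on the positive half line. Composed with
  \<open>r\<^sup>2 - (norm x)\<^sup>2\<close> it yields a cutoff, with the opposite sign a smooth
  function that vanishes precisely on a ball.\<close>

definition bump :: "real \<Rightarrow> real" where
  "bump t = flat 1 t"

lemma bump_pos: "0 < t \<Longrightarrow> 0 < bump t" and bump_zero: "t \<le> 0 \<Longrightarrow> bump t = 0"
  and bump_nonneg: "0 \<le> bump t"
  by (auto simp: bump_def flat_def)

lemma smooth_bump: "smooth (\<lambda>t. complex_of_real (bump t))"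
  unfolding bump_def by (rule smooth_flat)

lemma smooth_bump_compose:
  "smooth (\<lambda>x. complex_of_real (q x)) \<Longrightarrow> smooth (\<lambda>x. complex_of_real (bump (q x)))"
  by (rule smooth_compose[OF smooth_bump])

text \<open>A shift by \<nu> that is short compared with \<alpha> keeps the frequency in the cone,
  where \<open>w\<close> decays. For a long shift, \<alpha> is at most a multiple of
  \<open>norm \<nu>\<close>, and powers of \<open>1 + norm \<nu>\<close> pay for the weight and for
  the growth of \<open>w\<close>.\<close>

lemma cone_shift_bound:
  fixes w :: "'a::real_normed_vector \<Rightarrow> complex"
  assumes growth: "\<And>\<zeta>. norm (w \<zeta>) \<le> C0 * (1 + norm \<zeta>) ^ N0"
    and \<Gamma>: "open_cone \<Gamma>" "e \<in> \<Gamma>" "norm e = 1"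
    and decay: "\<And>N::nat. \<exists>C. \<forall>\<zeta>\<in>\<Gamma>. (1 + norm \<zeta>) ^ N * norm (w \<zeta>) \<le> C"
  shows "\<exists>C M'. 0 < C \<and> (\<forall>\<alpha> \<nu>. 0 \<le> \<alpha> \<longrightarrow> (1 + \<alpha>) ^ M * norm (w (\<alpha> *\<^sub>R e - \<nu>)) \<le> C * (1 + norm \<nu>) ^ M')"
proof -
  obtain c where c: "0 < c" "ball e c \<subseteq> \<Gamma>"
    using \<Gamma> unfolding open_cone_def by (meson openE)
  \<comment> \<open>\<open>c\<close> keeps the shifted frequency in the cone; \<open>1/2\<close>
    keeps its norm at least \<alpha> / 2, so that decay in the norm is decay in \<alpha>.\<close>
  define d where "d = min c (1/2)"
  have d: "0 < d" "d \<le> 1/2" "ball e d \<subseteq> \<Gamma>"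
    using c by (auto simp: d_def)
  obtain C1 where C1: "\<And>\<zeta>. \<zeta> \<in> \<Gamma> \<Longrightarrow> (1 + norm \<zeta>) ^ M * norm (w \<zeta>) \<le> C1"
    using decay by blast
  have "norm (w 0) \<le> C0" using growth[of 0] by simp
  then have C0: "0 \<le> C0" using norm_ge_zero[of "w 0"] by linarith
  define C where "C = 2 ^ M * \<bar>C1\<bar> + C0 / d ^ (M + N0) + 1"
  have Cpos: "0 < C" using C0 d by (simp add: C_def add_nonneg_pos)
  have "(1 + \<alpha>) ^ M * norm (w (\<alpha> *\<^sub>R e - \<nu>)) \<le> C * (1 + norm \<nu>) ^ (M + N0 + N0)"
    if \<alpha>: "0 \<le> \<alpha>" for \<alpha> \<nu>
  proof (cases "norm \<nu> < d * \<alpha>")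
    case True
    then have \<alpha>0: "0 < \<alpha>" using \<alpha> d by (cases "\<alpha> = 0") auto
    have "dist e (e - (1 / \<alpha>) *\<^sub>R \<nu>) < d"
      using True \<alpha>0 by (simp add: dist_norm divide_simps mult.commute)
    then have "e - (1 / \<alpha>) *\<^sub>R \<nu> \<in> \<Gamma>" using d by auto
    then have "\<alpha> *\<^sub>R (e - (1 / \<alpha>) *\<^sub>R \<nu>) \<in> \<Gamma>" using \<Gamma>(1) \<alpha>0 unfolding open_cone_def by blast
    then have in\<Gamma>: "\<alpha> *\<^sub>R e - \<nu> \<in> \<Gamma>" using \<alpha>0 by (simp add: algebra_simps)
    have "d * \<alpha> \<le> \<alpha> / 2" using d \<alpha>0 by (simp add: field_simps)
    moreover have "norm (\<alpha> *\<^sub>R e) - norm \<nu> \<le> norm (\<alpha> *\<^sub>R e - \<nu>)" by (rule norm_triangle_ineq2)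
    moreover have "norm (\<alpha> *\<^sub>R e) = \<alpha>" using \<Gamma>(3) \<alpha> by simp
    ultimately have "1 + \<alpha> \<le> 2 * (1 + norm (\<alpha> *\<^sub>R e - \<nu>))" using True by argo
    then have "(1 + \<alpha>) ^ M \<le> (2 * (1 + norm (\<alpha> *\<^sub>R e - \<nu>))) ^ M" using \<alpha> by (intro power_mono) auto
    then have "(1 + \<alpha>) ^ M * norm (w (\<alpha> *\<^sub>R e - \<nu>)) \<le>
       (2 * (1 + norm (\<alpha> *\<^sub>R e - \<nu>))) ^ M * norm (w (\<alpha> *\<^sub>R e - \<nu>))"
      by (intro mult_right_mono) auto
    also have "\<dots> = 2 ^ M * ((1 + norm (\<alpha> *\<^sub>R e - \<nu>)) ^ M * norm (w (\<alpha> *\<^sub>R e - \<nu>)))"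
      by (simp only: power_mult_distrib mult.assoc)
    also have "\<dots> \<le> 2 ^ M * \<bar>C1\<bar>" using C1[OF in\<Gamma>] by (intro mult_left_mono) auto
    also have "\<dots> \<le> C" using C0 d by (simp add: C_def)
    also have "\<dots> = C * 1" by simp
    also have "\<dots> \<le> C * (1 + norm \<nu>) ^ (M + N0 + N0)"
      using Cpos by (intro mult_left_mono one_le_power) auto
    finally show ?thesis .
  next
    case False
    have n: "norm (\<alpha> *\<^sub>R e - \<nu>) \<le> \<alpha> + norm \<nu>"
      using norm_triangle_ineq4[of "\<alpha> *\<^sub>R e" \<nu>] \<Gamma>(3) \<alpha> by simp
    \<comment> \<open>Weight and growth together are \<open>M + N0\<close> powers of
      \<open>1 + \<alpha>\<close>, which this inequality converts into powers of
      \<open>1 + norm \<nu>\<close>.\<close>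
    have "d * (1 + \<alpha>) \<le> 1 + norm \<nu>" using False d \<alpha> by (simp add: algebra_simps)
    then have a: "1 + \<alpha> \<le> (1 + norm \<nu>) / d" using d by (simp add: field_simps)
    have "1 + norm (\<alpha> *\<^sub>R e - \<nu>) \<le> (1 + \<alpha>) * (1 + norm \<nu>)"
      using n mult_nonneg_nonneg[OF \<alpha> norm_ge_zero[of \<nu>]] unfolding ring_distribs by linarith
    then have "(1 + norm (\<alpha> *\<^sub>R e - \<nu>)) ^ N0 \<le> ((1 + \<alpha>) * (1 + norm \<nu>)) ^ N0"
      by (intro power_mono) auto
    then have "norm (w (\<alpha> *\<^sub>R e - \<nu>)) \<le> C0 * ((1 + \<alpha>) * (1 + norm \<nu>)) ^ N0"
      using growth[of "\<alpha> *\<^sub>R e - \<nu>"] C0 by (meson mult_left_mono order_trans)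
    then have "(1 + \<alpha>) ^ M * norm (w (\<alpha> *\<^sub>R e - \<nu>)) \<le> (1 + \<alpha>) ^ M * (C0 * ((1 + \<alpha>) * (1 + norm \<nu>)) ^ N0)"
      using \<alpha> by (intro mult_left_mono) auto
    also have "\<dots> = C0 * (1 + norm \<nu>) ^ N0 * (1 + \<alpha>) ^ (M + N0)"
      by (simp add: power_mult_distrib power_add mult_ac)
    also have "\<dots> \<le> C0 * (1 + norm \<nu>) ^ N0 * ((1 + norm \<nu>) / d) ^ (M + N0)"
      using a \<alpha> C0 by (intro mult_left_mono power_mono) auto
    also have "\<dots> = C0 / d ^ (M + N0) * (1 + norm \<nu>) ^ (M + N0 + N0)"
      by (simp add: power_add power_divide mult_ac)
    also have "\<dots> \<le> C * (1 + norm \<nu>) ^ (M + N0 + N0)"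
      by (intro mult_right_mono) (auto simp: C_def)
    finally show ?thesis .
  qed
  with Cpos show ?thesis by blast
qed

section \<open>Fourier series\<close>

lemma vector_derivative_quotient_limit:
  fixes g :: "real \<Rightarrow> complex"
  assumes "(g has_vector_derivative g') (at p)"
  shows "((\<lambda>s. (g s - g p) / of_real (s - p)) \<longlongrightarrow> g') (at p)"
proof -
  have "((\<lambda>s. (1 / norm (s - p)) *\<^sub>R (g s - (g p + (s - p) *\<^sub>R g'))) \<longlongrightarrow> 0) (at p)"
    using assms unfolding has_vector_derivative_def has_derivative_within by simp
  then have "((\<lambda>s. norm ((1 / norm (s - p)) *\<^sub>R (g s - (g p + (s - p) *\<^sub>R g')))) \<longlongrightarrow> 0) (at p)"
    by (rule tendsto_norm_zero)
  moreover have "norm ((1 / norm (s - p)) *\<^sub>R (g s - (g p + (s - p) *\<^sub>R g'))) =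
      norm ((g s - g p) / of_real (s - p) - g')" if "s \<noteq> p" for s
  proof -
    have "(g s - g p) / of_real (s - p) - g' = (g s - (g p + (s - p) *\<^sub>R g')) / of_real (s - p)"
      using that by (simp add: divide_simps scaleR_conv_of_real algebra_simps)
    then show ?thesis by (simp add: norm_divide flip: of_real_diff)
  qed
  ultimately have "((\<lambda>s. norm ((g s - g p) / of_real (s - p) - g')) \<longlongrightarrow> 0) (at p)"
    by (elim Lim_transform_eventually) (auto simp: eventually_at_filter)
  then show ?thesis
    unfolding Lim_null[of _ g'] by (rule tendsto_norm_zero_cancel)
qed

definition wave :: "real \<Rightarrow> int \<Rightarrow> real \<Rightarrow> complex" where
  "wave L n s = exp (\<i> * complex_of_real (pi / L * real_of_int n * s))"

text \<open>Normalized, so that the waves are orthonormal and a bound for the integrand passes to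
  the mean unchanged, whatever the length of the interval.\<close>

definition mean :: "real \<Rightarrow> (real \<Rightarrow> complex) \<Rightarrow> complex" where
  "mean L g = integral {-L..L} g / complex_of_real (2 * L)"

definition fcoef :: "real \<Rightarrow> (real \<Rightarrow> complex) \<Rightarrow> int \<Rightarrow> complex" where
  "fcoef L g n = mean L (\<lambda>s. g s * wave L (- n) s)"

lemma wave_0 [simp]: "wave L 0 s = 1"
  by (simp add: wave_def)

lemma wave_add: "wave L (m + n) s = wave L m s * wave L n s"
  by (simp add: wave_def algebra_simps flip: exp_add)

lemma wave_minus: "wave L (- n) s = cnj (wave L n s)"
  by (simp add: wave_def exp_cnj)

lemma norm_wave [simp]: "norm (wave L n s) = 1"
  by (simp add: wave_def)

lemma continuous_on_wave [continuous_intros]: "continuous_on A (wave L n)"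
  unfolding wave_def by (intro continuous_intros)

context
  fixes L :: real
  assumes L: "0 < L"
begin

lemma mean_add:
  "continuous_on {-L..L} f \<Longrightarrow> continuous_on {-L..L} g \<Longrightarrow> mean L (\<lambda>s. f s + g s) = mean L f + mean L g"
  unfolding mean_def
  by (subst integral_add) (auto intro: integrable_continuous_interval simp: add_divide_distrib)

lemma mean_diff:
  "continuous_on {-L..L} f \<Longrightarrow> continuous_on {-L..L} g \<Longrightarrow> mean L (\<lambda>s. f s - g s) = mean L f - mean L g"
  unfolding mean_def
  by (subst integral_diff) (auto intro: integrable_continuous_interval simp: diff_divide_distrib)

lemma mean_cmult: "mean L (\<lambda>s. c * g s) = c * mean L g"
  unfolding mean_def by (simp add: integral_mult_right)

lemma mean_sum:
  "finite I \<Longrightarrow> (\<And>i. i \<in> I \<Longrightarrow> continuous_on {-L..L} (f i)) \<Longrightarrow>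
    mean L (\<lambda>s. \<Sum>i\<in>I. f i s) = (\<Sum>i\<in>I. mean L (f i))"
  unfolding mean_def
  by (subst integral_sum) (auto intro: integrable_continuous_interval simp: sum_divide_distrib)

lemma mean_cnj: "mean L (\<lambda>s. cnj (g s)) = cnj (mean L g)"
  unfolding mean_def by (simp add: integral_cnj)

lemma mean_cong: "(\<And>s. s \<in> {-L..L} \<Longrightarrow> f s = g s) \<Longrightarrow> mean L f = mean L g"
  unfolding mean_def by (metis integral_cong)

lemma norm_mean_le:
  assumes "continuous_on {-L..L} g" "\<And>s. s \<in> {-L..L} \<Longrightarrow> norm (g s) \<le> B"
  shows "norm (mean L g) \<le> B"
proof -
  have "norm (integral {-L..L} g) \<le> B * (L - (- L))"
    using assms L by (intro integral_bound) auto
  then show ?thesis using L by (simp add: mean_def norm_divide divide_simps mult_ac)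
qed

lemma mean_wave: "mean L (wave L n) = (if n = 0 then 1 else 0)"
proof (cases "n = 0")
  case True
  then have "wave L n = (\<lambda>s. 1)" by (auto simp: wave_def)
  then show ?thesis using L True by (simp add: mean_def scaleR_conv_of_real)
next
  case False
  define c where "c = \<i> * complex_of_real (pi / L * real_of_int n)"
  have c: "c \<noteq> 0" using False L by (simp add: c_def)
  have "((\<lambda>s. exp (c * of_real s) / c) has_vector_derivative wave L n s) (at s within {-L..L})" for s
  proof -
    have "((\<lambda>z. exp (c * z) / c) has_field_derivative exp (c * of_real s)) (at (of_real s))"
      using c by (auto intro!: derivative_eq_intros)
    from has_vector_derivative_real_field[OF this]
    have "((\<lambda>s. exp (c * of_real s) / c) has_vector_derivative exp (c * of_real s)) (at s within {-L..L})" .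
    moreover have "exp (c * of_real s) = wave L n s" by (simp add: c_def wave_def mult_ac)
    ultimately show ?thesis by simp
  qed
  then have "(wave L n has_integral exp (c * of_real L) / c - exp (c * of_real (-L)) / c) {-L..L}"
    using L by (intro fundamental_theorem_of_calculus) auto
  moreover have "exp (c * of_real L) = exp (c * of_real (-L))"
  proof -
    have "c * of_real L = c * of_real (-L) + of_int (2 * n) * pi * \<i>"
      using L by (simp add: c_def algebra_simps)
    then show ?thesis using exp_eq by blast
  qed
  ultimately have "(wave L n has_integral 0) {-L..L}" by simp
  then show ?thesis using False by (simp add: mean_def integral_unique)
qed

lemma fcoef_cnj: "mean L (\<lambda>s. cnj (g s) * wave L n s) = cnj (fcoef L g n)"
  unfolding fcoef_def mean_cnj[symmetric] by (simp add: wave_minus)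

text \<open>The mean square of \<open>g\<close> minus its partial sum \<open>S\<close> is
  nonnegative; by orthonormality both mixed terms and the mean square of \<open>S\<close> equal the
  same sum of squares.\<close>

lemma bessel:
  assumes g: "continuous_on {-L..L} g" and F: "finite F"
  shows "(\<Sum>n\<in>F. (norm (fcoef L g n))\<^sup>2) \<le> Re (mean L (\<lambda>s. g s * cnj (g s)))"
proof -
  define c where "c = fcoef L g"
  define S where "S s = (\<Sum>n\<in>F. c n * wave L n s)" for s
  have S: "continuous_on {-L..L} S"
    unfolding S_def by (intro continuous_intros)
  have cg: "continuous_on {-L..L} (\<lambda>s. cnj (g s))" by (intro continuous_intros g)
  have cS: "continuous_on {-L..L} (\<lambda>s. cnj (S s))" by (intro continuous_intros S)
  have 1: "mean L (\<lambda>s. S s * cnj (g s)) = (\<Sum>n\<in>F. c n * cnj (c n))"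
  proof -
    have "mean L (\<lambda>s. S s * cnj (g s)) = mean L (\<lambda>s. \<Sum>n\<in>F. c n * (cnj (g s) * wave L n s))"
      by (simp add: S_def sum_distrib_left sum_distrib_right mult_ac)
    also have "\<dots> = (\<Sum>n\<in>F. mean L (\<lambda>s. c n * (cnj (g s) * wave L n s)))"
      using F cg by (intro mean_sum) (auto intro!: continuous_intros)
    finally show ?thesis by (simp add: mean_cmult fcoef_cnj c_def)
  qed
  have 2: "mean L (\<lambda>s. g s * cnj (S s)) = (\<Sum>n\<in>F. c n * cnj (c n))"
  proof -
    have "mean L (\<lambda>s. g s * cnj (S s)) = cnj (mean L (\<lambda>s. S s * cnj (g s)))"
      by (simp add: mean_cnj[symmetric] mult.commute)
    then show ?thesis by (simp add: 1 mult.commute)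
  qed
  have 3: "mean L (\<lambda>s. S s * cnj (S s)) = (\<Sum>n\<in>F. c n * cnj (c n))"
  proof -
    have "mean L (\<lambda>s. S s * cnj (S s)) =
        mean L (\<lambda>s. \<Sum>n\<in>F. c n * (\<Sum>m\<in>F. cnj (c m) * wave L (n - m) s))"
    proof (rule mean_cong)
      fix s
      have "wave L n s * cnj (wave L m s) = wave L (n - m) s" for n m
        using wave_add[of L n "- m" s] by (simp add: wave_minus)
      then have "(c n * wave L n s) * cnj (c m * wave L m s) = c n * (cnj (c m) * wave L (n - m) s)" for n m
        by (simp add: mult_ac)
      then show "S s * cnj (S s) = (\<Sum>n\<in>F. c n * (\<Sum>m\<in>F. cnj (c m) * wave L (n - m) s))"
        unfolding S_def cnj_sum by (subst sum_product) (simp only: sum_distrib_left)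
    qed
    also have "\<dots> = (\<Sum>n\<in>F. c n * (\<Sum>m\<in>F. cnj (c m) * mean L (wave L (n - m))))"
    proof -
      have "mean L (\<lambda>s. \<Sum>m\<in>F. cnj (c m) * wave L (n - m) s) = (\<Sum>m\<in>F. cnj (c m) * mean L (wave L (n - m)))" for n
        using F by (subst mean_sum) (auto intro!: continuous_intros simp: mean_cmult)
      then show ?thesis
        using F by (subst mean_sum) (auto intro!: continuous_intros simp: mean_cmult)
    qed
    also have "\<dots> = (\<Sum>n\<in>F. c n * (\<Sum>m\<in>F. if m = n then cnj (c m) else 0))"
      by (intro sum.cong arg_cong2[of _ _ _ _ "(*)"]) (auto simp: mean_wave)
    finally show ?thesis using F by simp
  qed
  have "mean L (\<lambda>s. (g s - S s) * cnj (g s - S s)) =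
     mean L (\<lambda>s. (g s * cnj (g s) - g s * cnj (S s)) - (S s * cnj (g s) - S s * cnj (S s)))"
    by (simp add: algebra_simps)
  also have "\<dots> = mean L (\<lambda>s. g s * cnj (g s)) - (\<Sum>n\<in>F. c n * cnj (c n))"
  proof -
    have "mean L (\<lambda>s. g s * cnj (g s) - g s * cnj (S s)) =
        mean L (\<lambda>s. g s * cnj (g s)) - (\<Sum>n\<in>F. c n * cnj (c n))"
      unfolding 2[symmetric] by (intro mean_diff continuous_intros g S)
    moreover have "mean L (\<lambda>s. S s * cnj (g s) - S s * cnj (S s)) = 0"
      by (subst mean_diff) (auto intro!: continuous_intros g S simp: 1 3)
    ultimately show ?thesis
      by (subst mean_diff) (auto intro!: continuous_intros g S)
  qed
  finally have eq: "Re (mean L (\<lambda>s. (g s - S s) * cnj (g s - S s))) =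
      Re (mean L (\<lambda>s. g s * cnj (g s))) - (\<Sum>n\<in>F. (norm (c n))\<^sup>2)"
    by (simp add: complex_norm_square[symmetric] flip: of_real_sum)
  have "mean L (\<lambda>s. (g s - S s) * cnj (g s - S s)) =
      complex_of_real (integral {-L..L} (\<lambda>s. (norm (g s - S s))\<^sup>2) / (2 * L))"
  proof -
    have "(\<lambda>s. (norm (g s - S s))\<^sup>2) integrable_on {-L..L}"
      by (intro integrable_continuous_interval continuous_intros g S)
    from integral_linear[OF this bounded_linear_of_real[where 'a=complex]]
    have "integral {-L..L} (\<lambda>s. complex_of_real ((norm (g s - S s))\<^sup>2)) =
        complex_of_real (integral {-L..L} (\<lambda>s. (norm (g s - S s))\<^sup>2))"
      unfolding o_def .
    then show ?thesis unfolding mean_def complex_norm_square[symmetric] by simp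
  qed
  moreover have "0 \<le> integral {-L..L} (\<lambda>s. (norm (g s - S s))\<^sup>2)"
    using g S by (intro Henstock_Kurzweil_Integration.integral_nonneg integrable_continuous_interval)
      (auto intro!: continuous_intros)
  ultimately have "0 \<le> Re (mean L (\<lambda>s. (g s - S s) * cnj (g s - S s)))" using L by simp
  with eq show ?thesis by (simp add: c_def)
qed

text \<open>By Bessel's inequality the squares along distinct indices have bounded sums. The
  injection \<open>h\<close> lets the index run to either end of the integers.\<close>

lemma fcoef_tendsto_0:
  assumes g: "continuous_on {-L..L} g" and "inj h"
  shows "(\<lambda>k. fcoef L g (h (k::nat))) \<longlonglongrightarrow> 0"
proof -
  have "summable (\<lambda>k. (norm (fcoef L g (h k)))\<^sup>2)"
  proof (rule summableI_nonneg_bounded)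
    fix K :: nat
    have "(\<Sum>k<K. (norm (fcoef L g (h k)))\<^sup>2) = (\<Sum>n\<in>h ` {..<K}. (norm (fcoef L g n))\<^sup>2)"
      using \<open>inj h\<close> by (subst sum.reindex) (auto intro: inj_on_subset)
    also have "\<dots> \<le> Re (mean L (\<lambda>s. g s * cnj (g s)))"
      by (rule bessel[OF g]) simp
    finally show "(\<Sum>k<K. (norm (fcoef L g (h k)))\<^sup>2) \<le> Re (mean L (\<lambda>s. g s * cnj (g s)))" .
  qed simp
  from summable_LIMSEQ_zero[OF this] have "(\<lambda>k. sqrt ((norm (fcoef L g (h k)))\<^sup>2)) \<longlonglongrightarrow> sqrt 0"
    by (rule tendsto_real_sqrt)
  then show ?thesis by (simp add: tendsto_norm_zero_iff)
qed

text \<open>The difference quotient \<open>q\<close> of \<open>g\<close> against \<open>wave 1\<close> turns the partial sums of the Fourier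
  series into telescoping sums, whose remainder vanishes by Bessel's inequality.\<close>

lemma fourier_pointwise:
  assumes g: "continuous_on {-L..L} g" and p: "\<bar>p\<bar> < L"
    and dg: "(g has_vector_derivative g') (at p)"
    and sm: "(\<lambda>n. fcoef L g n * wave L n p) summable_on UNIV"
  shows "((\<lambda>n. fcoef L g n * wave L n p) has_sum g p) UNIV"
proof -
  define w where "w s = wave L 1 s * wave L (-1) p - 1" for s
  define c where "c = \<i> * complex_of_real (pi / L)"
  \<comment> \<open>The value at \<open>p\<close> is the limit of the quotient, so differentiability
    of \<open>g\<close> at this one point makes \<open>q\<close> continuous there.\<close>
  define q where "q s = (if s = p then g' / c else (g s - g p) / w s)" for s
  have c0: "c \<noteq> 0" using L by (simp add: c_def)
  have w_eq: "w s = exp (c * of_real (s - p)) - 1" for s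
    by (simp add: w_def c_def wave_def algebra_simps diff_divide_distrib flip: exp_add)
  \<comment> \<open>Zeros of \<open>w\<close> are spaced by \<open>2 * L\<close>; since
    \<open>p\<close> is interior, even the closed interval contains no zero besides
    \<open>p\<close>.\<close>
  have w_nz: "w s \<noteq> 0" if "s \<in> {-L..L}" "s \<noteq> p" for s
  proof
    assume "w s = 0"
    then have "exp (c * of_real (s - p)) = 1" by (simp add: w_eq)
    then obtain k :: int where k: "pi / L * (s - p) = of_int (2 * k) * pi"
      by (auto simp: exp_eq_1 c_def)
    then have "pi * (s - p) = pi * (2 * L * of_int k)" using L by (simp add: field_simps)
    then have sp: "s - p = 2 * L * of_int k" by (simp only: mult_cancel_left) simp
    have "\<bar>s - p\<bar> < 2 * L * 1" using that p unfolding atLeastAtMost_iff by linarith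
    then have "\<bar>of_int k :: real\<bar> < 1" unfolding sp abs_mult using L by simp
    then have "k = 0" by linarith
    then show False using sp that by simp
  qed
  have wp: "w p = 0" by (simp add: w_eq)
  have gw: "g s = g p + w s * q s" if "s \<in> {-L..L}" for s
    using w_nz[OF that] wp by (auto simp: q_def)
  have w_lim: "((\<lambda>s. w s / of_real (s - p)) \<longlongrightarrow> c) (at p)"
  proof -
    have "((\<lambda>z. exp (c * (z - of_real p)) - 1) has_field_derivative c) (at (of_real p))"
      by (auto intro!: derivative_eq_intros)
    from has_vector_derivative_real_field[OF this]
    have "(w has_vector_derivative c) (at p)" by (simp add: w_eq[abs_def])
    from vector_derivative_quotient_limit[OF this] show ?thesis by (simp add: wp)
  qed
  have g_lim: "((\<lambda>s. (g s - g p) / of_real (s - p)) \<longlongrightarrow> g') (at p)"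
    using dg by (rule vector_derivative_quotient_limit)
  have "(q \<longlongrightarrow> q p) (at p)"
  proof -
    have "((\<lambda>s. ((g s - g p) / of_real (s - p)) / (w s / of_real (s - p))) \<longlongrightarrow> g' / c) (at p)"
      by (intro tendsto_divide g_lim w_lim c0)
    then have "(q \<longlongrightarrow> g' / c) (at p)"
      by (rule Lim_transform_eventually) (auto simp: eventually_at_filter q_def)
    then show ?thesis by (simp add: q_def)
  qed
  then have qp: "isCont q p" by (simp add: isCont_def)
  have q: "continuous_on {-L..L} q"
    unfolding continuous_on_eq_continuous_within
  proof
    fix s assume s: "s \<in> {-L..L}"
    show "continuous (at s within {-L..L}) q"
    proof (cases "s = p")
      case True
      then show ?thesis using qp continuous_at_imp_continuous_at_within by blast
    next
      case False
      have w_c: "continuous_on A w" for A unfolding w_def by (intro continuous_intros)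
      have "continuous (at s within {-L..L}) (\<lambda>s. (g s - g p) / w s)"
        using g s w_c w_nz[OF s False]
        by (intro continuous_intros) (auto simp: continuous_on_eq_continuous_within)
      then have "((\<lambda>t. (g t - g p) / w t) \<longlongrightarrow> q s) (at s within {-L..L})"
        using False by (simp add: continuous_within q_def)
      moreover have "\<forall>\<^sub>F t in at s within {-L..L}. (g t - g p) / w t = q t"
        unfolding eventually_at
        by (rule exI[of _ "dist s p"]) (use False in \<open>auto simp: q_def dist_commute\<close>)
      ultimately show ?thesis
        unfolding continuous_within by (rule Lim_transform_eventually)
    qed
  qed
  \<comment> \<open>Multiplication by \<open>wave L 1\<close> shifts Fourier coefficients by one
    index, so the terms that come from \<open>w\<close> times \<open>q\<close> are differences of
    consecutive values of \<open>T\<close>.\<close>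
  define T where "T n = wave L n p * fcoef L q n" for n
  have fc: "fcoef L g n * wave L n p = (if n = 0 then g p else 0) + (T (n - 1) - T n)" for n
  proof -
    have "fcoef L g n = mean L (\<lambda>s. g p * wave L (-n) s +
        (wave L (-1) p * (q s * wave L (- (n - 1)) s) - q s * wave L (-n) s))"
      unfolding fcoef_def
    proof (rule mean_cong)
      fix s assume s: "s \<in> {-L..L}"
      have "wave L (- (n - 1)) s = wave L 1 s * wave L (- n) s"
        using wave_add[of L 1 "- n" s] by simp
      then show "g s * wave L (-n) s = g p * wave L (-n) s +
        (wave L (-1) p * (q s * wave L (- (n - 1)) s) - q s * wave L (-n) s)"
        unfolding gw[OF s] w_def by (simp add: algebra_simps)
    qed
    also have "\<dots> = g p * mean L (wave L (-n)) + (wave L (-1) p * fcoef L q (n - 1) - fcoef L q n)"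
      using q by (subst mean_add; (subst mean_diff)?)
        (auto intro!: continuous_intros simp: mean_cmult fcoef_def)
    finally have eq: "fcoef L g n = g p * mean L (wave L (-n)) +
        (wave L (-1) p * fcoef L q (n - 1) - fcoef L q n)" .
    have w: "wave L (n - 1) p = wave L n p * wave L (-1) p"
      using wave_add[of L n "-1" p] by simp
    have "fcoef L g n * wave L n p =
        g p * mean L (wave L (-n)) * wave L n p + (T (n - 1) - T n)"
      unfolding T_def w eq by (simp add: algebra_simps)
    then show ?thesis by (simp add: mean_wave)
  qed
  have part: "(\<Sum>n\<in>{- int N..int N}. fcoef L g n * wave L n p) = g p + (T (- int N - 1) - T (int N))" for N
  proof -
    have "(\<Sum>n\<in>{- int N..int N}. T (n - 1) - T n) = T (- int N - 1) - T (int N)"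
    proof (induction N)
      case (Suc N)
      have "{- int (Suc N)..int (Suc N)} = insert (- int N - 1) (insert (int N + 1) {- int N..int N})"
        by auto
      then show ?case using Suc.IH by (simp add: add.commute)
    qed simp
    then show ?thesis by (simp add: fc sum.distrib)
  qed
  have T1: "(\<lambda>N. T (int N)) \<longlonglongrightarrow> 0"
    by (rule tendsto_norm_zero_cancel)
      (use tendsto_norm_zero[OF fcoef_tendsto_0[OF q, of int]] in \<open>simp add: T_def norm_mult inj_on_def\<close>)
  have T2: "(\<lambda>N. T (- int N - 1)) \<longlonglongrightarrow> 0"
    by (rule tendsto_norm_zero_cancel)
      (use tendsto_norm_zero[OF fcoef_tendsto_0[OF q, of "\<lambda>N. - int N - 1"]] in \<open>simp add: T_def norm_mult inj_on_def\<close>)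
  have lim1: "(\<lambda>N. \<Sum>n\<in>{- int N..int N}. fcoef L g n * wave L n p) \<longlonglongrightarrow> g p"
    unfolding part using tendsto_add[OF tendsto_const[of "g p"] tendsto_diff[OF T2 T1]] by simp
  \<comment> \<open>Symmetric index intervals exhaust the integers, so the unordered sum, which
    exists by assumption, equals the limit of the telescoping sums.\<close>
  have fl: "filterlim (\<lambda>N. {- int N..int N}) (finite_subsets_at_top UNIV) sequentially"
    unfolding filterlim_finite_subsets_at_top
  proof (intro allI impI)
    fix X :: "int set" assume X: "finite X \<and> X \<subseteq> UNIV"
    obtain K where K: "\<And>n. n \<in> X \<Longrightarrow> \<bar>n\<bar> \<le> K"
      using X finite_abs_int_segment by (metis Max_ge finite_imageI imageI)
    have "X \<subseteq> {- int N..int N}" if "nat K \<le> N" for N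
      using K that by force
    then show "\<forall>\<^sub>F N in sequentially. finite {- int N..int N} \<and> X \<subseteq> {- int N..int N} \<and> {- int N..int N} \<subseteq> UNIV"
      unfolding eventually_sequentially by (intro exI[of _ "nat K"]) auto
  qed
  have hs: "((\<lambda>n. fcoef L g n * wave L n p) has_sum (\<Sum>\<^sub>\<infinity>n. fcoef L g n * wave L n p)) UNIV"
    using sm by simp
  then have "(\<lambda>N. \<Sum>n\<in>{- int N..int N}. fcoef L g n * wave L n p) \<longlonglongrightarrow> (\<Sum>\<^sub>\<infinity>n. fcoef L g n * wave L n p)"
    unfolding has_sum_def using filterlim_compose fl by blast
  from LIMSEQ_unique[OF lim1 this] hs show ?thesis by simp
qed

end

section \<open>Expanding distributions into plane waves\<close>

abbreviation plane_wave :: "'a::euclidean_space \<Rightarrow> 'a \<Rightarrow> complex" where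
  "plane_wave \<xi> x \<equiv> exp (- \<i> * complex_of_real (x \<bullet> \<xi>))"

lemma partial_derivs_plane_wave:
  assumes "set bs \<subseteq> Basis"
  shows "partial_derivs bs (plane_wave \<xi>) =
    (\<lambda>x. (\<Prod>b\<leftarrow>bs. - \<i> * complex_of_real (b \<bullet> \<xi>)) * plane_wave \<xi> x)"
  using assms
proof (induction bs)
  case (Cons b bs)
  then have IH: "partial_derivs bs (plane_wave \<xi>) =
    (\<lambda>x. (\<Prod>b\<leftarrow>bs. - \<i> * complex_of_real (b \<bullet> \<xi>)) * plane_wave \<xi> x)" by simp
  show ?case
    unfolding partial_derivs_simps IH partial_deriv_cmult[OF smooth_plane_wave] partial_deriv_plane_wave
    by (simp add: mult_ac)
qed simp

lemma norm_frequency_prod_le: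
  fixes \<xi> :: "'a::euclidean_space"
  assumes "set bs \<subseteq> Basis" "length bs \<le> N"
  shows "norm (\<Prod>b\<leftarrow>bs. - \<i> * complex_of_real (b \<bullet> \<xi>)) \<le> (1 + norm \<xi>) ^ N"
proof -
  have "norm (\<Prod>b\<leftarrow>bs. - \<i> * complex_of_real (b \<bullet> \<xi>)) \<le> (1 + norm \<xi>) ^ length bs"
    using assms(1)
  proof (induction bs)
    case (Cons b bs)
    have "\<bar>b \<bullet> \<xi>\<bar> \<le> 1 + norm \<xi>"
      using Basis_le_norm[of b \<xi>] Cons.prems by (simp add: inner_commute)
    then show ?case using Cons by (simp add: norm_mult mult_mono)
  qed simp
  also have "\<dots> \<le> (1 + norm \<xi>) ^ N" using assms(2) by (intro power_increasing) auto
  finally show ?thesis .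
qed

text \<open>The hypothesis on all derivatives replaces termwise differentiation: the derivatives of a
  compactly supported function have their own Fourier series.\<close>

lemma distribution_series:
  fixes v :: "('a::euclidean_space \<Rightarrow> complex) \<Rightarrow> complex" and \<xi> :: "'i \<Rightarrow> 'a"
  assumes lin: "linear_on_smooth v" and sb: "seminorm_bound v R C N" and a: "smooth a"
    and rep: "\<And>bs x. set bs \<subseteq> Basis \<Longrightarrow> length bs \<le> N \<Longrightarrow> x \<in> cball 0 R \<Longrightarrow>
      ((\<lambda>i. \<beta> i * partial_derivs bs (plane_wave (\<xi> i)) x) has_sum partial_derivs bs a x) UNIV"
    and sm: "(\<lambda>i. norm (\<beta> i) * (1 + norm (\<xi> i)) ^ N) summable_on UNIV"
  shows "((\<lambda>i. \<beta> i * v (plane_wave (\<xi> i))) has_sum v a) UNIV"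
proof -
  define B where "B i = norm (\<beta> i) * (1 + norm (\<xi> i)) ^ N" for i
  define T where "T F = infsum B UNIV - sum B F" for F
  have B: "(B has_sum infsum B UNIV) UNIV" using sm by (simp add: B_def[abs_def])
  have T0: "(T \<longlongrightarrow> 0) (finite_subsets_at_top UNIV)"
    using tendsto_diff[OF tendsto_const[of "infsum B UNIV"] B[unfolded has_sum_def]] by (simp add: T_def[abs_def])
  \<comment> \<open>The remainder and its derivatives up to order \<open>N\<close> are sums over the
    complement of \<open>F\<close>, dominated uniformly on the ball by the tail \<open>T F\<close>
    of one numerical series.\<close>
  have est: "norm (v a - (\<Sum>i\<in>F. \<beta> i * v (plane_wave (\<xi> i)))) \<le> C * T F" if F: "finite F" for F
  proof -
    have TF: "(B has_sum T F) (UNIV - F)"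
      unfolding T_def using B F by (intro has_sum_Diff) auto
    have smS: "smooth (\<lambda>x. \<Sum>i\<in>F. \<beta> i * plane_wave (\<xi> i) x)"
      by (intro smooth_sum smooth_cmult smooth_plane_wave)
    define \<phi> where "\<phi> = (\<lambda>x. a x + (-1) * (\<Sum>i\<in>F. \<beta> i * plane_wave (\<xi> i) x))"
    have "smooth \<phi>" unfolding \<phi>_def by (intro smooth_add smooth_cmult a smS)
    moreover have "0 \<le> T F" using has_sum_nonneg[OF TF] by (simp add: B_def)
    moreover have "derivs_bounded R N \<phi> (T F)"
      unfolding derivs_bounded_def
    proof (intro allI impI ballI)
      fix bs :: "'a list" and x :: 'a
      assume bs: "set bs \<subseteq> Basis" "length bs \<le> N" "x \<in> cball 0 R"
      let ?f = "\<lambda>i. \<beta> i * partial_derivs bs (plane_wave (\<xi> i)) x"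
      have "partial_derivs bs (\<lambda>x. \<Sum>i\<in>F. \<beta> i * plane_wave (\<xi> i) x) x = (\<Sum>i\<in>F. ?f i)"
        unfolding partial_derivs_sum[OF smooth_cmult[OF smooth_plane_wave] bs(1)]
          partial_derivs_cmult[OF smooth_plane_wave bs(1)] ..
      then have "partial_derivs bs \<phi> x = partial_derivs bs a x - (\<Sum>i\<in>F. ?f i)"
        unfolding \<phi>_def partial_derivs_add[OF a smooth_cmult[OF smS] bs(1)] partial_derivs_cmult[OF smS bs(1)]
        by simp
      moreover have "(?f has_sum (partial_derivs bs a x - (\<Sum>i\<in>F. ?f i))) (UNIV - F)"
        using rep[OF bs] F by (intro has_sum_Diff) auto
      ultimately have hs: "(?f has_sum partial_derivs bs \<phi> x) (UNIV - F)" by simp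
      have fB: "norm (?f i) \<le> B i" for i
        unfolding B_def partial_derivs_plane_wave[OF bs(1)] norm_mult
        using norm_frequency_prod_le[OF bs(1,2), of "\<xi> i"] by (intro mult_left_mono) auto
      have "(\<lambda>i. norm (?f i)) summable_on (UNIV - F)"
        using TF by (intro summable_on_comparison_test[OF has_sum_imp_summable[OF TF] fB]) auto
      then have "((\<lambda>i. norm (?f i)) has_sum infsum (\<lambda>i. norm (?f i)) (UNIV - F)) (UNIV - F)" by simp
      from norm_has_sum_bound[OF this hs] has_sum_mono[OF this TF fB]
      show "norm (partial_derivs bs \<phi> x) \<le> T F" by linarith
    qed
    ultimately have "norm (v \<phi>) \<le> C * T F" by (intro seminorm_boundD[OF sb])
    moreover have "v \<phi> = v a - (\<Sum>i\<in>F. \<beta> i * v (plane_wave (\<xi> i)))"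
      unfolding \<phi>_def linear_on_smooth_add[OF lin a smooth_cmult[OF smS]] linear_on_smooth_cmult[OF lin smS]
        linear_on_smooth_sum[OF lin smooth_cmult[OF smooth_plane_wave]]
        linear_on_smooth_cmult[OF lin smooth_plane_wave] by simp
    ultimately show ?thesis by simp
  qed
  have "((\<lambda>F. v a - (\<Sum>i\<in>F. \<beta> i * v (plane_wave (\<xi> i)))) \<longlongrightarrow> 0) (finite_subsets_at_top UNIV)"
  proof (rule Lim_null_comparison)
    show "((\<lambda>F. C * T F) \<longlongrightarrow> 0) (finite_subsets_at_top UNIV)"
      using tendsto_mult_right_zero[OF T0] .
    show "\<forall>\<^sub>F F in finite_subsets_at_top UNIV. norm (v a - (\<Sum>i\<in>F. \<beta> i * v (plane_wave (\<xi> i)))) \<le> C * T F"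
      using est by (auto intro!: eventually_finite_subsets_at_top_weakI)
  qed
  from tendsto_diff[OF tendsto_const[of "v a"] this] show ?thesis
    by (simp add: has_sum_def)
qed

text \<open>Partial integration controls pure powers of a frequency; together with an unweighted
  bound this controls the weight \<open>(1 + t) ^ M\<close>.\<close>

lemma one_plus_power_le:
  fixes t :: real
  assumes "0 \<le> t"
  shows "(1 + t) ^ M \<le> 2 ^ M * (1 + t ^ M)"
proof -
  have "(1 + t) ^ M \<le> (2 * max 1 t) ^ M" using assms by (intro power_mono) auto
  also have "\<dots> = 2 ^ M * (max 1 t) ^ M" by (simp add: power_mult_distrib)
  also have "(max 1 t) ^ M \<le> 1 + t ^ M" using assms by (auto simp: max_def)
  finally show ?thesis by simp
qed

lemma summable_on_int_inverse_square:
  assumes "0 < c"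
  shows "(\<lambda>n::int. 1 / (1 + \<bar>c * real_of_int n\<bar>) ^ 2) summable_on UNIV"
proof -
  have s: "summable (\<lambda>k::nat. 1 / (1 + c * real k) ^ 2)"
  proof (rule summable_comparison_test')
    have "summable (\<lambda>k::nat. inverse (real k ^ 2))" by (rule inverse_power_summable) simp
    then show "summable (\<lambda>k::nat. inverse (c ^ 2) * inverse (real k ^ 2))" by (rule summable_mult)
    fix k :: nat assume "1 \<le> k"
    then have "(c * real k) ^ 2 \<le> (1 + c * real k) ^ 2" "0 < (c * real k) ^ 2"
      using assms by (auto intro!: power_mono)
    moreover from this have "0 < (1 + c * real k) ^ 2" by linarith
    ultimately have "1 / (1 + c * real k) ^ 2 \<le> 1 / (c * real k) ^ 2" by (intro divide_left_mono mult_pos_pos) auto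
    then show "norm (1 / (1 + c * real k) ^ 2) \<le> inverse (c ^ 2) * inverse (real k ^ 2)"
      by (simp add: power_mult_distrib divide_inverse)
  qed
  then have nat: "(\<lambda>k::nat. 1 / (1 + c * real k) ^ 2) summable_on UNIV"
    by (intro norm_summable_imp_summable_on) simp
  have "(\<lambda>n::int. 1 / (1 + \<bar>c * real_of_int n\<bar>) ^ 2) summable_on range int"
    by (subst summable_on_reindex) (use nat assms in \<open>auto simp: o_def abs_mult\<close>)
  moreover have "(\<lambda>n::int. 1 / (1 + \<bar>c * real_of_int n\<bar>) ^ 2) summable_on range (\<lambda>k. - int k)"
    by (subst summable_on_reindex) (use nat assms in \<open>auto simp: o_def abs_mult inj_on_def\<close>)
  ultimately have "(\<lambda>n::int. 1 / (1 + \<bar>c * real_of_int n\<bar>) ^ 2) summable_on (range int \<union> range (\<lambda>k. - int k))"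
    by (rule summable_on_union)
  moreover have "range int \<union> range (\<lambda>k. - int k) = UNIV"
    by (auto simp: image_iff) (metis int_cases2)
  ultimately show ?thesis by simp
qed

text \<open>The boundary terms vanish through \<open>f\<close>, not through periodicity of the
  exponential, so \<open>\<alpha>\<close> may be any real number and not only a multiple of
  \<open>pi / L\<close>.\<close>

lemma mean_by_parts:
  assumes L: "0 < L"
    and f: "\<And>s. (f has_vector_derivative f' s) (at s)" and f': "continuous_on {-L..L} f'"
    and ends: "f L = 0" "f (-L) = 0"
  shows "mean L (\<lambda>s. f' s * exp (- \<i> * complex_of_real (\<alpha> * s))) =
     \<i> * of_real \<alpha> * mean L (\<lambda>s. f s * exp (- \<i> * complex_of_real (\<alpha> * s)))"
proof -
  let ?e = "\<lambda>s. exp (- \<i> * complex_of_real (\<alpha> * s))"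
  have e: "(?e has_vector_derivative - \<i> * of_real \<alpha> * ?e s) (at s)" for s
  proof -
    have "((\<lambda>z. exp (- \<i> * of_real \<alpha> * z)) has_field_derivative - \<i> * of_real \<alpha> * exp (- \<i> * of_real \<alpha> * of_real s)) (at (of_real s))"
      by (auto intro!: derivative_eq_intros)
    from has_vector_derivative_real_field[OF this] show ?thesis by (simp add: mult.assoc)
  qed
  have fc: "continuous_on {-L..L} f"
    using f by (meson continuous_at_imp_continuous_on has_vector_derivative_continuous)
  have "((\<lambda>s. f s * ?e s) has_vector_derivative (f s * (- \<i> * of_real \<alpha> * ?e s) + f' s * ?e s)) (at s within {-L..L})" for s
    by (rule has_vector_derivative_at_within[OF has_vector_derivative_mult[OF f e]])
  then have "((\<lambda>s. f s * (- \<i> * of_real \<alpha> * ?e s) + f' s * ?e s) has_integral f L * ?e L - f (-L) * ?e (-L)) {-L..L}"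
    using L by (intro fundamental_theorem_of_calculus) auto
  then have "mean L (\<lambda>s. f s * (- \<i> * of_real \<alpha> * ?e s) + f' s * ?e s) = 0"
    by (simp add: mean_def integral_unique ends)
  then have m0: "mean L (\<lambda>s. - \<i> * of_real \<alpha> * (f s * ?e s) + f' s * ?e s) = 0"
    by (simp add: mult_ac)
  then have "- \<i> * of_real \<alpha> * mean L (\<lambda>s. f s * ?e s) + mean L (\<lambda>s. f' s * ?e s) = 0"
  proof -
    have "continuous_on {-L..L} (\<lambda>s. - \<i> * of_real \<alpha> * (f s * ?e s))"
      "continuous_on {-L..L} (\<lambda>s. f' s * ?e s)"
      by (intro continuous_intros fc f')+
    from mean_add[OF L this] m0 show ?thesis by (simp only: mean_cmult[OF L])
  qed
  then show ?thesis by (simp add: algebra_simps add_eq_0_iff)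
qed

lemma wave_eq: "wave L (- n) s = exp (- \<i> * complex_of_real (pi / L * real_of_int n * s))"
  by (simp add: wave_def)

lemma fcoef_by_parts:
  assumes "0 < L" "\<And>s. (f has_vector_derivative f' s) (at s)" "continuous_on {-L..L} f'"
    "f L = 0" "f (-L) = 0"
  shows "fcoef L f' n = \<i> * of_real (pi / L * real_of_int n) * fcoef L f n"
  unfolding fcoef_def wave_eq by (rule mean_by_parts[OF assms])

lemma norm_fcoef_le:
  assumes "0 < L" "continuous_on {-L..L} g" "\<And>s. s \<in> {-L..L} \<Longrightarrow> norm (g s) \<le> B"
  shows "norm (fcoef L g n) \<le> B"
  unfolding fcoef_def using assms
  by (intro norm_mean_le) (auto intro!: continuous_intros simp: norm_mult)

lemma vector_derivative_sequence_continuous: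
  assumes "\<And>s. (f has_vector_derivative f' s) (at s)"
  shows "continuous_on A f"
  using assms by (meson continuous_at_imp_continuous_on has_vector_derivative_continuous)

text \<open>A sequence \<open>g\<close> of successive derivatives stands for the smooth function \<open>g 0\<close>.\<close>

locale bump_sequence =
  fixes L :: real and g :: "nat \<Rightarrow> real \<Rightarrow> complex"
  assumes L: "0 < L"
    and deriv: "\<And>k t. (g k has_vector_derivative g (Suc k) t) (at t)"
    and supp: "\<And>k t. L \<le> \<bar>t\<bar> \<Longrightarrow> g k t = 0"
begin

lemma cont: "continuous_on A (g k)"
  by (rule vector_derivative_sequence_continuous[OF deriv])

lemma fcoef_seq: "fcoef L (g k) n = (\<i> * of_real (pi / L * real_of_int n)) ^ k * fcoef L (g 0) n"
proof (induction k)
  case (Suc k)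
  have "fcoef L (g (Suc k)) n = \<i> * of_real (pi / L * real_of_int n) * fcoef L (g k) n"
    using L supp by (intro fcoef_by_parts[OF L deriv cont]) auto
  then show ?case by (simp add: Suc)
qed simp

lemma fcoef_decay:
  assumes "\<And>s. norm (g 0 s) \<le> B" "\<And>s. norm (g M s) \<le> B"
  shows "norm (fcoef L (g 0) n) * (1 + \<bar>pi / L * real_of_int n\<bar>) ^ M \<le> 2 ^ Suc M * B"
proof -
  let ?t = "\<bar>pi / L * real_of_int n\<bar>"
  have 0: "norm (fcoef L (g 0) n) \<le> B" by (rule norm_fcoef_le[OF L cont assms(1)])
  have "norm (fcoef L (g M) n) \<le> B" by (rule norm_fcoef_le[OF L cont assms(2)])
  then have M: "norm (fcoef L (g 0) n) * ?t ^ M \<le> B"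
    unfolding fcoef_seq[of M] by (simp add: norm_mult norm_power norm_divide abs_mult mult.commute)
  have "norm (fcoef L (g 0) n) * (1 + ?t) ^ M \<le> norm (fcoef L (g 0) n) * (2 ^ M * (1 + ?t ^ M))"
    by (intro mult_left_mono one_plus_power_le) auto
  also have "\<dots> = 2 ^ M * (norm (fcoef L (g 0) n) + norm (fcoef L (g 0) n) * ?t ^ M)"
    by (simp only: algebra_simps)
  also have "\<dots> \<le> 2 ^ M * (B + B)" using 0 M by (intro mult_left_mono add_mono) auto
  finally show ?thesis by simp
qed

text \<open>Two derivatives beyond \<open>M\<close> leave a summable inverse square. The second
  estimate sees \<open>g\<close> only through \<open>B\<close>, which makes it uniform over families
  of functions.\<close>

lemma fcoef_summable:
  "(\<lambda>n. norm (fcoef L (g 0) n) * (1 + \<bar>pi / L * real_of_int n\<bar>) ^ M) summable_on UNIV"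
    (is "?F summable_on UNIV")
  and fcoef_infsum_le: "(\<And>s. norm (g 0 s) \<le> B) \<Longrightarrow> (\<And>s. norm (g (M + 2) s) \<le> B) \<Longrightarrow>
    (\<Sum>\<^sub>\<infinity>n. norm (fcoef L (g 0) n) * (1 + \<bar>pi / L * real_of_int n\<bar>) ^ M) \<le>
      2 ^ (M + 3) * B * (\<Sum>\<^sub>\<infinity>n::int. 1 / (1 + \<bar>pi / L * real_of_int n\<bar>) ^ 2)"
proof -
  have sm: "(\<lambda>n::int. c * (1 / (1 + \<bar>pi / L * real_of_int n\<bar>) ^ 2)) summable_on UNIV" for c :: real
    using L by (intro summable_on_cmult_right summable_on_int_inverse_square) auto
  have *: "?F n \<le> 2 ^ (M + 3) * B * (1 / (1 + \<bar>pi / L * real_of_int n\<bar>) ^ 2)"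
    if "\<And>s. norm (g 0 s) \<le> B" "\<And>s. norm (g (M + 2) s) \<le> B" for B n
  proof -
    have "?F n * (1 + \<bar>pi / L * real_of_int n\<bar>) ^ 2 \<le> 2 ^ (M + 3) * B"
      using fcoef_decay[of B "M + 2" n] that by (simp add: power_add mult_ac power2_eq_square)
    moreover have "0 < (1 + \<bar>pi / L * real_of_int n\<bar>) ^ 2" by (intro zero_less_power add_pos_nonneg) auto
    ultimately show ?thesis by (simp add: pos_le_divide_eq)
  qed
  have bd: "\<exists>B. \<forall>s. norm (g k s) \<le> B" for k
  proof -
    have "bounded (g k ` {-L..L})"
      by (intro compact_imp_bounded compact_continuous_image cont compact_Icc)
    then obtain B where B: "0 < B" "\<forall>y\<in>g k ` {-L..L}. norm y \<le> B" by (auto simp: bounded_pos)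
    have "norm (g k s) \<le> B" for s
      using B supp[of s k] by (cases "L \<le> \<bar>s\<bar>") (auto simp: abs_le_iff not_le abs_less_iff)
    then show ?thesis by blast
  qed
  obtain B0 B1 where "\<And>s. norm (g 0 s) \<le> B0" "\<And>s. norm (g (M + 2) s) \<le> B1"
    using bd[of 0] bd[of "M + 2"] by blast
  then have "\<And>s. norm (g 0 s) \<le> max B0 B1" "\<And>s. norm (g (M + 2) s) \<le> max B0 B1"
    by (auto simp: le_max_iff_disj)
  from *[OF this] show F: "?F summable_on UNIV"
    by (intro summable_on_comparison_test[OF sm]) auto
  assume "\<And>s. norm (g 0 s) \<le> B" "\<And>s. norm (g (M + 2) s) \<le> B"
  from *[OF this] show "(\<Sum>\<^sub>\<infinity>n. norm (fcoef L (g 0) n) * (1 + \<bar>pi / L * real_of_int n\<bar>) ^ M) \<le>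
      2 ^ (M + 3) * B * (\<Sum>\<^sub>\<infinity>n::int. 1 / (1 + \<bar>pi / L * real_of_int n\<bar>) ^ 2)"
    by (subst infsum_cmult_right'[symmetric]) (rule infsum_mono[OF F sm])
qed

lemma shift: "bump_sequence L (\<lambda>k. g (k + j))"
  using deriv supp L by unfold_locales auto

lemma series: "\<bar>p\<bar> < L \<Longrightarrow> ((\<lambda>n. fcoef L (g k) n * wave L n p) has_sum g k p) UNIV"
proof (rule fourier_pointwise[OF L cont _ deriv])
  interpret s: bump_sequence L "\<lambda>j. g (j + k)" by (rule shift)
  have "(\<lambda>n. norm (fcoef L (g k) n * wave L n p)) summable_on UNIV"
    using s.fcoef_summable[of 0] by (simp add: norm_mult)
  then show "(\<lambda>n. fcoef L (g k) n * wave L n p) summable_on UNIV"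
    by (rule abs_summable_summable)
qed

text \<open>The series represents \<open>g 0\<close> only within one period; \<open>R < L\<close>
  places the ball that matters for \<open>v\<close> inside it.\<close>

lemma distribution_series_line:
  assumes lin: "linear_on_smooth v" and sb: "seminorm_bound v R C N" and RL: "R < L"
  shows "((\<lambda>n. fcoef L (g 0) n * v (plane_wave (- (pi / L * real_of_int n)))) has_sum v (g 0)) UNIV"
proof (rule distribution_series[OF lin sb])
  show "smooth (g 0)" using smooth_sequence(1)[of g, OF deriv] .
  show "(\<lambda>n. norm (fcoef L (g 0) n) * (1 + norm (- (pi / L * real_of_int n))) ^ N) summable_on UNIV"
    using fcoef_summable[of N] by simp
  fix bs :: "real list" and x :: real
  assume bs: "set bs \<subseteq> Basis" and x: "x \<in> cball 0 R"
  have "(\<Prod>b\<leftarrow>bs. - \<i> * complex_of_real (b \<bullet> - (pi / L * real_of_int n))) =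
      (\<i> * of_real (pi / L * real_of_int n)) ^ length bs" for n
    using bs by (induction bs) (auto simp: inner_real_def)
  moreover have "plane_wave (- (pi / L * real_of_int n)) x = wave L n x" for n
    by (simp add: wave_def inner_real_def mult_ac)
  ultimately have "fcoef L (g 0) n * partial_derivs bs (plane_wave (- (pi / L * real_of_int n))) x =
      fcoef L (g (length bs)) n * wave L n x" for n
    unfolding partial_derivs_plane_wave[OF bs] fcoef_seq[of "length bs"] by (simp only: mult_ac)
  moreover have "partial_derivs bs (g 0) = g (length bs)"
    using smooth_sequence(2)[of g, OF deriv bs] .
  ultimately show "((\<lambda>n. fcoef L (g 0) n * partial_derivs bs (plane_wave (- (pi / L * real_of_int n))) x)
      has_sum partial_derivs bs (g 0) x) UNIV"
    using series[of x "length bs"] x RL by simp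
qed

end

section \<open>Localizations in the plane\<close>

definition supp_in :: "real \<Rightarrow> ('a::euclidean_space \<Rightarrow> complex) \<Rightarrow> bool" where
  "supp_in \<rho> a \<longleftrightarrow> smooth a \<and> (\<forall>x. \<rho> < norm x \<longrightarrow> a x = 0)"

lemma supp_in_partial_deriv:
  assumes "supp_in \<rho> a"
  shows "supp_in \<rho> (partial_deriv v a)"
proof -
  have "partial_deriv v a x = 0" if "\<rho> < norm x" for x
  proof -
    have op: "open {x::'a. \<rho> < norm x}" by (intro open_Collect_less continuous_intros)
    have "((\<lambda>x. 0) has_derivative (\<lambda>h. 0)) (at x)" by simp
    then have "(a has_derivative (\<lambda>h. 0)) (at x)"
      by (rule has_derivative_transform_within_open[OF _ op])
        (use assms that in \<open>auto simp: supp_in_def\<close>)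
    then show ?thesis
      unfolding partial_deriv_def by (metis frechet_derivative_at)
  qed
  then show ?thesis
    using assms smooth_partial_deriv unfolding supp_in_def by blast
qed

lemma supp_in_iterate: "supp_in \<rho> a \<Longrightarrow> supp_in \<rho> ((partial_deriv v ^^ k) a)"
  by (induction k) (auto intro: supp_in_partial_deriv)

lemma supp_in_partial_derivs: "supp_in \<rho> a \<Longrightarrow> supp_in \<rho> (partial_derivs bs a)"
  by (induction bs) (auto intro: supp_in_partial_deriv)

lemma supp_in_bounded:
  assumes "supp_in \<rho> a"
  obtains B where "0 < B" "\<And>x. norm (a x) \<le> B"
proof -
  obtain B where B: "B > 0" "\<And>x. x \<in> cball 0 \<rho> \<Longrightarrow> norm (a x) \<le> B"
    using bounded_on_cball[OF smooth_continuous_on, of a \<rho>] assms unfolding supp_in_def by metis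
  have "norm (a x) \<le> B" for x
    using B assms unfolding supp_in_def by (cases "\<rho> < norm x") auto
  with B that show thesis by blast
qed

lemma smooth_line_derivative:
  assumes "smooth a"
  shows "((\<lambda>t. a (y + t *\<^sub>R v)) has_vector_derivative partial_deriv v a (y + t *\<^sub>R v)) (at t)"
proof -
  have 1: "((\<lambda>t. y + t *\<^sub>R v) has_derivative (\<lambda>h. h *\<^sub>R v)) (at t)"
    by (auto intro!: derivative_eq_intros)
  have d: "(a has_derivative frechet_derivative a (at (y + t *\<^sub>R v))) (at (y + t *\<^sub>R v))"
    using assms by (rule smooth_has_derivative)
  from has_derivative_compose[OF 1 this]
  have "((\<lambda>t. a (y + t *\<^sub>R v)) has_derivative (\<lambda>h. frechet_derivative a (at (y + t *\<^sub>R v)) (h *\<^sub>R v))) (at t)" .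
  then show ?thesis
    by (simp add: has_vector_derivative_def partial_deriv_def linear_cmul[OF has_derivative_linear[OF d]])
qed

lemma mean_leibniz:
  assumes "\<And>s t. ((\<lambda>s. F s t) has_vector_derivative F' s t) (at s)"
    and "\<And>s. continuous_on UNIV (F s)" "continuous_on UNIV (\<lambda>(s, t). F' s t)"
  shows "((\<lambda>s. mean L (F s)) has_vector_derivative mean L (F' s)) (at s)"
proof -
  have "((\<lambda>s. integral (cbox (-L) L) (F s)) has_vector_derivative integral (cbox (-L) L) (F' s)) (at s within UNIV)"
  proof (rule leibniz_rule_vector_derivative)
    show "F s integrable_on cbox (-L) L" for s
      by (rule integrable_continuous) (rule continuous_on_subset[OF assms(2)], simp)
    show "continuous_on (UNIV \<times> cbox (-L) L) (\<lambda>(s, t). F' s t)"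
      by (rule continuous_on_subset[OF assms(3)]) simp
  qed (use assms(1) in auto)
  then have "((\<lambda>s. integral {-L..L} (F s) / of_real (2 * L)) has_vector_derivative
      integral {-L..L} (F' s) / of_real (2 * L)) (at s)"
    by (intro has_vector_derivative_divide) (simp add: cbox_interval)
  then show ?thesis by (simp add: mean_def)
qed

lemma perp_simps:
  fixes \<omega> :: "real^2"
  assumes "norm \<omega> = 1"
  shows "\<omega> \<bullet> \<omega> = 1" "perp \<omega> \<bullet> perp \<omega> = 1" "\<omega> \<bullet> perp \<omega> = 0" "perp \<omega> \<bullet> \<omega> = 0" "norm (perp \<omega>) = 1"
    "(x \<bullet> \<omega>) *\<^sub>R \<omega> + (x \<bullet> perp \<omega>) *\<^sub>R perp \<omega> = x"
proof -
  have 1: "\<omega> \<bullet> \<omega> = 1" using assms by (simp add: norm_eq_1)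
  then have 2: "\<omega> $ 1 * \<omega> $ 1 + \<omega> $ 2 * \<omega> $ 2 = 1" by (simp add: inner_vec_def sum_2)
  show "\<omega> \<bullet> \<omega> = 1" by (rule 1)
  show 3: "perp \<omega> \<bullet> perp \<omega> = 1" using 2 by (simp add: inner_vec_def sum_2 perp_def)
  then show "norm (perp \<omega>) = 1" by (simp add: norm_eq_1)
  show "\<omega> \<bullet> perp \<omega> = 0" "perp \<omega> \<bullet> \<omega> = 0" by (simp_all add: inner_vec_def sum_2 perp_def)
  have "x $ 1 * (\<omega> $ 1 * \<omega> $ 1 + \<omega> $ 2 * \<omega> $ 2) = x $ 1" "x $ 2 * (\<omega> $ 1 * \<omega> $ 1 + \<omega> $ 2 * \<omega> $ 2) = x $ 2"
    unfolding 2 by simp_all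
  then show "(x \<bullet> \<omega>) *\<^sub>R \<omega> + (x \<bullet> perp \<omega>) *\<^sub>R perp \<omega> = x"
    by (simp add: vec_eq_iff forall_2 inner_vec_def sum_2 perp_def algebra_simps)
qed

locale frame =
  fixes \<omega> :: "real^2"
  assumes unit: "norm \<omega> = 1"
begin

definition pt :: "real \<Rightarrow> real \<Rightarrow> real^2" where
  "pt s t = s *\<^sub>R \<omega> + t *\<^sub>R perp \<omega>"

lemma pt_inner [simp]: "pt s t \<bullet> \<omega> = s" "pt s t \<bullet> perp \<omega> = t"
  by (simp_all add: pt_def inner_add_left perp_simps[OF unit])

lemma pt_coords [simp]: "pt (x \<bullet> \<omega>) (x \<bullet> perp \<omega>) = x"
  unfolding pt_def by (rule perp_simps(6)[OF unit])

lemma abs_le_norm_pt: "\<bar>s\<bar> \<le> norm (pt s t)" "\<bar>t\<bar> \<le> norm (pt s t)"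
  using Cauchy_Schwarz_ineq2[of "pt s t" \<omega>] Cauchy_Schwarz_ineq2[of "pt s t" "perp \<omega>"]
  by (simp_all add: unit perp_simps(5)[OF unit])

lemma pt_inner_left: "pt s t \<bullet> \<xi> = s * (\<omega> \<bullet> \<xi>) + t * (perp \<omega> \<bullet> \<xi>)"
  by (simp add: pt_def inner_add_left)

lemma continuous_on_pt [continuous_intros]:
  "continuous_on A f \<Longrightarrow> continuous_on A g \<Longrightarrow> continuous_on A (\<lambda>x. pt (f x) (g x))"
  unfolding pt_def by (intro continuous_intros)

lemma smooth_continuous_on_pt:
  assumes "smooth a" "continuous_on A f" "continuous_on A g"
  shows "continuous_on A (\<lambda>x. a (pt (f x) (g x)))"
  using continuous_on_compose2[OF smooth_continuous_on[OF assms(1), of UNIV] continuous_on_pt[OF assms(2,3)]]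
  by simp

text \<open>A partial Fourier transform along \<open>perp \<omega>\<close>. For \<open>a\<close>
  supported in a ball of radius less than \<open>L\<close> the mean covers the whole line, so up to
  the factor \<open>2 * L\<close> this is the Radon transform of \<open>a\<close> times a
  transversal wave.\<close>

definition X :: "real \<Rightarrow> (real^2 \<Rightarrow> complex) \<Rightarrow> real \<Rightarrow> real \<Rightarrow> complex" where
  "X L a \<tau> s = mean L (\<lambda>t. a (pt s t) * exp (- \<i> * complex_of_real (\<tau> * t)))"

context
  fixes L \<rho> :: real
  assumes L: "0 < L" "\<rho> < L"
begin

lemma X_add: "smooth a \<Longrightarrow> smooth b \<Longrightarrow> X L (\<lambda>x. a x + b x) \<tau> s = X L a \<tau> s + X L b \<tau> s"
  unfolding X_def ring_distribs
  by (intro mean_add[OF L(1)] continuous_intros smooth_continuous_on_pt)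

lemma X_cmult: "X L (\<lambda>x. c * a x) \<tau> s = c * X L a \<tau> s"
  unfolding X_def mult.assoc by (rule mean_cmult[OF L(1)])

lemma X_deriv:
  assumes "smooth a"
  shows "(X L a \<tau> has_vector_derivative X L (partial_deriv \<omega> a) \<tau> s) (at s)"
  unfolding X_def
proof (rule mean_leibniz)
  fix s t
  have "((\<lambda>s. a (t *\<^sub>R perp \<omega> + s *\<^sub>R \<omega>)) has_vector_derivative
      partial_deriv \<omega> a (t *\<^sub>R perp \<omega> + s *\<^sub>R \<omega>)) (at s)"
    using assms by (rule smooth_line_derivative)
  then have "((\<lambda>s. a (pt s t)) has_vector_derivative partial_deriv \<omega> a (pt s t)) (at s)"
    by (simp add: pt_def add.commute)
  then show "((\<lambda>s. a (pt s t) * exp (- \<i> * complex_of_real (\<tau> * t))) has_vector_derivative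
      partial_deriv \<omega> a (pt s t) * exp (- \<i> * complex_of_real (\<tau> * t))) (at s)"
    by (rule has_vector_derivative_mult_left)
next
  show "continuous_on UNIV (\<lambda>t. a (pt s t) * exp (- \<i> * complex_of_real (\<tau> * t)))" for s
    by (intro continuous_intros smooth_continuous_on_pt assms)
  show "continuous_on UNIV (\<lambda>(s, t). partial_deriv \<omega> a (pt s t) * exp (- \<i> * complex_of_real (\<tau> * t)))"
    unfolding case_prod_beta
    by (intro continuous_intros smooth_continuous_on_pt smooth_partial_deriv assms)
qed

lemma X_perp_deriv:
  assumes "supp_in \<rho> a"
  shows "X L (partial_deriv (perp \<omega>) a) \<tau> s = \<i> * of_real \<tau> * X L a \<tau> s"
  unfolding X_def
proof (rule mean_by_parts[OF L(1)])
  have sm: "smooth a" using assms by (simp add: supp_in_def)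
  show "((\<lambda>t. a (pt s t)) has_vector_derivative partial_deriv (perp \<omega>) a (pt s t)) (at t)" for t
    unfolding pt_def using sm by (rule smooth_line_derivative)
  show "continuous_on {-L..L} (\<lambda>t. partial_deriv (perp \<omega>) a (pt s t))"
    by (intro smooth_continuous_on_pt smooth_partial_deriv sm continuous_intros)
  have "\<rho> < norm (pt s L)" "\<rho> < norm (pt s (-L))"
    using abs_le_norm_pt(2)[of L s] abs_le_norm_pt(2)[of "-L" s] L by auto
  then show "a (pt s L) = 0" "a (pt s (-L)) = 0" using assms by (auto simp: supp_in_def)
qed

lemma norm_X_le:
  assumes "smooth a" "\<And>x. norm (a x) \<le> B"
  shows "norm (X L a \<tau> s) \<le> B"
  unfolding X_def
  by (rule norm_mean_le[OF L(1)])
    (auto intro!: continuous_intros smooth_continuous_on_pt assms simp: norm_mult)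

lemma X_supp:
  assumes "supp_in \<rho> a" "\<rho> < \<bar>s\<bar>"
  shows "X L a \<tau> s = 0"
proof -
  have "a (pt s t) = 0" for t
    using assms abs_le_norm_pt(1)[of s t] unfolding supp_in_def by auto
  then show ?thesis by (simp add: X_def mean_def)
qed

text \<open>Derivatives along \<open>perp \<omega>\<close> become powers of \<open>\<tau>\<close>;
  the bounds are suprema over the plane and therefore uniform in \<open>s\<close>.\<close>

lemma X_decay:
  assumes "supp_in \<rho> a"
  shows "\<exists>B>0. \<forall>\<tau> s. norm (X L a \<tau> s) * (1 + \<bar>\<tau>\<bar>) ^ N \<le> B"
proof -
  obtain B0 where B0: "0 < B0" "\<And>x. norm (a x) \<le> B0" using supp_in_bounded[OF assms] by blast
  have s: "supp_in \<rho> ((partial_deriv (perp \<omega>) ^^ k) a)" for k by (rule supp_in_iterate[OF assms])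
  obtain B1 where B1: "0 < B1" "\<And>x. norm ((partial_deriv (perp \<omega>) ^^ N) a x) \<le> B1"
    using supp_in_bounded[OF s[of N]] by blast
  have eq: "X L ((partial_deriv (perp \<omega>) ^^ k) a) \<tau> s = (\<i> * of_real \<tau>) ^ k * X L a \<tau> s" for k \<tau> s
    by (induction k) (simp_all add: X_perp_deriv[OF s] mult_ac)
  have "norm (X L a \<tau> s) * (1 + \<bar>\<tau>\<bar>) ^ N \<le> 2 ^ N * (B0 + B1)" for \<tau> s
  proof -
    have 0: "norm (X L a \<tau> s) \<le> B0"
      using assms B0 by (intro norm_X_le) (auto simp: supp_in_def)
    have "norm (X L ((partial_deriv (perp \<omega>) ^^ N) a) \<tau> s) \<le> B1"
      using s[of N] B1 by (intro norm_X_le) (auto simp: supp_in_def)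
    then have N: "norm (X L a \<tau> s) * \<bar>\<tau>\<bar> ^ N \<le> B1"
      unfolding eq by (simp add: norm_mult norm_power mult.commute)
    have "norm (X L a \<tau> s) * (1 + \<bar>\<tau>\<bar>) ^ N \<le> norm (X L a \<tau> s) * (2 ^ N * (1 + \<bar>\<tau>\<bar> ^ N))"
      by (intro mult_left_mono one_plus_power_le) auto
    also have "\<dots> = 2 ^ N * (norm (X L a \<tau> s) + norm (X L a \<tau> s) * \<bar>\<tau>\<bar> ^ N)"
      by (simp only: algebra_simps)
    also have "\<dots> \<le> 2 ^ N * (B0 + B1)" using 0 N by (intro mult_left_mono add_mono) auto
    finally show ?thesis .
  qed
  moreover have "0 < 2 ^ N * (B0 + B1)" using B0 B1 by simp
  ultimately show ?thesis by blast
qed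

lemma X_bump_sequence:
  assumes "supp_in \<rho> a"
  shows "bump_sequence L (\<lambda>k. X L ((partial_deriv \<omega> ^^ k) a) \<tau>)"
proof
  have s: "supp_in \<rho> ((partial_deriv \<omega> ^^ k) a)" for k by (rule supp_in_iterate[OF assms])
  show "0 < L" by (rule L)
  show "(X L ((partial_deriv \<omega> ^^ k) a) \<tau> has_vector_derivative X L ((partial_deriv \<omega> ^^ Suc k) a) \<tau> t) (at t)" for k t
    using X_deriv s[of k] by (simp add: supp_in_def)
  show "X L ((partial_deriv \<omega> ^^ k) a) \<tau> t = 0" if "L \<le> \<bar>t\<bar>" for k t
    using X_supp[OF s] that L by simp
qed

text \<open>Double Fourier coefficients in the coordinates of the frame, taken one variable at a
  time: \<open>fst i\<close> belongs to \<open>perp \<omega>\<close>, \<open>snd i\<close> to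
  \<open>\<omega>\<close>. Aligning the square with the frame lets the one-dimensional results be
  applied through \<open>X\<close>.\<close>

definition coef :: "(real^2 \<Rightarrow> complex) \<Rightarrow> int \<times> int \<Rightarrow> complex" where
  "coef a i = fcoef L (X L a (pi / L * real_of_int (fst i))) (snd i)"

text \<open>The minus sign compensates the negative exponent in \<open>plane_wave\<close>.\<close>

definition freq :: "int \<times> int \<Rightarrow> real^2" where
  "freq i = - pt (pi / L * real_of_int (snd i)) (pi / L * real_of_int (fst i))"

lemma plane_wave_freq:
  "plane_wave (freq i) x = wave L (fst i) (x \<bullet> perp \<omega>) * wave L (snd i) (x \<bullet> \<omega>)"
  by (simp add: wave_def freq_def pt_def inner_add_right inner_commute algebra_simps flip: exp_add)

lemma coef_add:
  assumes "smooth a" "smooth b"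
  shows "coef (\<lambda>x. a x + b x) i = coef a i + coef b i"
proof -
  have c: "continuous_on {-L..L} (X L a \<tau>)" if "smooth a" for a \<tau>
    by (rule vector_derivative_sequence_continuous[OF X_deriv[OF that]])
  show ?thesis
    unfolding coef_def fcoef_def X_add[OF assms] ring_distribs
    by (intro mean_add[OF L(1)] continuous_intros c assms)
qed

lemma coef_cmult: "coef (\<lambda>x. c * a x) i = c * coef a i"
  unfolding coef_def fcoef_def X_cmult mult.assoc by (rule mean_cmult[OF L(1)])

lemma coef_partial_deriv:
  assumes "supp_in \<rho> a"
  shows "coef (partial_deriv b a) i = - \<i> * complex_of_real (b \<bullet> freq i) * coef a i"
proof -
  have sm: "smooth a" using assms by (simp add: supp_in_def)
  interpret g: bump_sequence L "\<lambda>k. X L ((partial_deriv \<omega> ^^ k) a) (pi / L * real_of_int (fst i))"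
    by (rule X_bump_sequence[OF assms])
  have 1: "coef (partial_deriv \<omega> a) i = \<i> * of_real (pi / L * real_of_int (snd i)) * coef a i"
    using g.fcoef_seq[of 1 "snd i"] by (simp add: coef_def)
  have 2: "coef (partial_deriv (perp \<omega>) a) i = \<i> * of_real (pi / L * real_of_int (fst i)) * coef a i"
    unfolding coef_def fcoef_def X_perp_deriv[OF assms] mult.assoc mean_cmult[OF L(1)] ..
  \<comment> \<open>The vector \<open>b\<close> need not point along the frame; it is resolved into
    the two directions whose coefficients are known.\<close>
  have "frechet_derivative a (at x) b = (b \<bullet> \<omega>) *\<^sub>R frechet_derivative a (at x) \<omega> +
      (b \<bullet> perp \<omega>) *\<^sub>R frechet_derivative a (at x) (perp \<omega>)" for x
  proof -
    have l: "linear (frechet_derivative a (at x))"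
      using smooth_has_derivative[OF sm] has_derivative_linear by blast
    have "frechet_derivative a (at x) b =
        frechet_derivative a (at x) ((b \<bullet> \<omega>) *\<^sub>R \<omega> + (b \<bullet> perp \<omega>) *\<^sub>R perp \<omega>)"
      by (simp add: perp_simps(6)[OF unit])
    then show ?thesis by (simp only: linear_add[OF l] linear_cmul[OF l])
  qed
  then have "partial_deriv b a = (\<lambda>x. complex_of_real (b \<bullet> \<omega>) * partial_deriv \<omega> a x +
      complex_of_real (b \<bullet> perp \<omega>) * partial_deriv (perp \<omega>) a x)"
    by (simp add: fun_eq_iff partial_deriv_def scaleR_conv_of_real)
  then have "coef (partial_deriv b a) i = complex_of_real (b \<bullet> \<omega>) * coef (partial_deriv \<omega> a) i +
      complex_of_real (b \<bullet> perp \<omega>) * coef (partial_deriv (perp \<omega>) a) i"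
    by (simp add: coef_add coef_cmult smooth_cmult smooth_partial_deriv sm)
  then show ?thesis
    unfolding 1 2 by (simp add: freq_def pt_def inner_add_right algebra_simps)
qed

lemma coef_partial_derivs:
  assumes "supp_in \<rho> a"
  shows "coef (partial_derivs bs a) i = (\<Prod>b\<leftarrow>bs. - \<i> * complex_of_real (b \<bullet> freq i)) * coef a i"
proof (induction bs)
  case (Cons b bs)
  then show ?case
    using coef_partial_deriv[OF supp_in_partial_derivs[OF assms]] by (simp add: mult.assoc)
qed simp

text \<open>The bounds for \<open>X\<close> already carry the decay in the first index; fed into the
  decay of one-dimensional coefficients they give the product of both weights.\<close>

lemma coef_decay:
  assumes "supp_in \<rho> a"
  shows "\<exists>C. \<forall>m n. norm (coef a (m, n)) *
    ((1 + \<bar>pi / L * real_of_int m\<bar>) ^ M * (1 + \<bar>pi / L * real_of_int n\<bar>) ^ M) \<le> C"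
proof -
  have s: "supp_in \<rho> ((partial_deriv \<omega> ^^ k) a)" for k by (rule supp_in_iterate[OF assms])
  obtain B0 where B0: "0 < B0" "\<And>\<tau> s. norm (X L a \<tau> s) * (1 + \<bar>\<tau>\<bar>) ^ M \<le> B0"
    using X_decay[OF assms] by blast
  obtain B1 where B1: "0 < B1" "\<And>\<tau> s. norm (X L ((partial_deriv \<omega> ^^ M) a) \<tau> s) * (1 + \<bar>\<tau>\<bar>) ^ M \<le> B1"
    using X_decay[OF s] by blast
  have "norm (coef a (m, n)) * ((1 + \<bar>pi / L * real_of_int m\<bar>) ^ M * (1 + \<bar>pi / L * real_of_int n\<bar>) ^ M)
      \<le> 2 ^ Suc M * (B0 + B1)" for m n
  proof -
    let ?\<tau> = "pi / L * real_of_int m"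
    let ?P = "(1 + \<bar>?\<tau>\<bar>) ^ M"
    have P: "0 < ?P" by (intro zero_less_power add_pos_nonneg) auto
    interpret g: bump_sequence L "\<lambda>k. X L ((partial_deriv \<omega> ^^ k) a) ?\<tau>"
      by (rule X_bump_sequence[OF assms])
    have "norm (fcoef L (X L ((partial_deriv \<omega> ^^ 0) a) ?\<tau>) n) * (1 + \<bar>pi / L * real_of_int n\<bar>) ^ M
        \<le> 2 ^ Suc M * ((B0 + B1) / ?P)"
    proof (rule g.fcoef_decay)
      fix s
      have "norm (X L a ?\<tau> s) * ?P \<le> B0 + B1" using B0(2)[of ?\<tau> s] B1(1) by linarith
      then show "norm (X L ((partial_deriv \<omega> ^^ 0) a) ?\<tau> s) \<le> (B0 + B1) / ?P"
        using P by (simp add: pos_le_divide_eq)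
      have "norm (X L ((partial_deriv \<omega> ^^ M) a) ?\<tau> s) * ?P \<le> B0 + B1" using B1(2)[of ?\<tau> s] B0(1) by linarith
      then show "norm (X L ((partial_deriv \<omega> ^^ M) a) ?\<tau> s) \<le> (B0 + B1) / ?P"
        using P by (simp add: pos_le_divide_eq)
    qed
    then have "norm (coef a (m, n)) * (1 + \<bar>pi / L * real_of_int n\<bar>) ^ M \<le> 2 ^ Suc M * (B0 + B1) / ?P"
      by (simp add: coef_def)
    then show ?thesis unfolding pos_le_divide_eq[OF P] by (simp only: mult_ac)
  qed
  then show ?thesis by blast
qed

lemma norm_freq_le: "norm (freq (m, n)) \<le> \<bar>pi / L * real_of_int m\<bar> + \<bar>pi / L * real_of_int n\<bar>"
  unfolding freq_def pt_def norm_minus_cancel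
  by (rule order_trans[OF norm_triangle_ineq]) (simp add: unit perp_simps(5)[OF unit])

text \<open>Two spare powers in each index leave a product of inverse squares; the other
  \<open>M\<close> powers cover the weight, since \<open>1 + norm (freq (m, n))\<close> is at most
  the product of the two factors.\<close>

lemma coef_summable:
  assumes "supp_in \<rho> a"
  shows "(\<lambda>i. norm (coef a i) * (1 + norm (freq i)) ^ M) summable_on UNIV"
proof -
  define u where "u n = 1 / (1 + \<bar>pi / L * real_of_int n\<bar>) ^ 2" for n
  have u: "u summable_on UNIV"
    unfolding u_def[abs_def] using L by (intro summable_on_int_inverse_square) auto
  have u0: "0 \<le> u n" for n by (simp add: u_def)
  obtain C where C: "\<And>m n. norm (coef a (m, n)) *
    ((1 + \<bar>pi / L * real_of_int m\<bar>) ^ (M + 2) * (1 + \<bar>pi / L * real_of_int n\<bar>) ^ (M + 2)) \<le> C"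
    using coef_decay[OF assms] by blast
  have uu: "(\<lambda>(m, n). C * u m * u n) summable_on (UNIV \<times> UNIV)"
  proof (rule summable_on_SigmaI)
    show "((\<lambda>n. case (m, n) of (m, n) \<Rightarrow> C * u m * u n) has_sum C * u m * infsum u UNIV) UNIV" for m
      using has_sum_cmult_right[OF has_sum_infsum[OF u]] by simp
    show "(\<lambda>m. C * u m * infsum u UNIV) summable_on UNIV"
      by (intro summable_on_cmult_left summable_on_cmult_right u)
    have "0 \<le> C" using C[of 0 0] by (simp add: order_trans[OF _ C[of 0 0]])
    then show "0 \<le> (case (m, n) of (m, n) \<Rightarrow> C * u m * u n)" for m n using u0 by simp
  qed
  have "norm (coef a (m, n)) * (1 + norm (freq (m, n))) ^ M \<le> C * u m * u n" for m n
  proof -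
    let ?x = "\<bar>pi / L * real_of_int m\<bar>" and ?y = "\<bar>pi / L * real_of_int n\<bar>"
    have p: "0 < (1 + ?x) ^ 2" "0 < (1 + ?y) ^ 2" by (intro zero_less_power add_pos_nonneg; simp)+
    have "0 \<le> ?x * ?y" by simp
    then have "1 + norm (freq (m, n)) \<le> (1 + ?x) * (1 + ?y)"
      using norm_freq_le[of m n] unfolding ring_distribs by linarith
    then have "(1 + norm (freq (m, n))) ^ M \<le> ((1 + ?x) * (1 + ?y)) ^ M"
      by (intro power_mono) auto
    then have "norm (coef a (m, n)) * (1 + norm (freq (m, n))) ^ M * ((1 + ?x) ^ 2 * (1 + ?y) ^ 2) \<le>
        norm (coef a (m, n)) * ((1 + ?x) * (1 + ?y)) ^ M * ((1 + ?x) ^ 2 * (1 + ?y) ^ 2)"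
      using p by (intro mult_right_mono mult_left_mono) auto
    also have "\<dots> = norm (coef a (m, n)) * ((1 + ?x) ^ (M + 2) * (1 + ?y) ^ (M + 2))"
      by (simp only: power_mult_distrib power_add mult_ac)
    also have "\<dots> \<le> C" by (rule C)
    finally have "norm (coef a (m, n)) * (1 + norm (freq (m, n))) ^ M \<le> C / ((1 + ?x) ^ 2 * (1 + ?y) ^ 2)"
      using p by (subst pos_le_divide_eq) (auto intro: mult_pos_pos)
    then show ?thesis by (simp add: u_def)
  qed
  then have "norm (coef a i) * (1 + norm (freq i)) ^ M \<le> (case i of (m, n) \<Rightarrow> C * u m * u n)" for i
    by (cases i) simp
  from summable_on_comparison_test[OF uu[unfolded UNIV_Times_UNIV] this] show ?thesis by simp
qed

text \<open>Absolute summability allows iterated summation: the inner series recovers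
  \<open>X\<close> at \<open>s\<close>, the outer one recovers \<open>a\<close> on the line through
  \<open>x\<close> along \<open>perp \<omega>\<close>.\<close>

lemma coef_series:
  assumes "supp_in \<rho> a" "norm x < L"
  shows "((\<lambda>i. coef a i * plane_wave (freq i) x) has_sum a x) UNIV"
proof -
  define s t where "s = x \<bullet> \<omega>" and "t = x \<bullet> perp \<omega>"
  have x: "x = pt s t" by (simp add: s_def t_def)
  have st: "\<bar>s\<bar> < L" "\<bar>t\<bar> < L" using abs_le_norm_pt(1)[of s t] abs_le_norm_pt(2)[of t s] assms(2) x by auto
  have sm: "smooth a" using assms by (simp add: supp_in_def)
  let ?F = "\<lambda>i. coef a i * (wave L (fst i) t * wave L (snd i) s)"
  have "(\<lambda>i. norm (?F i)) summable_on UNIV"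
    using coef_summable[OF assms(1), of 0] by (simp add: norm_mult)
  then have "?F summable_on UNIV" by (rule abs_summable_summable)
  then obtain S where S: "(?F has_sum S) (UNIV \<times> UNIV)" unfolding UNIV_Times_UNIV summable_on_def ..
  have in_s: "((\<lambda>n. ?F (m, n)) has_sum X L a (pi / L * real_of_int m) s * wave L m t) UNIV" for m
  proof -
    interpret g: bump_sequence L "\<lambda>k. X L ((partial_deriv \<omega> ^^ k) a) (pi / L * real_of_int m)"
      by (rule X_bump_sequence[OF assms(1)])
    show ?thesis
      using has_sum_cmult_left[OF g.series[OF st(1), of 0], of "wave L m t"]
      by (simp add: coef_def mult_ac)
  qed
  have "((\<lambda>m. X L a (pi / L * real_of_int m) s * wave L m t) has_sum S) UNIV"
    using has_sum_SigmaD[OF S in_s] .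
  moreover have "((\<lambda>m. X L a (pi / L * real_of_int m) s * wave L m t) has_sum a x) UNIV"
  proof -
    \<comment> \<open>At lattice frequencies \<open>X\<close> is itself a Fourier coefficient,
      namely of \<open>a\<close> restricted to this line.\<close>
    have X: "X L a (pi / L * real_of_int m) s = fcoef L (\<lambda>t. a (pt s t)) m" for m
      unfolding X_def fcoef_def wave_eq ..
    obtain B where B: "\<And>\<tau> s. norm (X L a \<tau> s) * (1 + \<bar>\<tau>\<bar>) ^ 2 \<le> B"
      using X_decay[OF assms(1)] by blast
    have "(\<lambda>m. norm (X L a (pi / L * real_of_int m) s * wave L m t)) summable_on UNIV"
    proof (rule summable_on_comparison_test)
      show "(\<lambda>m. B * (1 / (1 + \<bar>pi / L * real_of_int m\<bar>) ^ 2)) summable_on UNIV"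
        using L by (intro summable_on_cmult_right summable_on_int_inverse_square) auto
      fix m
      have "0 < (1 + \<bar>pi / L * real_of_int m\<bar>) ^ 2" by (intro zero_less_power add_pos_nonneg) auto
      then show "norm (X L a (pi / L * real_of_int m) s * wave L m t) \<le> B * (1 / (1 + \<bar>pi / L * real_of_int m\<bar>) ^ 2)"
        using B[of "pi / L * real_of_int m" s] by (simp add: norm_mult pos_le_divide_eq)
    qed simp
    then have "(\<lambda>m. X L a (pi / L * real_of_int m) s * wave L m t) summable_on UNIV"
      by (rule abs_summable_summable)
    then have "((\<lambda>m. fcoef L (\<lambda>t. a (pt s t)) m * wave L m t) has_sum a (pt s t)) UNIV"
      unfolding X
    proof (rule fourier_pointwise[OF L(1) _ st(2), rotated -1])
      show "continuous_on {-L..L} (\<lambda>t. a (pt s t))"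
        by (intro smooth_continuous_on_pt sm continuous_intros)
      show "((\<lambda>t. a (pt s t)) has_vector_derivative partial_deriv (perp \<omega>) a (pt s t)) (at t)"
        unfolding pt_def using sm by (rule smooth_line_derivative)
    qed
    then show ?thesis unfolding X by (simp only: x)
  qed
  ultimately have "S = a x" by (rule has_sum_unique)
  then show ?thesis using S unfolding plane_wave_freq s_def t_def by simp
qed

lemma distribution_series_plane:
  assumes "linear_on_smooth v" "seminorm_bound v R C N" "R < L" "supp_in \<rho> a"
  shows "((\<lambda>i. coef a i * v (plane_wave (freq i))) has_sum v a) UNIV"
proof (rule distribution_series[OF assms(1,2)])
  show "smooth a" using assms by (simp add: supp_in_def)
  show "(\<lambda>i. norm (coef a i) * (1 + norm (freq i)) ^ N) summable_on UNIV"
    by (rule coef_summable[OF assms(4)])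
  fix bs :: "(real^2) list" and x :: "real^2"
  assume bs: "set bs \<subseteq> Basis" and x: "x \<in> cball 0 R"
  have "coef a i * partial_derivs bs (plane_wave (freq i)) x = coef (partial_derivs bs a) i * plane_wave (freq i) x" for i
    unfolding partial_derivs_plane_wave[OF bs] coef_partial_derivs[OF assms(4)] by (simp only: mult_ac)
  then show "((\<lambda>i. coef a i * partial_derivs bs (plane_wave (freq i)) x) has_sum partial_derivs bs a x) UNIV"
    using coef_series[OF supp_in_partial_derivs[OF assms(4)], of x bs] x assms(3) by simp
qed

end

end

text \<open>\<open>K\<close> stands for a weight in a frequency parameter and \<open>b i\<close> for
  the cost of a shift by the frequency with index \<open>i\<close>; the constant \<open>C\<close> is
  free of the parameter.\<close>

lemma has_sum_weighted_bound:
  fixes W \<beta> :: "'i \<Rightarrow> complex"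
  assumes S: "((\<lambda>i. \<beta> i * W i) has_sum S) UNIV" and K: "0 \<le> K"
    and W: "\<And>i. K * norm (W i) \<le> C * b i"
    and b: "(\<lambda>i. norm (\<beta> i) * b i) summable_on UNIV"
  shows "K * norm S \<le> C * (\<Sum>\<^sub>\<infinity>i. norm (\<beta> i) * b i)"
proof -
  have KS: "((\<lambda>i. of_real K * (\<beta> i * W i)) has_sum of_real K * S) UNIV"
    by (rule has_sum_cmult_right[OF S])
  have le: "norm (of_real K * (\<beta> i * W i)) \<le> C * (norm (\<beta> i) * b i)" for i
  proof -
    have "norm (of_real K * (\<beta> i * W i)) = norm (\<beta> i) * (K * norm (W i))" using K by (simp add: norm_mult)
    also have "\<dots> \<le> norm (\<beta> i) * (C * b i)" by (intro mult_left_mono W) auto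
    finally show ?thesis by (simp add: mult_ac)
  qed
  have Cb: "(\<lambda>i. C * (norm (\<beta> i) * b i)) summable_on UNIV" by (intro summable_on_cmult_right b)
  have n: "(\<lambda>i. norm (of_real K * (\<beta> i * W i))) summable_on UNIV"
    by (rule summable_on_comparison_test[OF Cb le]) simp
  have "norm (of_real K * S) \<le> (\<Sum>\<^sub>\<infinity>i. norm (of_real K * (\<beta> i * W i)))"
    by (rule norm_has_sum_bound[OF has_sum_infsum[OF n] KS])
  also have "\<dots> \<le> (\<Sum>\<^sub>\<infinity>i. C * (norm (\<beta> i) * b i))" by (rule infsum_mono[OF n Cb le])
  also have "\<dots> = C * (\<Sum>\<^sub>\<infinity>i. norm (\<beta> i) * b i)" by (rule infsum_cmult_right')
  finally show ?thesis using K by (simp add: norm_mult)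
qed

lemma plane_wave_add: "plane_wave \<xi> x * plane_wave \<zeta> x = plane_wave (\<xi> + \<zeta>) x"
  by (simp add: inner_add_right algebra_simps flip: exp_add)

text \<open>Expanding \<open>a\<close> in plane waves turns multiplication by \<open>a\<close> into
  shifts of the Fourier transform of \<open>\<eta>\<close> times \<open>f\<close>; the rapidly
  decreasing coefficients outweigh the cost of the shifts. Decay is retained along the ray through
  \<open>e\<close>.\<close>

lemma localized_mult_decay:
  fixes f :: "(real^2 \<Rightarrow> complex) \<Rightarrow> complex"
  assumes lin: "linear_on_smooth f" and sb: "seminorm_bound f R C N"
    and \<eta>: "smooth \<eta>" and a: "supp_in \<rho> a"
    and \<Gamma>: "open_cone \<Gamma>" "e \<in> \<Gamma>" "norm e = 1"
    and decay: "\<And>N::nat. \<exists>C. \<forall>\<xi>\<in>\<Gamma>. (1 + norm \<xi>) ^ N * norm (f (\<lambda>x. \<eta> x * plane_wave \<xi> x)) \<le> C"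
  shows "\<exists>C. \<forall>\<alpha>\<ge>0. (1 + \<alpha>) ^ M * norm (f (\<lambda>x. a x * \<eta> x * plane_wave (\<alpha> *\<^sub>R e) x)) \<le> C"
proof -
  define w where "w \<xi> = f (\<lambda>x. \<eta> x * plane_wave \<xi> x)" for \<xi>
  obtain C0 where "seminorm_bound (\<lambda>\<phi>. f (\<lambda>x. \<eta> x * \<phi> x)) R C0 N"
    using seminorm_bound_mult[OF sb \<eta>] by blast
  from seminorm_bound_plane_wave[OF this] have growth: "norm (w \<zeta>) \<le> C0 * (1 + norm \<zeta>) ^ N" for \<zeta>
    unfolding w_def .
  obtain C1 M' where C1: "\<And>\<alpha> \<nu>. 0 \<le> \<alpha> \<Longrightarrow> (1 + \<alpha>) ^ M * norm (w (\<alpha> *\<^sub>R e - \<nu>)) \<le> C1 * (1 + norm \<nu>) ^ M'"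
    using cone_shift_bound[OF growth \<Gamma>, of M] decay unfolding w_def by blast
  interpret frame e by unfold_locales (rule \<Gamma>(3))
  \<comment> \<open>\<open>L\<close> exceeds \<open>\<rho>\<close> so that \<open>a\<close> fits
    into one period, and \<open>R\<close> so that the series represents \<open>a\<close> on the ball
    that matters for \<open>f\<close>.\<close>
  define L where "L = max 0 (max \<rho> R) + 1"
  have L: "0 < L" "\<rho> < L" "R < L" by (auto simp: L_def)
  have "(1 + \<alpha>) ^ M * norm (f (\<lambda>x. a x * \<eta> x * plane_wave (\<alpha> *\<^sub>R e) x)) \<le>
      C1 * (\<Sum>\<^sub>\<infinity>i. norm (coef L a i) * (1 + norm (- freq L i)) ^ M')" if \<alpha>: "0 \<le> \<alpha>" for \<alpha>
  proof -
    have sm: "smooth (\<lambda>x. \<eta> x * plane_wave (\<alpha> *\<^sub>R e) x)" by (intro smooth_mult \<eta> smooth_plane_wave)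
    define v where "v = (\<lambda>\<phi>. f (\<lambda>x. \<eta> x * plane_wave (\<alpha> *\<^sub>R e) x * \<phi> x))"
    have v1: "linear_on_smooth v" unfolding v_def by (rule linear_on_smooth_mult[OF lin sm])
    \<comment> \<open>\<open>C2\<close> may depend on \<open>\<alpha>\<close>; it serves only the
      convergence of the series, while the bound uses \<open>C1\<close>.\<close>
    obtain C2 where v2: "seminorm_bound v R C2 N" unfolding v_def using seminorm_bound_mult[OF sb sm] by blast
    have hs: "((\<lambda>i. coef L a i * v (plane_wave (freq L i))) has_sum v a) UNIV"
      by (rule distribution_series_plane[OF L(1,2) v1 v2 L(3) a])
    have vw: "v (plane_wave (freq L i)) = w (\<alpha> *\<^sub>R e - (- freq L i))" for i
      unfolding v_def w_def mult.assoc plane_wave_add by simp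
    have va: "v a = f (\<lambda>x. a x * \<eta> x * plane_wave (\<alpha> *\<^sub>R e) x)" unfolding v_def by (simp only: mult_ac)
    have W: "(1 + \<alpha>) ^ M * norm (w (\<alpha> *\<^sub>R e - (- freq L i))) \<le> C1 * (1 + norm (- freq L i)) ^ M'" for i
      by (rule C1[OF \<alpha>])
    show ?thesis
      unfolding va[symmetric]
      by (rule has_sum_weighted_bound[OF hs[unfolded vw] _ W])
        (use coef_summable[OF L(1,2) a, of M'] \<alpha> in simp_all)
  qed
  then show ?thesis by blast
qed

section \<open>The Hilbert transform\<close>

text \<open>The kernel \<open>1 / t\<close> of the Hilbert transform is split as \<open>far_kernel \<epsilon> t + near_weight \<epsilon> t / t\<close>,
  where the first summand is smooth and the second one is supported in \<open>{-\<epsilon>..\<epsilon>}\<close>.\<close>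

definition far_kernel :: "real \<Rightarrow> real \<Rightarrow> real" where
  "far_kernel \<epsilon> t = t / (t\<^sup>2 + bump (\<epsilon>\<^sup>2 - t\<^sup>2))"

definition near_weight :: "real \<Rightarrow> real \<Rightarrow> real" where
  "near_weight \<epsilon> t = bump (\<epsilon>\<^sup>2 - t\<^sup>2) / (t\<^sup>2 + bump (\<epsilon>\<^sup>2 - t\<^sup>2))"

text \<open>The square vanishes only at \<open>0\<close>, where the bump is positive. Where
  \<open>\<epsilon> \<le> \<bar>t\<bar>\<close> the bump is zero, so that
  \<open>far_kernel \<epsilon> t\<close> is exactly \<open>1 / t\<close> there.\<close>

lemma kernel_denominator_pos: "0 < \<epsilon> \<Longrightarrow> 0 < t\<^sup>2 + bump (\<epsilon>\<^sup>2 - t\<^sup>2)"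
  using bump_nonneg[of "\<epsilon>\<^sup>2 - t\<^sup>2"] bump_pos[of "\<epsilon>\<^sup>2"]
  by (cases "t = 0") (auto intro: add_pos_nonneg)

lemma smooth_of_real_power2: "smooth (\<lambda>t::real. complex_of_real (t\<^sup>2))"
  using smooth_norm_power2[of "0::real"] by simp

lemma smooth_kernel_denominator:
  "smooth (\<lambda>t. complex_of_real (t\<^sup>2 + bump (\<epsilon>\<^sup>2 - t\<^sup>2)))"
proof -
  have "smooth (\<lambda>t. complex_of_real (\<epsilon>\<^sup>2) - complex_of_real (t\<^sup>2))"
    by (intro smooth_diff smooth_const smooth_of_real_power2)
  then have "smooth (\<lambda>t. complex_of_real (bump (\<epsilon>\<^sup>2 - t\<^sup>2)))"
    by (intro smooth_bump_compose) simp
  with smooth_of_real_power2 have "smooth (\<lambda>t. complex_of_real (t\<^sup>2) + complex_of_real (bump (\<epsilon>\<^sup>2 - t\<^sup>2)))"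
    by (rule smooth_add)
  then show ?thesis by simp
qed

lemma smooth_far_kernel:
  assumes "0 < \<epsilon>"
  shows "smooth (\<lambda>t. complex_of_real (far_kernel \<epsilon> t))"
proof -
  have "smooth (\<lambda>t. complex_of_real t / complex_of_real (t\<^sup>2 + bump (\<epsilon>\<^sup>2 - t\<^sup>2)))"
    using kernel_denominator_pos[OF assms]
    by (intro smooth_divide smooth_of_real_ident smooth_kernel_denominator) (metis less_irrefl of_real_eq_0_iff)
  then show ?thesis by (simp add: far_kernel_def)
qed

lemma continuous_on_bump: "continuous_on A bump"
proof -
  have "continuous_on A (\<lambda>t. Re (complex_of_real (bump t)))"
    by (intro continuous_intros smooth_continuous_on[OF smooth_bump, of A])
  then show ?thesis by simp
qed

lemma continuous_on_near_weight:
  assumes "0 < \<epsilon>"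
  shows "continuous_on A (near_weight \<epsilon>)"
proof -
  have "continuous_on A (\<lambda>t. bump (\<epsilon>\<^sup>2 - t\<^sup>2))"
    by (rule continuous_on_compose2[OF continuous_on_bump[of UNIV]]) (auto intro!: continuous_intros)
  moreover have "t\<^sup>2 + bump (\<epsilon>\<^sup>2 - t\<^sup>2) \<noteq> 0" for t
    using kernel_denominator_pos[OF assms, of t] by simp
  ultimately show ?thesis
    unfolding near_weight_def[abs_def] by (intro continuous_intros) auto
qed

lemma continuous_on_far_kernel:
  assumes "0 < \<epsilon>"
  shows "continuous_on A (far_kernel \<epsilon>)"
proof -
  have "continuous_on A (\<lambda>t. Re (complex_of_real (far_kernel \<epsilon> t)))"
    by (intro continuous_intros smooth_continuous_on smooth_far_kernel assms)
  then show ?thesis by simp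
qed

lemma near_weight_minus [simp]: "near_weight \<epsilon> (- t) = near_weight \<epsilon> t"
  by (simp add: near_weight_def)

lemma near_weight_supp: "0 < \<epsilon> \<Longrightarrow> \<epsilon> \<le> \<bar>t\<bar> \<Longrightarrow> near_weight \<epsilon> t = 0"
  using power_mono[of \<epsilon> "\<bar>t\<bar>" 2] by (simp add: near_weight_def bump_zero)

lemma near_weight_bounds:
  assumes "0 < \<epsilon>"
  shows "0 \<le> near_weight \<epsilon> t" "near_weight \<epsilon> t \<le> 1"
  using kernel_denominator_pos[OF assms, of t] bump_nonneg[of "\<epsilon>\<^sup>2 - t\<^sup>2"]
  by (auto simp: near_weight_def divide_le_eq)

lemma kernel_split:
  assumes "0 < \<epsilon>" "t \<noteq> 0"
  shows "1 / t = far_kernel \<epsilon> t + near_weight \<epsilon> t / t"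
  using kernel_denominator_pos[OF assms(1), of t] assms(2)
  by (simp add: far_kernel_def near_weight_def divide_simps power2_eq_square)

text \<open>Symmetrizing a principal value around \<open>p\<close> leaves
  \<open>h (p - t) - h (p + t)\<close> divided by \<open>t\<close>, which is a multiple of the
  average of the derivative of \<open>h\<close> over the segment between the two points.
  \<open>w\<close> is that derivative and \<open>\<theta>\<close> parametrizes the segment; the
  general weight \<open>c\<close> leaves room for a modulating factor.\<close>

definition nearop :: "real \<Rightarrow> (real \<Rightarrow> real \<Rightarrow> complex) \<Rightarrow> (real \<Rightarrow> complex) \<Rightarrow> real \<Rightarrow> complex" where
  "nearop \<epsilon> c w p = mean \<epsilon> (\<lambda>t. mean 1 (\<lambda>\<theta>. c t \<theta> * w (p + t * \<theta>)))"

lemma continuous_on_mean_param: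
  fixes F :: "'a::euclidean_space \<Rightarrow> real \<Rightarrow> complex"
  assumes "continuous_on UNIV (\<lambda>(x, t). F x t)"
  shows "continuous_on A (\<lambda>x. mean L (F x))"
proof -
  have "continuous_on (UNIV \<times> cbox (-L) L) (\<lambda>(x, t). F x t)"
    by (rule continuous_on_subset[OF assms]) simp
  then have "continuous_on UNIV (\<lambda>x. integral (cbox (-L) L) (F x))"
    by (rule integral_continuous_on_param)
  then have "continuous_on A (\<lambda>x. integral {-L..L} (F x))"
    unfolding cbox_interval by (rule continuous_on_subset) simp
  then show ?thesis
    unfolding mean_def divide_inverse by (intro continuous_on_mult continuous_on_const)
qed

lemma vector_derivative_compose_affine:
  fixes w :: "real \<Rightarrow> complex"
  assumes "\<And>q. (w has_vector_derivative w' q) (at q)"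
  shows "((\<lambda>\<theta>. w (p + t * \<theta>)) has_vector_derivative t *\<^sub>R w' (p + t * \<theta>)) (at \<theta>)"
proof -
  have "((\<lambda>\<theta>. p + t * \<theta>) has_real_derivative t) (at \<theta>)"
    by (auto intro!: derivative_eq_intros)
  then have "((\<lambda>\<theta>. p + t * \<theta>) has_vector_derivative t) (at \<theta>)"
    by (simp only: has_real_derivative_iff_has_vector_derivative)
  from vector_diff_chain_at[OF this assms] show ?thesis by (simp add: o_def)
qed

context
  fixes c :: "real \<Rightarrow> real \<Rightarrow> complex" and \<epsilon> :: real
  assumes c: "continuous_on UNIV (\<lambda>(t, \<theta>). c t \<theta>)" and \<epsilon>: "0 < \<epsilon>"
begin

lemma continuous_on_nearop_integrand:
  assumes w: "continuous_on UNIV w"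
    and "continuous_on A f" "continuous_on A g" "continuous_on A h"
  shows "continuous_on A (\<lambda>x. c (f x) (g x) * w (h x))"
  using continuous_on_compose2[OF c continuous_on_Pair[OF assms(2,3)]]
    continuous_on_compose2[OF w assms(4)]
  by (auto intro!: continuous_on_mult)

text \<open>Only translates of \<open>w\<close> are averaged, so the operator commutes with
  differentiation.\<close>

lemma nearop_deriv:
  assumes w: "\<And>q. (w has_vector_derivative w' q) (at q)" and w': "continuous_on UNIV w'"
  shows "(nearop \<epsilon> c w has_vector_derivative nearop \<epsilon> c w' p) (at p)"
proof -
  have wc: "continuous_on UNIV w" by (rule vector_derivative_sequence_continuous[OF w])
  have shift: "((\<lambda>p. w (p + y)) has_vector_derivative w' (p + y)) (at p)" for p y
    using vector_derivative_compose_affine[OF w, where p=y and t=1 and \<theta>=p] by (simp add: add.commute)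
  have 1: "((\<lambda>p. mean 1 (\<lambda>\<theta>. c t \<theta> * w (p + t * \<theta>))) has_vector_derivative
      mean 1 (\<lambda>\<theta>. c t \<theta> * w' (p + t * \<theta>))) (at p)" for t p
  proof (rule mean_leibniz)
    show "((\<lambda>p. c t \<theta> * w (p + t * \<theta>)) has_vector_derivative c t \<theta> * w' (p + t * \<theta>)) (at p)" for p \<theta>
      by (intro has_vector_derivative_mult_right shift)
    show "continuous_on UNIV (\<lambda>\<theta>. c t \<theta> * w (p + t * \<theta>))" for p
      by (intro continuous_on_nearop_integrand wc continuous_intros)
    show "continuous_on UNIV (\<lambda>(p, \<theta>). c t \<theta> * w' (p + t * \<theta>))"
      unfolding case_prod_beta by (intro continuous_on_nearop_integrand w' continuous_intros)
  qed
  have 2: "continuous_on UNIV (\<lambda>x::real \<times> real. mean 1 (\<lambda>\<theta>. c (snd x) \<theta> * u (fst x + snd x * \<theta>)))"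
    if "continuous_on UNIV u" for u
    by (rule continuous_on_mean_param)
      (unfold case_prod_beta, intro continuous_on_nearop_integrand that continuous_intros)
  show ?thesis
    unfolding nearop_def
  proof (rule mean_leibniz[OF 1])
    show "continuous_on UNIV (\<lambda>t. mean 1 (\<lambda>\<theta>. c t \<theta> * w (p + t * \<theta>)))" for p
      by (rule continuous_on_mean_param)
        (unfold case_prod_beta, intro continuous_on_nearop_integrand wc continuous_intros)
    show "continuous_on UNIV (\<lambda>(p, t). mean 1 (\<lambda>\<theta>. c t \<theta> * w' (p + t * \<theta>)))"
      unfolding case_prod_beta by (rule 2[OF w'])
  qed
qed

lemma norm_nearop_le:
  assumes w: "continuous_on UNIV w"
    and "\<And>t \<theta>. norm (c t \<theta>) \<le> 1" "\<And>q. norm (w q) \<le> B"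
  shows "norm (nearop \<epsilon> c w p) \<le> B"
  unfolding nearop_def
proof (rule norm_mean_le[OF \<epsilon>])
  show "continuous_on {-\<epsilon>..\<epsilon>} (\<lambda>t. mean 1 (\<lambda>\<theta>. c t \<theta> * w (p + t * \<theta>)))"
    by (rule continuous_on_mean_param)
      (unfold case_prod_beta, intro continuous_on_nearop_integrand w continuous_intros)
  fix t
  have "norm (c t \<theta> * w (p + t * \<theta>)) \<le> 1 * B" for \<theta>
    unfolding norm_mult using assms(2,3) by (intro mult_mono) auto
  then show "norm (mean 1 (\<lambda>\<theta>. c t \<theta> * w (p + t * \<theta>))) \<le> B"
    by (intro norm_mean_le continuous_on_nearop_integrand w continuous_intros) auto
qed

text \<open>The translations are by \<open>t * \<theta>\<close>, of size at most
  \<open>\<epsilon>\<close>, so supports grow by no more than that.\<close>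

lemma nearop_supp:
  assumes "\<And>q. r < \<bar>q - p0\<bar> \<Longrightarrow> w q = 0" "r + \<epsilon> < \<bar>p - p0\<bar>"
  shows "nearop \<epsilon> c w p = 0"
proof -
  have "w (p + t * \<theta>) = 0" if "t \<in> {-\<epsilon>..\<epsilon>}" "\<theta> \<in> {-1..1}" for t \<theta>
  proof -
    have "\<bar>t * \<theta>\<bar> \<le> \<epsilon> * 1" unfolding abs_mult using that by (intro mult_mono) auto
    then show ?thesis using assms(2) by (intro assms(1)) linarith
  qed
  then have "mean 1 (\<lambda>\<theta>. c t \<theta> * w (p + t * \<theta>)) = 0" if "t \<in> {-\<epsilon>..\<epsilon>}" for t
    using mean_cong[of 1 "\<lambda>\<theta>. c t \<theta> * w (p + t * \<theta>)" "\<lambda>_. 0"] that by (simp add: mean_def)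
  then show ?thesis
    using mean_cong[of \<epsilon> "\<lambda>t. mean 1 (\<lambda>\<theta>. c t \<theta> * w (p + t * \<theta>))" "\<lambda>_. 0"] \<epsilon>
    by (simp add: nearop_def mean_def)
qed

end

section \<open>Evaluation of the principal value\<close>

lemma continuous_supp_integral:
  fixes A :: "real \<Rightarrow> complex"
  assumes "continuous_on UNIV A" "\<And>s. L \<le> \<bar>s\<bar> \<Longrightarrow> A s = 0" "0 < L"
  shows "integrable lborel A" "integral\<^sup>L lborel A = of_real (2 * L) * mean L A"
proof -
  have A: "A = (\<lambda>s. indicator {-L..L} s *\<^sub>R A s)"
    using assms(2) by (force simp: indicator_def)
  have i: "set_integrable lborel {-L..L} A"
    unfolding set_integrable_def
    by (rule borel_integrable_compact) (auto intro: continuous_on_subset[OF assms(1)])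
  then show "integrable lborel A" using A unfolding set_integrable_def by metis
  have "(LINT s:{-L..L}|lborel. A s) = integral {-L..L} A"
    by (rule set_borel_integral_eq_integral(2)[OF i])
  then have "integral\<^sup>L lborel A = integral {-L..L} A"
    unfolding set_lebesgue_integral_def using A by metis
  then show "integral\<^sup>L lborel A = of_real (2 * L) * mean L A"
    using assms(3) by (simp add: mean_def)
qed

text \<open>Removing an interval of length \<open>2 * \<delta>\<close> from the integral of a
  function bounded by \<open>B\<close> changes it by at most
  \<open>2 * B * \<delta>\<close>.\<close>

lemma cut_integral_tendsto:
  fixes A :: "real \<Rightarrow> complex"
  assumes A: "integrable lborel A" and B: "\<And>s. norm (A s) \<le> B"
  shows "((\<lambda>\<delta>. LINT s|lborel. indicator {s. \<delta> < \<bar>p - s\<bar>} s *\<^sub>R A s) \<longlongrightarrow> integral\<^sup>L lborel A) (at_right 0)"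
proof -
  have m: "{s::real. \<delta> < \<bar>p - s\<bar>} \<in> sets lborel" for \<delta>
    by (simp add: borel_open open_Collect_less continuous_intros)
  have est: "norm ((LINT s|lborel. indicator {s. \<delta> < \<bar>p - s\<bar>} s *\<^sub>R A s) - integral\<^sup>L lborel A) \<le> 2 * B * \<delta>"
    if \<delta>: "0 < \<delta>" for \<delta>
  proof -
    have i: "integrable lborel (\<lambda>s. indicator {s. \<delta> < \<bar>p - s\<bar>} s *\<^sub>R A s)"
      by (rule integrable_mult_indicator[OF m A])
    have "norm ((LINT s|lborel. indicator {s. \<delta> < \<bar>p - s\<bar>} s *\<^sub>R A s) - integral\<^sup>L lborel A) =
        norm (LINT s|lborel. indicator {s. \<delta> < \<bar>p - s\<bar>} s *\<^sub>R A s - A s)"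
      using i A by (subst Bochner_Integration.integral_diff) auto
    also have "\<dots> \<le> (LINT s|lborel. B * indicator {p - \<delta>..p + \<delta>} s)"
    proof (rule Bochner_Integration.integral_norm_bound_integral)
      show "integrable lborel (\<lambda>s. indicator {s. \<delta> < \<bar>p - s\<bar>} s *\<^sub>R A s - A s)" using i A by simp
      show "integrable lborel (\<lambda>s. B * indicator {p - \<delta>..p + \<delta>} s)"
        by (intro integrable_mult_right integrable_real_indicator) (auto simp: emeasure_lborel_Icc_eq)
      show "norm (indicator {s. \<delta> < \<bar>p - s\<bar>} s *\<^sub>R A s - A s) \<le> B * indicator {p - \<delta>..p + \<delta>} s" for s
        using B[of s] order_trans[OF norm_ge_zero B[of s]] by (auto simp: indicator_def)
    qed
    also have "\<dots> = 2 * B * \<delta>" using \<delta> by (simp add: measure_def)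
    finally show ?thesis .
  qed
  have "((\<lambda>\<delta>. (LINT s|lborel. indicator {s. \<delta> < \<bar>p - s\<bar>} s *\<^sub>R A s) - integral\<^sup>L lborel A) \<longlongrightarrow> 0) (at_right 0)"
  proof (rule Lim_null_comparison)
    have "((\<lambda>\<delta>. 2 * B * \<delta>) \<longlongrightarrow> 2 * B * 0) (at_right 0)" by (intro tendsto_intros)
    then show "((\<lambda>\<delta>. 2 * B * \<delta>) \<longlongrightarrow> 0) (at_right 0)" by simp
    show "\<forall>\<^sub>F \<delta> in at_right 0. norm ((LINT s|lborel. indicator {s. \<delta> < \<bar>p - s\<bar>} s *\<^sub>R A s) - integral\<^sup>L lborel A) \<le> 2 * B * \<delta>"
      using eventually_at_right_less[of "0::real"] by eventually_elim (rule est)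
  qed
  then show ?thesis by (simp add: Lim_null[symmetric])
qed

lemma continuous_supp_bounded:
  fixes A :: "real \<Rightarrow> complex"
  assumes "continuous_on UNIV A" "\<And>s. L \<le> \<bar>s\<bar> \<Longrightarrow> A s = 0"
  obtains B where "\<And>s. norm (A s) \<le> B"
proof -
  have "bounded (A ` {-L..L})"
    by (intro compact_imp_bounded compact_continuous_image continuous_on_subset[OF assms(1)] compact_Icc subset_UNIV)
  then obtain B where B: "0 < B" "\<forall>y\<in>A ` {-L..L}. norm y \<le> B" by (auto simp: bounded_pos)
  have "norm (A s) \<le> B" for s
    using B assms(2)[of s] by (cases "L \<le> \<bar>s\<bar>") (auto simp: abs_le_iff not_le abs_less_iff)
  then show thesis by (rule that)
qed

lemma mean_derivative_segment:
  assumes "\<And>q. (h has_vector_derivative h' q) (at q)" "t \<noteq> 0"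
  shows "of_real (2 * t) * mean 1 (\<lambda>\<theta>. h' (p + t * \<theta>)) = h (p + t) - h (p - t)"
proof -
  have "((\<lambda>\<theta>. h (p + t * \<theta>)) has_vector_derivative t *\<^sub>R h' (p + t * \<theta>)) (at \<theta> within {-1..1})" for \<theta>
    by (rule has_vector_derivative_at_within[OF vector_derivative_compose_affine[OF assms(1)]])
  then have "((\<lambda>\<theta>. t *\<^sub>R h' (p + t * \<theta>)) has_integral h (p + t * 1) - h (p + t * (-1))) {-1..1}"
    by (intro fundamental_theorem_of_calculus) auto
  then have "t *\<^sub>R integral {-1..1} (\<lambda>\<theta>. h' (p + t * \<theta>)) = h (p + t) - h (p - t)"
    by (simp add: integral_unique flip: integral_cmul)
  then show ?thesis by (simp add: mean_def scaleR_conv_of_real)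
qed

text \<open>The far kernel contributes an ordinary integral. The near kernel is odd, so reflection
  about \<open>p\<close> removes the singularity and leaves \<open>nearop\<close>; both truncated
  integrals then converge, which determines the value of \<open>Lim\<close>.\<close>

lemma hilbert_eq:
  fixes h :: "nat \<Rightarrow> real \<Rightarrow> complex"
  assumes "bump_sequence L h" and \<epsilon>: "0 < \<epsilon>"
  shows "hilbert (h 0) p = complex_of_real (1 / pi) *
     (- of_real (2 * \<epsilon>) * nearop \<epsilon> (\<lambda>t \<theta>. of_real (near_weight \<epsilon> t)) (h 1) p +
      of_real (2 * L) * mean L (\<lambda>s. h 0 s * of_real (far_kernel \<epsilon> (p - s))))"
proof -
  interpret bump_sequence L h by fact
  define A where "A s = h 0 s * of_real (far_kernel \<epsilon> (p - s))" for s
  define B where "B t = - of_real (near_weight \<epsilon> t) * mean 1 (\<lambda>\<theta>. h 1 (p + t * \<theta>))" for t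
  have cf: "continuous_on U (\<lambda>s. far_kernel \<epsilon> (p - s))" for U
    by (rule continuous_on_compose2[OF continuous_on_far_kernel[OF \<epsilon>, of UNIV]]) (auto intro!: continuous_intros)
  have cn: "continuous_on U (\<lambda>s. near_weight \<epsilon> (p - s))" for U
    by (rule continuous_on_compose2[OF continuous_on_near_weight[OF \<epsilon>, of UNIV]]) (auto intro!: continuous_intros)
  have A: "continuous_on UNIV A" unfolding A_def by (intro continuous_intros cont cf)
  have A0: "A s = 0" if "L \<le> \<bar>s\<bar>" for s using supp[OF that] by (simp add: A_def)
  have ch: "continuous_on UNIV (\<lambda>x. h 1 (f x))" if "continuous_on UNIV f" for f :: "'x::topological_space \<Rightarrow> real"
    using continuous_on_compose2[OF cont[of UNIV 1] that] by simp
  have B: "continuous_on UNIV B"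
    unfolding B_def
    by (intro continuous_intros continuous_on_near_weight \<epsilon> continuous_on_mean_param)
      (unfold case_prod_beta, intro ch continuous_intros)
  have B0: "B t = 0" if "\<epsilon> \<le> \<bar>t\<bar>" for t using near_weight_supp[OF \<epsilon> that] by (simp add: B_def)
  obtain bA where bA: "\<And>s. norm (A s) \<le> bA" using continuous_supp_bounded[OF A A0] by metis
  obtain bB where bB: "\<And>s. norm (B s) \<le> bB" using continuous_supp_bounded[OF B B0] by metis
  note iA = continuous_supp_integral[OF A A0 L] and iB = continuous_supp_integral[OF B B0 \<epsilon>]
  define I where "I \<delta> = (LINT s:{s. \<delta> < \<bar>p - s\<bar>}|lborel. h 0 s / complex_of_real (p - s))" for \<delta>
  have I: "I \<delta> = (LINT s|lborel. indicator {s. \<delta> < \<bar>p - s\<bar>} s *\<^sub>R A s) +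
      (LINT t|lborel. indicator {t. \<delta> < \<bar>0 - t\<bar>} t *\<^sub>R B t)" if \<delta>: "0 < \<delta>" for \<delta>
  proof -
    let ?ind = "\<lambda>s. indicator {s. \<delta> < \<bar>p - s\<bar>} s :: real"
    define F where "F s = ?ind s *\<^sub>R (h 0 s * of_real (near_weight \<epsilon> (p - s) / (p - s)))" for s
    have m: "{s::real. \<delta> < \<bar>p - s\<bar>} \<in> sets lborel"
      by (simp add: borel_open open_Collect_less continuous_intros)
    have ih: "integrable lborel (h 0)"
      by (rule continuous_supp_integral(1)[OF cont supp L])
    \<comment> \<open>Truncation bounds the singular quotient by \<open>1 / \<delta>\<close>, so
      this part is integrable and can be split off before the limit is taken.\<close>
    have iF: "integrable lborel F"
    proof (rule Bochner_Integration.integrable_bound)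
      show "integrable lborel (\<lambda>s. of_real (1 / \<delta>) * h 0 s)" using ih by simp
      have "h 0 \<in> borel_measurable borel" "(\<lambda>s. near_weight \<epsilon> (p - s)) \<in> borel_measurable borel"
        using cont cn by (auto intro: borel_measurable_continuous_onI)
      then show "F \<in> borel_measurable lborel"
        unfolding F_def using m by measurable
      show "AE s in lborel. norm (F s) \<le> norm (of_real (1 / \<delta>) * h 0 s)"
      proof (rule AE_I2)
        fix s
        show "norm (F s) \<le> norm (of_real (1 / \<delta>) * h 0 s)"
        proof (cases "\<delta> < \<bar>p - s\<bar>")
          case True
          have "\<bar>near_weight \<epsilon> (p - s)\<bar> / \<bar>p - s\<bar> \<le> 1 / \<delta>"
            using near_weight_bounds[OF \<epsilon>, of "p - s"] True \<delta> by (intro frac_le) auto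
          then have "norm (h 0 s) * (\<bar>near_weight \<epsilon> (p - s)\<bar> / \<bar>p - s\<bar>) \<le> norm (h 0 s) * (1 / \<delta>)"
            by (intro mult_left_mono) auto
          then show ?thesis
            using True \<delta> by (simp add: F_def norm_mult norm_divide mult.commute del: of_real_diff of_real_divide)
        qed (simp add: F_def)
      qed
    qed
    have "I \<delta> = (LINT s|lborel. ?ind s *\<^sub>R A s + F s)"
      unfolding I_def set_lebesgue_integral_def
    proof (rule Bochner_Integration.integral_cong[OF refl])
      fix s
      show "?ind s *\<^sub>R (h 0 s / complex_of_real (p - s)) = ?ind s *\<^sub>R A s + F s"
      proof (cases "\<delta> < \<bar>p - s\<bar>")
        case True
        then have "p - s \<noteq> 0" using \<delta> by auto
        from kernel_split[OF \<epsilon> this]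
        have "h 0 s * of_real (1 / (p - s)) = A s + h 0 s * of_real (near_weight \<epsilon> (p - s) / (p - s))"
          unfolding A_def by (simp only: of_real_add ring_distribs)
        then show ?thesis using True by (simp add: F_def divide_inverse)
      qed (simp add: F_def)
    qed
    also have "\<dots> = (LINT s|lborel. ?ind s *\<^sub>R A s) + integral\<^sup>L lborel F"
      by (rule Bochner_Integration.integral_add[OF integrable_mult_indicator[OF m iA(1)] iF])
    also have "integral\<^sup>L lborel F = (LINT t|lborel. indicator {t. \<delta> < \<bar>0 - t\<bar>} t *\<^sub>R B t)"
    proof -
      \<comment> \<open>The integral is written twice, by the substitutions \<open>p - t\<close> and
        \<open>p + t\<close>; half the sum is the symmetrized integral.\<close>
      have 1: "integral\<^sup>L lborel F = (LINT t|lborel. F (p - t))" and i1: "integrable lborel (\<lambda>t. F (p - t))"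
        using lborel_integral_real_affine[of "-1" F p] lborel_integrable_real_affine[OF iF, of "-1" p] by simp_all
      have 2: "integral\<^sup>L lborel F = (LINT t|lborel. F (p + t))" and i2: "integrable lborel (\<lambda>t. F (p + t))"
        using lborel_integral_real_affine[of 1 F p] lborel_integrable_real_affine[OF iF, of 1 p] by simp_all
      have "2 * integral\<^sup>L lborel F = (LINT t|lborel. F (p - t)) + (LINT t|lborel. F (p + t))"
        using 1 2 by simp
      also have "\<dots> = (LINT t|lborel. F (p - t) + F (p + t))"
        by (rule Bochner_Integration.integral_add[OF i1 i2, symmetric])
      also have "\<dots> = (LINT t|lborel. 2 * (indicator {t. \<delta> < \<bar>0 - t\<bar>} t *\<^sub>R B t))"
      proof (rule Bochner_Integration.integral_cong[OF refl])
        fix t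
        show "F (p - t) + F (p + t) = 2 * (indicator {t. \<delta> < \<bar>0 - t\<bar>} t *\<^sub>R B t)"
        proof (cases "\<delta> < \<bar>t\<bar>")
          case True
          then have t: "t \<noteq> 0" using \<delta> by auto
          have "F (p - t) + F (p + t) = of_real (near_weight \<epsilon> t / t) * (h 0 (p - t) - h 0 (p + t))"
            using True t by (simp add: F_def algebra_simps)
          also have "h 0 (p - t) - h 0 (p + t) = - (of_real (2 * t) * mean 1 (\<lambda>\<theta>. h 1 (p + t * \<theta>)))"
            using mean_derivative_segment[of "h 0" "h 1" t p] deriv[of 0] t by simp
          finally show ?thesis using True t by (simp add: B_def)
        qed (simp add: F_def)
      qed
      also have "\<dots> = 2 * (LINT t|lborel. indicator {t. \<delta> < \<bar>0 - t\<bar>} t *\<^sub>R B t)"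
        by (rule integral_mult_right_zero)
      finally show ?thesis by simp
    qed
    finally show ?thesis .
  qed
  have "((\<lambda>\<delta>. (LINT s|lborel. indicator {s. \<delta> < \<bar>p - s\<bar>} s *\<^sub>R A s) +
      (LINT t|lborel. indicator {t. \<delta> < \<bar>0 - t\<bar>} t *\<^sub>R B t)) \<longlongrightarrow> integral\<^sup>L lborel A + integral\<^sup>L lborel B) (at_right 0)"
    by (intro tendsto_add cut_integral_tendsto[OF iA(1) bA] cut_integral_tendsto[OF iB(1) bB])
  then have "(I \<longlongrightarrow> integral\<^sup>L lborel A + integral\<^sup>L lborel B) (at_right 0)"
    by (rule Lim_transform_eventually)
      (use eventually_at_right_less[of "0::real"] I in \<open>auto elim: eventually_mono\<close>)
  then have "Lim (at_right 0) I = integral\<^sup>L lborel A + integral\<^sup>L lborel B"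
    by (intro tendsto_Lim) simp_all
  moreover have "integral\<^sup>L lborel B = - of_real (2 * \<epsilon>) * nearop \<epsilon> (\<lambda>t \<theta>. of_real (near_weight \<epsilon> t)) (h 1) p"
  proof -
    have "B = (\<lambda>t. - 1 * mean 1 (\<lambda>\<theta>. of_real (near_weight \<epsilon> t) * h 1 (p + t * \<theta>)))"
      by (simp add: B_def[abs_def] mean_cmult)
    then have "mean \<epsilon> B = - 1 * nearop \<epsilon> (\<lambda>t \<theta>. of_real (near_weight \<epsilon> t)) (h 1) p"
      unfolding nearop_def by (simp only: mean_cmult[OF \<epsilon>])
    moreover have "integral\<^sup>L lborel B = of_real (2 * \<epsilon>) * mean \<epsilon> B" by (rule iB(2))
    ultimately show ?thesis by simp
  qed
  moreover have "integral\<^sup>L lborel A = of_real (2 * L) * mean L A" by (rule iA(2))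
  ultimately have "Lim (at_right 0) I = of_real (2 * L) * mean L A +
      - of_real (2 * \<epsilon>) * nearop \<epsilon> (\<lambda>t \<theta>. of_real (near_weight \<epsilon> t)) (h 1) p"
    by simp
  then show ?thesis
    unfolding hilbert_def I_def[abs_def] A_def[abs_def] by (simp only: add.commute)
qed

section \<open>Filtering modulated functions\<close>

abbreviation mode :: "real \<Rightarrow> real \<Rightarrow> complex" where
  "mode \<alpha> p \<equiv> exp (- \<i> * complex_of_real (\<alpha> * p))"

lemma plane_wave_mode: "plane_wave (\<alpha>::real) p = mode \<alpha> p"
  by (simp add: mult.commute)

lemma mode_add: "mode \<alpha> (p + q) = mode \<alpha> p * mode \<alpha> q"
  by (simp add: algebra_simps flip: exp_add)

lemma mode_deriv: "(mode \<alpha> has_vector_derivative - \<i> * of_real \<alpha> * mode \<alpha> s) (at s)"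
proof -
  have "((\<lambda>z. exp (- \<i> * of_real \<alpha> * z)) has_field_derivative - \<i> * of_real \<alpha> * exp (- \<i> * of_real \<alpha> * of_real s)) (at (of_real s))"
    by (auto intro!: derivative_eq_intros)
  from has_vector_derivative_real_field[OF this] show ?thesis by (simp add: mult.assoc)
qed

text \<open>The derivative conjugated by \<open>mode \<alpha>\<close>: differentiating the mode
  times \<open>g\<close> applies it to \<open>g\<close> behind the mode. With the oscillation kept
  outside, the remaining factor grows only polynomially in \<open>\<alpha>\<close>.\<close>

definition modderiv :: "real \<Rightarrow> (nat \<Rightarrow> real \<Rightarrow> complex) \<Rightarrow> nat \<Rightarrow> real \<Rightarrow> complex" where
  "modderiv \<alpha> g k p = g (Suc k) p - \<i> * of_real \<alpha> * g k p"

lemma modderiv_deriv: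
  assumes "\<And>k t. (g k has_vector_derivative g (Suc k) t) (at t)"
  shows "(modderiv \<alpha> g k has_vector_derivative modderiv \<alpha> g (Suc k) t) (at t)"
  unfolding modderiv_def by (intro has_vector_derivative_diff has_vector_derivative_mult_right assms)

lemma mode_mult_deriv:
  assumes "\<And>k t. (g k has_vector_derivative g (Suc k) t) (at t)"
  shows "((\<lambda>p. mode \<alpha> p * g k p) has_vector_derivative mode \<alpha> t * modderiv \<alpha> g k t) (at t)"
  using has_vector_derivative_mult[OF mode_deriv[of \<alpha> t] assms[of k t]]
  by (simp add: modderiv_def algebra_simps)

lemma norm_modderiv_le:
  assumes "norm (g (Suc k) p) \<le> B" "norm (g k p) \<le> B"
  shows "norm (modderiv \<alpha> g k p) \<le> (1 + \<bar>\<alpha>\<bar>) * B"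
proof -
  have "norm (modderiv \<alpha> g k p) \<le> norm (g (Suc k) p) + norm (\<i> * of_real \<alpha> * g k p)"
    unfolding modderiv_def by (rule norm_triangle_ineq4)
  also have "\<dots> \<le> B + \<bar>\<alpha>\<bar> * B"
    using assms by (intro add_mono) (auto simp: norm_mult intro!: mult_left_mono)
  finally show ?thesis by (simp add: algebra_simps)
qed

lemma bump_sequence_modderiv:
  assumes "bump_sequence L g"
  shows "bump_sequence L (modderiv \<alpha> g)"
proof -
  interpret bump_sequence L g by fact
  show ?thesis
    using L supp modderiv_deriv[of g, OF deriv] by unfold_locales (auto simp: modderiv_def)
qed

lemma bump_sequence_modderiv_iterate:
  "bump_sequence L g \<Longrightarrow> bump_sequence L ((modderiv \<alpha> ^^ j) g)"
  by (induction j) (auto intro: bump_sequence_modderiv)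

lemma bump_sequence_mode:
  assumes "bump_sequence L g"
  shows "bump_sequence L (\<lambda>j p. mode \<alpha> p * (modderiv \<alpha> ^^ j) g 0 p)"
proof
  note b = bump_sequence_modderiv_iterate[OF assms, of _ \<alpha>]
  show "0 < L" using assms by (rule bump_sequence.L)
  show "((\<lambda>p. mode \<alpha> p * (modderiv \<alpha> ^^ k) g 0 p) has_vector_derivative
      mode \<alpha> t * (modderiv \<alpha> ^^ Suc k) g 0 t) (at t)" for k t
    using mode_mult_deriv[of "(modderiv \<alpha> ^^ k) g", OF bump_sequence.deriv[OF b]] by simp
  show "mode \<alpha> t * (modderiv \<alpha> ^^ k) g 0 t = 0" if "L \<le> \<bar>t\<bar>" for k t
    using bump_sequence.supp[OF b that] by simp
qed

definition far_deriv :: "real \<Rightarrow> nat \<Rightarrow> real \<Rightarrow> complex" where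
  "far_deriv \<epsilon> j = (partial_deriv 1 ^^ j) (\<lambda>t. of_real (far_kernel \<epsilon> t))"

lemma far_deriv_deriv:
  "0 < \<epsilon> \<Longrightarrow> (far_deriv \<epsilon> j has_vector_derivative far_deriv \<epsilon> (Suc j) t) (at t)"
  unfolding far_deriv_def by (intro smooth_derivative_sequence smooth_far_kernel)

text \<open>Two indices, because partial integration in \<open>s\<close> trades a factor
  \<open>\<alpha>\<close> for a derivative of either \<open>g\<close> or the kernel, while
  derivatives in \<open>p\<close> fall on the kernel alone.\<close>

definition far_part :: "real \<Rightarrow> real \<Rightarrow> real \<Rightarrow> (nat \<Rightarrow> real \<Rightarrow> complex) \<Rightarrow> nat \<Rightarrow> nat \<Rightarrow> real \<Rightarrow> complex" where
  "far_part L \<epsilon> \<alpha> g i j p = mean L (\<lambda>s. g i s * far_deriv \<epsilon> j (p - s) * mode \<alpha> s)"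

text \<open>Two conjugated derivatives: one from the averaged derivative in the Hilbert transform,
  one from the derivative in the filter. The mode at \<open>p + t * \<theta>\<close> is divided into
  the mode at \<open>p\<close>, which is pulled out, and a factor absorbed by the weight.\<close>

definition near_part :: "real \<Rightarrow> real \<Rightarrow> (nat \<Rightarrow> real \<Rightarrow> complex) \<Rightarrow> nat \<Rightarrow> real \<Rightarrow> complex" where
  "near_part \<epsilon> \<alpha> g k p =
     nearop \<epsilon> (\<lambda>t \<theta>. of_real (near_weight \<epsilon> t) * mode \<alpha> (t * \<theta>)) ((modderiv \<alpha> ^^ 2) g k) p"

lemma far_deriv_continuous: "0 < \<epsilon> \<Longrightarrow> continuous_on A (far_deriv \<epsilon> j)"
  using far_deriv_deriv by (rule vector_derivative_sequence_continuous)

lemma far_deriv_continuous_compose: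
  assumes "0 < \<epsilon>" "continuous_on A f"
  shows "continuous_on A (\<lambda>x. far_deriv \<epsilon> j (f x))"
  using continuous_on_compose2[OF far_deriv_continuous[OF assms(1), of UNIV] assms(2)] by simp

lemma far_part_deriv:
  assumes "bump_sequence L g" "0 < \<epsilon>"
  shows "(far_part L \<epsilon> \<alpha> g i j has_vector_derivative far_part L \<epsilon> \<alpha> g i (Suc j) p) (at p)"
proof -
  interpret bump_sequence L g by fact
  have c: "continuous_on A (\<lambda>x. g i (f x))" if "continuous_on A f" for A and f :: "'x::topological_space \<Rightarrow> real"
    using continuous_on_compose2[OF cont[of UNIV i] that] by simp
  show ?thesis
    unfolding far_part_def
  proof (rule mean_leibniz)
    fix p s
    have "((\<lambda>p. far_deriv \<epsilon> j (- s + 1 * p)) has_vector_derivative 1 *\<^sub>R far_deriv \<epsilon> (Suc j) (- s + 1 * p)) (at p)"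
      by (rule vector_derivative_compose_affine[OF far_deriv_deriv[OF assms(2)]])
    then have "((\<lambda>p. far_deriv \<epsilon> j (p - s)) has_vector_derivative far_deriv \<epsilon> (Suc j) (p - s)) (at p)"
      by simp
    then show "((\<lambda>p. g i s * far_deriv \<epsilon> j (p - s) * mode \<alpha> s) has_vector_derivative
        g i s * far_deriv \<epsilon> (Suc j) (p - s) * mode \<alpha> s) (at p)"
      by (intro has_vector_derivative_mult_right has_vector_derivative_mult_left)
  next
    show "continuous_on UNIV (\<lambda>s. g i s * far_deriv \<epsilon> j (p - s) * mode \<alpha> s)" for p
      by (intro continuous_intros c far_deriv_continuous_compose assms)
    show "continuous_on UNIV (\<lambda>(p, s). g i s * far_deriv \<epsilon> (Suc j) (p - s) * mode \<alpha> s)"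
      unfolding case_prod_beta by (intro continuous_intros c far_deriv_continuous_compose assms)
  qed
qed

lemma far_part_by_parts:
  assumes "bump_sequence L g" "0 < \<epsilon>"
  shows "\<i> * of_real \<alpha> * far_part L \<epsilon> \<alpha> g i j p = far_part L \<epsilon> \<alpha> g (Suc i) j p - far_part L \<epsilon> \<alpha> g i (Suc j) p"
proof -
  interpret bump_sequence L g by fact
  let ?f = "\<lambda>s. g i s * far_deriv \<epsilon> j (p - s)"
  let ?f' = "\<lambda>s. g (Suc i) s * far_deriv \<epsilon> j (p - s) - g i s * far_deriv \<epsilon> (Suc j) (p - s)"
  have c: "continuous_on A (\<lambda>s. far_deriv \<epsilon> j (p - s))" for A j
    by (intro far_deriv_continuous_compose assms continuous_intros)
  have "mean L (\<lambda>s. ?f' s * mode \<alpha> s) = \<i> * of_real \<alpha> * mean L (\<lambda>s. ?f s * mode \<alpha> s)"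
  proof (rule mean_by_parts[OF L])
    fix s
    have "((\<lambda>s. far_deriv \<epsilon> j (p + (-1) * s)) has_vector_derivative (-1) *\<^sub>R far_deriv \<epsilon> (Suc j) (p + (-1) * s)) (at s)"
      by (rule vector_derivative_compose_affine[OF far_deriv_deriv[OF assms(2)]])
    then have "((\<lambda>s. far_deriv \<epsilon> j (p - s)) has_vector_derivative - far_deriv \<epsilon> (Suc j) (p - s)) (at s)"
      by simp
    from has_vector_derivative_mult[OF deriv this]
    show "(?f has_vector_derivative ?f' s) (at s)" by simp
    show "continuous_on {-L..L} ?f'" by (intro continuous_intros cont c)
    show "g i L * far_deriv \<epsilon> j (p - L) = 0" "g i (-L) * far_deriv \<epsilon> j (p - (-L)) = 0"
      using supp L by auto
  qed
  moreover have "mean L (\<lambda>s. ?f' s * mode \<alpha> s) = far_part L \<epsilon> \<alpha> g (Suc i) j p - far_part L \<epsilon> \<alpha> g i (Suc j) p"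
    unfolding far_part_def left_diff_distrib by (intro mean_diff[OF L] continuous_intros cont c)
  ultimately show ?thesis by (simp add: far_part_def)
qed

text \<open>Each partial integration raises one of the two indices, so \<open>j\<close> and
  \<open>i\<close> vary in the induction. The constant comes from the kernel on a bounded set;
  \<open>g\<close> enters only through \<open>B\<close>.\<close>

lemma far_part_bound:
  assumes "0 < L" "0 < \<epsilon>"
  shows "\<exists>C>0. \<forall>g \<alpha> B i p. bump_sequence L g \<longrightarrow> \<bar>p\<bar> \<le> R \<longrightarrow>
    (\<forall>k s. i \<le> k \<longrightarrow> k \<le> i + M \<longrightarrow> norm (g k s) \<le> B) \<longrightarrow>
    \<bar>\<alpha>\<bar> ^ M * norm (far_part L \<epsilon> \<alpha> g i j p) \<le> C * B"
proof (induction M arbitrary: j)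
  case 0
  obtain C where C: "0 < C" "\<And>q. q \<in> cball 0 (R + L) \<Longrightarrow> norm (far_deriv \<epsilon> j q) \<le> C"
    using bounded_on_cball[OF far_deriv_continuous[OF assms(2), of "cball 0 (R + L)" j]] by metis
  show ?case
  proof (intro exI[of _ C] conjI allI impI C(1))
    fix g :: "nat \<Rightarrow> real \<Rightarrow> complex" and \<alpha> B i p
    assume "bump_sequence L g" and p: "\<bar>p\<bar> \<le> R"
      and B: "\<forall>k s. i \<le> k \<longrightarrow> k \<le> i + 0 \<longrightarrow> norm (g k s) \<le> B"
    then interpret bump_sequence L g by simp
    have "norm (far_part L \<epsilon> \<alpha> g i j p) \<le> C * B"
      unfolding far_part_def
    proof (rule norm_mean_le[OF L])
      show "continuous_on {-L..L} (\<lambda>s. g i s * far_deriv \<epsilon> j (p - s) * mode \<alpha> s)"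
        by (intro continuous_intros cont far_deriv_continuous_compose assms)
      fix s assume s: "s \<in> {-L..L}"
      have "norm (g i s) \<le> B" using B by simp
      moreover have "norm (far_deriv \<epsilon> j (p - s)) \<le> C"
        using s p by (intro C(2)) auto
      ultimately have "norm (far_deriv \<epsilon> j (p - s)) * norm (g i s) \<le> C * B"
        using C(1) by (intro mult_mono) auto
      then show "norm (g i s * far_deriv \<epsilon> j (p - s) * mode \<alpha> s) \<le> C * B"
        by (simp add: norm_mult mult.commute)
    qed
    then show "\<bar>\<alpha>\<bar> ^ 0 * norm (far_part L \<epsilon> \<alpha> g i j p) \<le> C * B" by simp
  qed
next
  case (Suc M)
  obtain C1 where C1: "0 < C1" "\<And>g \<alpha> B i p. bump_sequence L g \<Longrightarrow> \<bar>p\<bar> \<le> R \<Longrightarrow>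
    (\<forall>k s. i \<le> k \<longrightarrow> k \<le> i + M \<longrightarrow> norm (g k s) \<le> B) \<Longrightarrow>
    \<bar>\<alpha>\<bar> ^ M * norm (far_part L \<epsilon> \<alpha> g i j p) \<le> C1 * B"
    using Suc.IH[of j] by metis
  obtain C2 where C2: "0 < C2" "\<And>g \<alpha> B i p. bump_sequence L g \<Longrightarrow> \<bar>p\<bar> \<le> R \<Longrightarrow>
    (\<forall>k s. i \<le> k \<longrightarrow> k \<le> i + M \<longrightarrow> norm (g k s) \<le> B) \<Longrightarrow>
    \<bar>\<alpha>\<bar> ^ M * norm (far_part L \<epsilon> \<alpha> g i (Suc j) p) \<le> C2 * B"
    using Suc.IH[of "Suc j"] by metis
  show ?case
  proof (intro exI[of _ "C1 + C2"] conjI allI impI)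
    show "0 < C1 + C2" using C1 C2 by simp
    fix g :: "nat \<Rightarrow> real \<Rightarrow> complex" and \<alpha> B i p
    assume g: "bump_sequence L g" and p: "\<bar>p\<bar> \<le> R"
      and B: "\<forall>k s. i \<le> k \<longrightarrow> k \<le> i + Suc M \<longrightarrow> norm (g k s) \<le> B"
    have "\<bar>\<alpha>\<bar> ^ Suc M * norm (far_part L \<epsilon> \<alpha> g i j p) =
        \<bar>\<alpha>\<bar> ^ M * norm (\<i> * of_real \<alpha> * far_part L \<epsilon> \<alpha> g i j p)"
      by (simp add: norm_mult)
    also have "\<dots> \<le> \<bar>\<alpha>\<bar> ^ M * (norm (far_part L \<epsilon> \<alpha> g (Suc i) j p) + norm (far_part L \<epsilon> \<alpha> g i (Suc j) p))"
      unfolding far_part_by_parts[OF g assms(2)] by (intro mult_left_mono norm_triangle_ineq4) auto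
    also have "\<dots> \<le> C1 * B + C2 * B"
      unfolding distrib_left by (intro add_mono C1(2)[OF g p] C2(2)[OF g p]) (use B in auto)
    finally show "\<bar>\<alpha>\<bar> ^ Suc M * norm (far_part L \<epsilon> \<alpha> g i j p) \<le> (C1 + C2) * B"
      by (simp add: algebra_simps)
  qed
qed

context
  fixes L \<epsilon> \<alpha> :: real and g :: "nat \<Rightarrow> real \<Rightarrow> complex"
  assumes g: "bump_sequence L g" and \<epsilon>: "0 < \<epsilon>"
begin

lemma near_weight_mode_continuous:
  "continuous_on UNIV (\<lambda>(t, \<theta>). complex_of_real (near_weight \<epsilon> t) * mode \<alpha> (t * \<theta>))"
proof -
  have "continuous_on UNIV (\<lambda>x::real \<times> real. near_weight \<epsilon> (fst x))"
    using continuous_on_compose2[OF continuous_on_near_weight[OF \<epsilon>, of UNIV]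
        continuous_on_fst[OF continuous_on_id, of UNIV]] by simp
  then show ?thesis unfolding case_prod_beta by (intro continuous_intros)
qed

lemma near_part_deriv: "(near_part \<epsilon> \<alpha> g k has_vector_derivative near_part \<epsilon> \<alpha> g (Suc k) p) (at p)"
proof -
  interpret w: bump_sequence L "(modderiv \<alpha> ^^ 2) g" by (rule bump_sequence_modderiv_iterate[OF g])
  show ?thesis
    unfolding near_part_def by (intro nearop_deriv near_weight_mode_continuous \<epsilon> w.deriv w.cont)
qed

text \<open>Each of the two conjugated derivatives costs a factor
  \<open>1 + \<bar>\<alpha>\<bar>\<close>; averaging costs nothing.\<close>

lemma near_part_bound:
  assumes "\<And>i s. i \<le> k + 2 \<Longrightarrow> norm (g i s) \<le> B"
  shows "norm (near_part \<epsilon> \<alpha> g k p) \<le> (1 + \<bar>\<alpha>\<bar>) ^ 2 * B"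
proof -
  interpret w: bump_sequence L "(modderiv \<alpha> ^^ 2) g" by (rule bump_sequence_modderiv_iterate[OF g])
  have 1: "norm (modderiv \<alpha> g i s) \<le> (1 + \<bar>\<alpha>\<bar>) * B" if "i \<le> k + 1" for i s
    using that assms by (intro norm_modderiv_le) auto
  have "norm (modderiv \<alpha> (modderiv \<alpha> g) k s) \<le> (1 + \<bar>\<alpha>\<bar>) * ((1 + \<bar>\<alpha>\<bar>) * B)" for s
    using norm_modderiv_le[of "modderiv \<alpha> g" k s "(1 + \<bar>\<alpha>\<bar>) * B" \<alpha>] 1[of "Suc k" s] 1[of k s] by simp
  then have 2: "norm ((modderiv \<alpha> ^^ 2) g k s) \<le> (1 + \<bar>\<alpha>\<bar>) ^ 2 * B" for s
    by (simp add: numeral_2_eq_2 mult.assoc)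
  show ?thesis
    unfolding near_part_def
    by (rule norm_nearop_le[OF near_weight_mode_continuous \<epsilon> w.cont _ 2])
      (use near_weight_bounds[OF \<epsilon>] in \<open>auto simp: norm_mult\<close>)
qed

lemma near_part_supp:
  assumes "\<And>k q. r < \<bar>q - p0\<bar> \<Longrightarrow> g k q = 0" "r + \<epsilon> < \<bar>p - p0\<bar>"
  shows "near_part \<epsilon> \<alpha> g k p = 0"
  unfolding near_part_def
  by (rule nearop_supp[OF near_weight_mode_continuous \<epsilon>, of r p0])
    (use assms in \<open>auto simp: numeral_2_eq_2 modderiv_def\<close>)

lemma vector_derivative_hilbert:
  "vector_derivative (hilbert (\<lambda>p. mode \<alpha> p * g 0 p)) (at p) = complex_of_real (1 / pi) *
     (- of_real (2 * \<epsilon>) * (mode \<alpha> p * near_part \<epsilon> \<alpha> g 0 p) + of_real (2 * L) * far_part L \<epsilon> \<alpha> g 0 1 p)"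
proof -
  define h where "h = (\<lambda>j p. mode \<alpha> p * (modderiv \<alpha> ^^ j) g 0 p)"
  have hb: "bump_sequence L h" unfolding h_def by (rule bump_sequence_mode[OF g])
  interpret h: bump_sequence L h by (rule hb)
  have c: "continuous_on UNIV (\<lambda>(t, \<theta>::real). complex_of_real (near_weight \<epsilon> t))"
  proof -
    have "continuous_on UNIV (\<lambda>x::real \<times> real. near_weight \<epsilon> (fst x))"
      using continuous_on_compose2[OF continuous_on_near_weight[OF \<epsilon>, of UNIV]
          continuous_on_fst[OF continuous_on_id, of UNIV]] by simp
    then show ?thesis unfolding case_prod_beta by (intro continuous_intros)
  qed
  have far: "mean L (\<lambda>s. h 0 s * of_real (far_kernel \<epsilon> (p - s))) = far_part L \<epsilon> \<alpha> g 0 0 p" for p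
    by (simp add: far_part_def h_def far_deriv_def mult_ac)
  have hil: "hilbert (h 0) = (\<lambda>p. complex_of_real (1 / pi) *
     (- of_real (2 * \<epsilon>) * nearop \<epsilon> (\<lambda>t \<theta>. of_real (near_weight \<epsilon> t)) (h 1) p +
      of_real (2 * L) * far_part L \<epsilon> \<alpha> g 0 0 p))"
    using hilbert_eq[OF hb \<epsilon>] unfolding far by blast
  have n: "(nearop \<epsilon> (\<lambda>t \<theta>. of_real (near_weight \<epsilon> t)) (h 1) has_vector_derivative
      nearop \<epsilon> (\<lambda>t \<theta>. of_real (near_weight \<epsilon> t)) (h 2) p) (at p)"
    using nearop_deriv[OF c \<epsilon>, of "h 1" "h 2"] h.deriv[of 1] h.cont[of UNIV 2] by (simp add: numeral_2_eq_2)
  have f: "(far_part L \<epsilon> \<alpha> g 0 0 has_vector_derivative far_part L \<epsilon> \<alpha> g 0 1 p) (at p)"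
    using far_part_deriv[OF g \<epsilon>] by simp
  have "(hilbert (h 0) has_vector_derivative complex_of_real (1 / pi) *
     (- of_real (2 * \<epsilon>) * nearop \<epsilon> (\<lambda>t \<theta>. of_real (near_weight \<epsilon> t)) (h 2) p +
      of_real (2 * L) * far_part L \<epsilon> \<alpha> g 0 1 p)) (at p)"
    unfolding hil by (intro has_vector_derivative_mult_right has_vector_derivative_add n f)
  moreover have "nearop \<epsilon> (\<lambda>t \<theta>. of_real (near_weight \<epsilon> t)) (h 2) p = mode \<alpha> p * near_part \<epsilon> \<alpha> g 0 p"
  proof -
    have "mean 1 (\<lambda>\<theta>. of_real (near_weight \<epsilon> t) * h 2 (p + t * \<theta>)) =
       mode \<alpha> p * mean 1 (\<lambda>\<theta>. of_real (near_weight \<epsilon> t) * mode \<alpha> (t * \<theta>) * (modderiv \<alpha> ^^ 2) g 0 (p + t * \<theta>))" for t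
      unfolding h_def mode_add by (subst mean_cmult[symmetric]) (simp_all only: zero_less_one mult_ac)
    then show ?thesis
      unfolding nearop_def near_part_def by (simp only: mean_cmult[OF \<epsilon>])
  qed
  ultimately have "vector_derivative (hilbert (h 0)) (at p) = complex_of_real (1 / pi) *
     (- of_real (2 * \<epsilon>) * (mode \<alpha> p * near_part \<epsilon> \<alpha> g 0 p) + of_real (2 * L) * far_part L \<epsilon> \<alpha> g 0 1 p)"
    by (simp only: vector_derivative_at)
  moreover have "h 0 = (\<lambda>p. mode \<alpha> p * g 0 p)" by (simp add: h_def)
  ultimately show ?thesis by simp
qed

lemma smooth_mode_near_part: "smooth (\<lambda>p. mode \<alpha> p * near_part \<epsilon> \<alpha> g 0 p)"
  using smooth_mult[OF smooth_plane_wave smooth_sequence(1)[of "near_part \<epsilon> \<alpha> g", OF near_part_deriv], of \<alpha>]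
  unfolding plane_wave_mode .

lemma smooth_far_part: "smooth (far_part L \<epsilon> \<alpha> g 0 1)"
proof -
  have "smooth (\<lambda>p. far_part L \<epsilon> \<alpha> g 0 (Suc 0) p)"
    using smooth_sequence(1)[of "\<lambda>j. far_part L \<epsilon> \<alpha> g 0 (Suc j)"] far_part_deriv[OF g \<epsilon>] by blast
  then show ?thesis by simp
qed

lemma distribution_hilbert:
  assumes u: "linear_on_smooth u"
  shows "u (\<lambda>p. vector_derivative (hilbert (\<lambda>p. mode \<alpha> p * g 0 p)) (at p)) = complex_of_real (1 / pi) *
     (- of_real (2 * \<epsilon>) * u (\<lambda>p. mode \<alpha> p * near_part \<epsilon> \<alpha> g 0 p) + of_real (2 * L) * u (far_part L \<epsilon> \<alpha> g 0 1))"
  unfolding vector_derivative_hilbert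
    linear_on_smooth_cmult[OF u smooth_add[OF smooth_cmult[OF smooth_mode_near_part] smooth_cmult[OF smooth_far_part]]]
    linear_on_smooth_add[OF u smooth_cmult[OF smooth_mode_near_part] smooth_cmult[OF smooth_far_part]]
    linear_on_smooth_cmult[OF u smooth_mode_near_part] linear_on_smooth_cmult[OF u smooth_far_part] ..

text \<open>A crude bound that grows in \<open>\<alpha>\<close>, for use where \<open>B\<close>
  decays in the transversal frequency: continuity of \<open>u\<close> costs \<open>N\<close> powers,
  the filter two.\<close>

lemma distribution_near_part:
  assumes u: "seminorm_bound u R C N" and B: "\<And>i s. i \<le> N + 2 \<Longrightarrow> norm (g i s) \<le> B"
  shows "norm (u (\<lambda>p. mode \<alpha> p * near_part \<epsilon> \<alpha> g 0 p)) \<le> C * (1 + \<bar>\<alpha>\<bar>) ^ (N + 2) * B"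
proof -
  have B0: "0 \<le> B" using order_trans[OF norm_ge_zero B[of 0 0]] by simp
  have "derivs_bounded R N (near_part \<epsilon> \<alpha> g 0) ((1 + \<bar>\<alpha>\<bar>) ^ 2 * B)"
    by (rule derivs_bounded_sequence[of "near_part \<epsilon> \<alpha> g", OF near_part_deriv])
      (use B in \<open>auto intro!: near_part_bound\<close>)
  from derivs_bounded_plane_wave_mult[OF smooth_sequence(1)[of "near_part \<epsilon> \<alpha> g", OF near_part_deriv] _ this, of \<alpha>]
  have "derivs_bounded R N (\<lambda>p. mode \<alpha> p * near_part \<epsilon> \<alpha> g 0 p) ((1 + \<bar>\<alpha>\<bar>) ^ N * ((1 + \<bar>\<alpha>\<bar>) ^ 2 * B))"
    unfolding plane_wave_mode using B0 by simp
  from seminorm_boundD[OF u smooth_mode_near_part _ this] B0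
  have "norm (u (\<lambda>p. mode \<alpha> p * near_part \<epsilon> \<alpha> g 0 p)) \<le> C * ((1 + \<bar>\<alpha>\<bar>) ^ N * ((1 + \<bar>\<alpha>\<bar>) ^ 2 * B))"
    by simp
  then show ?thesis by (simp only: power_add mult.assoc)
qed

end

text \<open>Smoothness of the kernel makes this part decay in \<open>\<alpha>\<close> for every
  distribution, whatever its singularities, uniformly over \<open>g\<close>.\<close>

lemma distribution_far_part:
  assumes lin: "linear_on_smooth u" and u: "seminorm_bound u R C N" and "0 < L" "0 < \<epsilon>"
  shows "\<exists>C'>0. \<forall>g \<alpha> B. bump_sequence L g \<longrightarrow> (\<forall>k s. k \<le> M \<longrightarrow> norm (g k s) \<le> B) \<longrightarrow>
    \<bar>\<alpha>\<bar> ^ M * norm (u (far_part L \<epsilon> \<alpha> g 0 1)) \<le> C' * B"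
proof -
  have "\<forall>j. \<exists>C>0. \<forall>g \<alpha> B i p. bump_sequence L g \<longrightarrow> \<bar>p\<bar> \<le> R \<longrightarrow>
    (\<forall>k s. i \<le> k \<longrightarrow> k \<le> i + M \<longrightarrow> norm (g k s) \<le> B) \<longrightarrow>
    \<bar>\<alpha>\<bar> ^ M * norm (far_part L \<epsilon> \<alpha> g i j p) \<le> C * B"
    using far_part_bound[OF assms(3,4)] by simp
  then obtain D where D: "\<And>j. 0 < D j" "\<And>j g \<alpha> B i p. bump_sequence L g \<Longrightarrow> \<bar>p\<bar> \<le> R \<Longrightarrow>
    (\<forall>k s. i \<le> k \<longrightarrow> k \<le> i + M \<longrightarrow> norm (g k s) \<le> B) \<Longrightarrow>
    \<bar>\<alpha>\<bar> ^ M * norm (far_part L \<epsilon> \<alpha> g i j p) \<le> D j * B"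
    by metis
  \<comment> \<open>Continuity of \<open>u\<close> looks at derivatives up to order
    \<open>N\<close>, that is, at kernel indices from \<open>1\<close> to
    \<open>N + 1\<close>.\<close>
  define E where "E = (\<Sum>j\<le>N. D (Suc j))"
  have E: "D (Suc j) \<le> E" if "j \<le> N" for j
    unfolding E_def using D(1) that by (intro member_le_sum) (auto intro: less_imp_le)
  have E0: "0 < E" using E[of 0] D(1)[of "Suc 0"] by simp
  have C: "0 < C" using u by (simp add: seminorm_bound_def)
  have "\<bar>\<alpha>\<bar> ^ M * norm (u (far_part L \<epsilon> \<alpha> g 0 1)) \<le> (C * E) * B"
    if g: "bump_sequence L g" and B: "\<forall>k s. k \<le> M \<longrightarrow> norm (g k s) \<le> B" for g \<alpha> B
  proof -
    have B0: "0 \<le> B" using order_trans[OF norm_ge_zero] B by blast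
    \<comment> \<open>With the weight inside the distribution, one application of the seminorm
      estimate yields the weighted bound.\<close>
    define F where "F = (\<lambda>j p. of_real (\<bar>\<alpha>\<bar> ^ M) * far_part L \<epsilon> \<alpha> g 0 (Suc j) p)"
    have F: "(F j has_vector_derivative F (Suc j) p) (at p)" for j p
      unfolding F_def by (intro has_vector_derivative_mult_right far_part_deriv[OF g assms(4)])
    have "norm (F j p) \<le> E * B" if "j \<le> N" "\<bar>p\<bar> \<le> R" for j p
    proof -
      have "norm (F j p) \<le> D (Suc j) * B"
        unfolding F_def norm_mult using D(2)[OF g that(2), of 0 B \<alpha> "Suc j"] B by (simp add: norm_power)
      also have "\<dots> \<le> E * B" using E[OF that(1)] B0 by (rule mult_right_mono)
      finally show ?thesis .
    qed
    then have "derivs_bounded R N (F 0) (E * B)" by (rule derivs_bounded_sequence[of F, OF F])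
    then have "norm (u (F 0)) \<le> C * (E * B)"
      using E0 B0 by (intro seminorm_boundD[OF u] smooth_sequence(1)[of F, OF F]) auto
    moreover have "F 0 = (\<lambda>p. of_real (\<bar>\<alpha>\<bar> ^ M) * far_part L \<epsilon> \<alpha> g 0 1 p)" by (simp add: F_def)
    ultimately show ?thesis
      using linear_on_smooth_cmult[OF lin smooth_far_part[OF g assms(4)], of "of_real (\<bar>\<alpha>\<bar> ^ M)"]
      by (simp add: norm_mult norm_power mult.assoc)
  qed
  then show ?thesis using C E0 by (intro exI[of _ "C * E"]) auto
qed

section \<open>Microlocal cutoffs\<close>

text \<open>The counterpart on the line of multiplication by a smooth function, with a constant that
  sees \<open>G\<close> only through bounds for \<open>G 0\<close> and one derivative, since
  \<open>G\<close> will be a near part varying with the frequency. Cones on the line are half lines,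
  selected by \<open>s\<close>.\<close>

lemma mode_mult_decay:
  fixes v :: "(real \<Rightarrow> complex) \<Rightarrow> complex"
  assumes lin: "linear_on_smooth v" and sb: "seminorm_bound v R C N" and RL: "R < L"
    and s: "s = 1 \<or> s = -1"
    and decay: "\<And>M::nat. \<exists>C. \<forall>\<sigma>\<ge>0. (1 + \<sigma>) ^ M * norm (v (plane_wave (\<sigma> * s))) \<le> C"
  shows "\<exists>C M'. 0 < C \<and> (\<forall>G \<alpha> B. bump_sequence L G \<longrightarrow> 0 \<le> \<alpha> * s \<longrightarrow>
    (\<forall>p. norm (G 0 p) \<le> B) \<longrightarrow> (\<forall>p. norm (G M' p) \<le> B) \<longrightarrow>
    (1 + \<bar>\<alpha>\<bar>) ^ M * norm (v (\<lambda>p. mode \<alpha> p * G 0 p)) \<le> C * B)"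
proof -
  define w where "w \<sigma> = v (plane_wave \<sigma>)" for \<sigma>
  define \<Gamma> where "\<Gamma> = {\<sigma>. 0 < \<sigma> * s}"
  have growth: "norm (w \<zeta>) \<le> C * (1 + norm \<zeta>) ^ N" for \<zeta>
    unfolding w_def by (rule seminorm_bound_plane_wave[OF sb])
  have "open \<Gamma>" unfolding \<Gamma>_def by (intro open_Collect_less continuous_intros)
  then have cone: "open_cone \<Gamma>" unfolding open_cone_def by (auto simp: \<Gamma>_def mult.assoc)
  have s\<Gamma>: "s \<in> \<Gamma>" "norm s = 1" using s by (auto simp: \<Gamma>_def)
  have decay': "\<exists>C. \<forall>\<zeta>\<in>\<Gamma>. (1 + norm \<zeta>) ^ K * norm (w \<zeta>) \<le> C" for K :: nat
  proof -
    obtain C' where C': "\<And>\<sigma>. 0 \<le> \<sigma> \<Longrightarrow> (1 + \<sigma>) ^ K * norm (v (plane_wave (\<sigma> * s))) \<le> C'"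
      using decay[of K] by blast
    have "(1 + norm \<zeta>) ^ K * norm (w \<zeta>) \<le> C'" if "\<zeta> \<in> \<Gamma>" for \<zeta>
    proof -
      have "\<bar>\<zeta>\<bar> * s = \<zeta>" using that s by (auto simp: \<Gamma>_def)
      then show ?thesis using C'[of "\<bar>\<zeta>\<bar>"] unfolding w_def by simp
    qed
    then show ?thesis by blast
  qed
  obtain C1 M1 where C1: "0 < C1"
    "\<And>a \<nu>. 0 \<le> a \<Longrightarrow> (1 + a) ^ M * norm (w (a *\<^sub>R s - \<nu>)) \<le> C1 * (1 + norm \<nu>) ^ M1"
    using cone_shift_bound[OF growth cone s\<Gamma>, of M] decay' by metis
  define Z where "Z = (\<Sum>\<^sub>\<infinity>n::int. 1 / (1 + \<bar>pi / L * real_of_int n\<bar>) ^ 2)"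
  have Z: "0 \<le> Z" unfolding Z_def by (intro infsum_nonneg) simp
  show ?thesis
  \<comment> \<open>\<open>M1\<close> derivatives pay for the shifts and two more for summability;
    \<open>Z + 1\<close> instead of \<open>Z\<close> makes the constant positive.\<close>
  proof (intro exI[of _ "C1 * (2 ^ (M1 + 3) * (Z + 1))"] exI[of _ "M1 + 2"] conjI allI impI)
    show "0 < C1 * (2 ^ (M1 + 3) * (Z + 1))" using C1(1) Z by (intro mult_pos_pos) auto
    fix G :: "nat \<Rightarrow> real \<Rightarrow> complex" and \<alpha> B
    assume "bump_sequence L G" and \<alpha>: "0 \<le> \<alpha> * s"
      and B: "\<forall>p. norm (G 0 p) \<le> B" "\<forall>p. norm (G (M1 + 2) p) \<le> B"
    then interpret G: bump_sequence L G by simp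
    have B0: "0 \<le> B" using order_trans[OF norm_ge_zero] B by blast
    have sm: "smooth (mode \<alpha>)" using smooth_plane_wave[of \<alpha>] unfolding plane_wave_mode .
    define v' where "v' = (\<lambda>\<phi>. v (\<lambda>p. mode \<alpha> p * \<phi> p))"
    have v1: "linear_on_smooth v'" unfolding v'_def by (rule linear_on_smooth_mult[OF lin sm])
    obtain C2 where v2: "seminorm_bound v' R C2 N" unfolding v'_def using seminorm_bound_mult[OF sb sm] by metis
    note hs = G.distribution_series_line[OF v1 v2 RL]
    have a: "\<bar>\<alpha>\<bar> * s = \<alpha>" using \<alpha> s by auto
    have vw: "v' (plane_wave (- (pi / L * real_of_int n))) = w (\<bar>\<alpha>\<bar> *\<^sub>R s - pi / L * real_of_int n)" for n
      unfolding v'_def w_def plane_wave_mode[symmetric] plane_wave_add real_scaleR_def a by simp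
    have W: "(1 + \<bar>\<alpha>\<bar>) ^ M * norm (w (\<bar>\<alpha>\<bar> *\<^sub>R s - pi / L * real_of_int n)) \<le>
        C1 * (1 + \<bar>pi / L * real_of_int n\<bar>) ^ M1" for n
      using C1(2)[of "\<bar>\<alpha>\<bar>" "pi / L * real_of_int n"] by simp
    have "(1 + \<bar>\<alpha>\<bar>) ^ M * norm (v' (G 0)) \<le>
        C1 * (\<Sum>\<^sub>\<infinity>n. norm (fcoef L (G 0) n) * (1 + \<bar>pi / L * real_of_int n\<bar>) ^ M1)"
      by (rule has_sum_weighted_bound[OF hs[unfolded vw] _ W G.fcoef_summable]) simp
    also have "\<dots> \<le> C1 * (2 ^ (M1 + 3) * B * Z)"
      unfolding Z_def using C1(1) B by (intro mult_left_mono G.fcoef_infsum_le) auto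
    also have "\<dots> \<le> C1 * (2 ^ (M1 + 3) * B * (Z + 1))"
      using C1(1) B0 by (intro mult_left_mono) auto
    finally show "(1 + \<bar>\<alpha>\<bar>) ^ M * norm (v (\<lambda>p. mode \<alpha> p * G 0 p)) \<le> C1 * (2 ^ (M1 + 3) * (Z + 1)) * B"
      unfolding v'_def by (simp only: mult_ac)
  qed
qed

lemma test_function_supp_in:
  assumes "test_function \<eta>"
  obtains \<rho> where "supp_in \<rho> \<eta>"
proof -
  have "bounded {x. \<eta> x \<noteq> 0}"
    using assms bounded_subset[OF compact_imp_bounded closure_subset] unfolding test_function_def by metis
  then obtain \<rho> where "\<forall>x\<in>{x. \<eta> x \<noteq> 0}. norm x \<le> \<rho>" by (auto simp: bounded_iff)
  then have "supp_in \<rho> \<eta>" using assms by (force simp: supp_in_def test_function_def)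
  then show thesis by (rule that)
qed

lemma smooth_bump_sphere_gap:
  "smooth (\<lambda>x::'a::euclidean_space. complex_of_real (bump ((norm x)\<^sup>2 - r)))"
proof -
  have "smooth (\<lambda>x::'a. complex_of_real ((norm (x - 0))\<^sup>2) - complex_of_real r)"
    by (intro smooth_diff smooth_norm_power2 smooth_const)
  then show ?thesis by (intro smooth_bump_compose) simp
qed

lemma smooth_bump_strip_gap:
  "smooth (\<lambda>x::'a::euclidean_space. complex_of_real (bump ((x \<bullet> e - p)\<^sup>2 - r)))"
proof -
  have "smooth (\<lambda>x::'a. (complex_of_real (x \<bullet> e) - complex_of_real p) * (complex_of_real (x \<bullet> e) - complex_of_real p) - complex_of_real r)"
    by (intro smooth_diff smooth_mult smooth_of_real_inner smooth_const)
  then show ?thesis by (intro smooth_bump_compose) (simp add: power2_eq_square)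
qed

text \<open>Compactness of the part of the line in the ball gives finitely many cutoffs with decay
  near the direction \<open>e\<close>. They are combined to a function \<open>S\<close> that is
  \<open>1\<close> on a strip, and decay along the ray passes to it summand by summand. The radius
  \<open>R + 1\<close> leaves an open margin around the ball on which \<open>f\<close>
  depends.\<close>

lemma microlocal_cutoff:
  fixes f :: "(real^2 \<Rightarrow> complex) \<Rightarrow> complex"
  assumes lin: "linear_on_smooth f" and sb: "seminorm_bound f R C N" and e: "norm e = 1"
    and WF: "\<forall>y. y \<bullet> e = p \<longrightarrow> (y, e) \<notin> WF f"
  shows "\<exists>\<delta>>0. \<exists>S. smooth S \<and> (\<forall>x. norm x \<le> R + 1 \<longrightarrow> \<bar>x \<bullet> e - p\<bar> \<le> \<delta> \<longrightarrow> S x = 1) \<and>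
    (\<forall>M. \<exists>C. \<forall>\<sigma>\<ge>0. (1 + \<sigma>) ^ M * norm (f (\<lambda>x. S x * plane_wave (\<sigma> *\<^sub>R e) x)) \<le> C)"
proof -
  define K where "K = cball 0 (R + 1) \<inter> {x. x \<bullet> e = p}"
  have K: "compact K"
    unfolding K_def by (intro compact_Int_closed compact_cball closed_Collect_eq continuous_intros)
  define good where "good \<eta> \<longleftrightarrow> test_function \<eta> \<and> (\<exists>\<Gamma>. open_cone \<Gamma> \<and> e \<in> \<Gamma> \<and>
      (\<forall>N::nat. \<exists>C. \<forall>\<xi>\<in>\<Gamma>. (1 + norm \<xi>) ^ N * norm (localized_fourier f \<eta> \<xi>) \<le> C))" for \<eta>
  have e0: "e \<noteq> 0" using e by auto
  have "\<exists>\<eta>. good \<eta> \<and> \<eta> x \<noteq> 0" if "x \<in> K" for x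
    using WF[rule_format, of x] that e0 unfolding WF_def good_def K_def by blast
  then obtain \<eta> where \<eta>: "\<And>x. x \<in> K \<Longrightarrow> good (\<eta> x)" "\<And>x. x \<in> K \<Longrightarrow> \<eta> x x \<noteq> 0"
    by metis
  have \<eta>sm: "smooth (\<eta> x)" if "x \<in> K" for x using \<eta>(1)[OF that] by (simp add: good_def test_function_def)
  obtain I where I: "I \<subseteq> K" "finite I" "K \<subseteq> (\<Union>i\<in>I. {x. \<eta> i x \<noteq> 0})"
  proof (rule compactE_image[OF K])
    show "open {x. \<eta> i x \<noteq> 0}" if "i \<in> K" for i
      using smooth_continuous_on[OF \<eta>sm[OF that], of UNIV]
      by (intro open_Collect_neq continuous_intros)
    show "K \<subseteq> (\<Union>i\<in>K. {x. \<eta> i x \<noteq> 0})" using \<eta>(2) by blast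
  qed blast
  \<comment> \<open>Squares add up without cancellation, and each summand
    \<open>\<eta> i x * cnj (\<eta> i x)\<close> keeps the factor \<open>\<eta> i\<close> that
    localizes \<open>f\<close>.\<close>
  define B where "B x = (\<Sum>i\<in>I. (norm (\<eta> i x))\<^sup>2)" for x
  have B0: "0 \<le> B x" for x by (simp add: B_def sum_nonneg)
  have Bpos: "0 < B x" if xK: "x \<in> K" for x
  proof -
    obtain i where i: "i \<in> I" "\<eta> i x \<noteq> 0" using I(3) xK by blast
    have "0 < (norm (\<eta> i x))\<^sup>2" using i by simp
    also have "\<dots> \<le> B x" unfolding B_def using i I(2) by (intro member_le_sum) auto
    finally show ?thesis .
  qed
  have Bsm: "smooth (\<lambda>x. complex_of_real (B x))"
  proof -
    have "smooth (\<lambda>x. \<Sum>i\<in>I. \<eta> i x * cnj (\<eta> i x))"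
      using I(1) \<eta>sm by (intro smooth_sum smooth_mult smooth_cnj) auto
    then show ?thesis unfolding B_def of_real_sum complex_norm_square .
  qed
  have Bcont: "continuous_on UNIV B"
  proof -
    have "continuous_on UNIV (\<lambda>x. Re (complex_of_real (B x)))"
      by (intro continuous_intros smooth_continuous_on Bsm)
    then show ?thesis by simp
  qed
  \<comment> \<open>The zeros of \<open>B\<close> in the ball form a compact set that misses the
    line. If there are any, their distance from the line has a positive minimum, and half of it is a
    safe width.\<close>
  obtain \<delta> where \<delta>: "0 < \<delta>" "\<And>x. norm x \<le> R + 1 \<Longrightarrow> \<bar>x \<bullet> e - p\<bar> \<le> \<delta> \<Longrightarrow> 0 < B x"
  proof -
    define Z where "Z = cball 0 (R + 1) \<inter> {x. B x = 0}"
    have Z: "compact Z"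
      unfolding Z_def by (intro compact_Int_closed compact_cball closed_Collect_eq continuous_intros Bcont)
    show thesis
    proof (cases "Z = {}")
      case True
      then have "0 < B x" if "norm x \<le> R + 1" for x
        using that B0[of x] unfolding Z_def by (force simp: less_le)
      then show thesis by (intro that[of 1]) auto
    next
      case False
      have "continuous_on Z (\<lambda>x. \<bar>x \<bullet> e - p\<bar>)" by (intro continuous_intros)
      from continuous_attains_inf[OF Z False this]
      obtain z where z: "z \<in> Z" "\<forall>x\<in>Z. \<bar>z \<bullet> e - p\<bar> \<le> \<bar>x \<bullet> e - p\<bar>" by blast
      have "z \<notin> K" using Bpos[of z] z(1) unfolding Z_def by auto
      then have pos: "0 < \<bar>z \<bullet> e - p\<bar>" using z(1) unfolding Z_def K_def by auto
      show thesis
      proof (rule that[of "\<bar>z \<bullet> e - p\<bar> / 2"])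
        show "0 < \<bar>z \<bullet> e - p\<bar> / 2" using pos by simp
        fix x assume x: "norm x \<le> R + 1" "\<bar>x \<bullet> e - p\<bar> \<le> \<bar>z \<bullet> e - p\<bar> / 2"
        then have "x \<notin> Z" using z(2) pos by fastforce
        then show "0 < B x" using x(1) B0[of x] unfolding Z_def by (auto simp: less_le)
      qed
    qed
  qed
  \<comment> \<open>Both bumps vanish where \<open>S\<close> must be \<open>1\<close>, and at least
    one is positive elsewhere; the denominator becomes positive on the whole plane without changing
    the quotient on the strip.\<close>
  define D where "D x = B x + bump ((x \<bullet> e - p)\<^sup>2 - \<delta>\<^sup>2) + bump ((norm x)\<^sup>2 - (R + 1)\<^sup>2)" for x
  have R: "0 < R" using sb by (simp add: seminorm_bound_def)
  have Dpos: "0 < D x" for x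
  proof -
    consider "R + 1 < norm x" | "norm x \<le> R + 1" "\<delta> < \<bar>x \<bullet> e - p\<bar>" | "norm x \<le> R + 1" "\<bar>x \<bullet> e - p\<bar> \<le> \<delta>"
      by linarith
    then show ?thesis
    proof cases
      case 1
      then have "(R + 1)\<^sup>2 < (norm x)\<^sup>2" using R by (intro power_strict_mono) auto
      then have "0 < bump ((norm x)\<^sup>2 - (R + 1)\<^sup>2)" by (intro bump_pos) simp
      then show ?thesis unfolding D_def by (intro add_nonneg_pos add_nonneg_nonneg B0 bump_nonneg)
    next
      case 2
      then have "\<delta>\<^sup>2 < \<bar>x \<bullet> e - p\<bar>\<^sup>2" using \<delta>(1) by (intro power_strict_mono) auto
      then have "0 < bump ((x \<bullet> e - p)\<^sup>2 - \<delta>\<^sup>2)" by (intro bump_pos) simp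
      then show ?thesis unfolding D_def by (intro add_nonneg_pos add_pos_nonneg B0 bump_nonneg)
    next
      case 3
      then show ?thesis unfolding D_def by (intro add_pos_nonneg \<delta>(2) bump_nonneg)
    qed
  qed
  have Dsm: "smooth (\<lambda>x. complex_of_real (D x))"
    unfolding D_def of_real_add
    by (intro smooth_add Bsm smooth_bump_sphere_gap smooth_bump_strip_gap)
  \<comment> \<open>\<open>b i\<close> inherits its bounded support from \<open>\<eta> i\<close>,
    and the products \<open>b i x * \<eta> i x\<close> add up to \<open>S x\<close>.\<close>
  define b where "b i x = cnj (\<eta> i x) / complex_of_real (D x)" for i x
  define S where "S x = complex_of_real (B x) / complex_of_real (D x)" for x
  have Dnz: "complex_of_real (D x) \<noteq> 0" for x using Dpos[of x] by simp
  have bsm: "smooth (b i)" if "i \<in> I" for i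
    unfolding b_def[abs_def] using that I(1) \<eta>sm by (intro smooth_divide smooth_cnj Dsm Dnz) auto
  have Ssm: "smooth S" unfolding S_def[abs_def] by (intro smooth_divide Bsm Dsm Dnz)
  have S1: "S x = 1" if "norm x \<le> R + 1" "\<bar>x \<bullet> e - p\<bar> \<le> \<delta>" for x
  proof -
    have "(norm x)\<^sup>2 \<le> (R + 1)\<^sup>2" using that by (intro power_mono) auto
    moreover have "\<bar>x \<bullet> e - p\<bar>\<^sup>2 \<le> \<delta>\<^sup>2" using that by (intro power_mono) auto
    ultimately have "D x = B x" by (simp add: D_def bump_zero)
    then show ?thesis using Dnz[of x] by (simp add: S_def)
  qed
  have decay: "\<exists>C. \<forall>\<sigma>\<ge>0. (1 + \<sigma>) ^ M * norm (f (\<lambda>x. b i x * \<eta> i x * plane_wave (\<sigma> *\<^sub>R e) x)) \<le> C"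
    if i: "i \<in> I" for i M
  proof -
    have iK: "i \<in> K" using i I(1) by blast
    obtain \<Gamma> where \<Gamma>: "open_cone \<Gamma>" "e \<in> \<Gamma>"
      "\<And>N::nat. \<exists>C. \<forall>\<xi>\<in>\<Gamma>. (1 + norm \<xi>) ^ N * norm (localized_fourier f (\<eta> i) \<xi>) \<le> C"
      using \<eta>(1)[OF iK] unfolding good_def by blast
    obtain \<rho> where "supp_in \<rho> (\<eta> i)" using test_function_supp_in \<eta>(1)[OF iK] unfolding good_def by metis
    then have "supp_in \<rho> (b i)" using bsm[OF i] by (simp add: supp_in_def b_def)
    from localized_mult_decay[OF lin sb \<eta>sm[OF iK] this \<Gamma>(1,2) e \<Gamma>(3)[unfolded localized_fourier_def]]
    show ?thesis .
  qed
  have Sdecay: "\<exists>C. \<forall>\<sigma>\<ge>0. (1 + \<sigma>) ^ M * norm (f (\<lambda>x. S x * plane_wave (\<sigma> *\<^sub>R e) x)) \<le> C" for M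
  proof -
    have "\<forall>i\<in>I. \<exists>C. \<forall>\<sigma>\<ge>0. (1 + \<sigma>) ^ M * norm (f (\<lambda>x. b i x * \<eta> i x * plane_wave (\<sigma> *\<^sub>R e) x)) \<le> C"
      by (intro ballI decay)
    from bchoice[OF this] obtain C where C': "\<forall>i\<in>I. \<forall>\<sigma>\<ge>0.
        (1 + \<sigma>) ^ M * norm (f (\<lambda>x. b i x * \<eta> i x * plane_wave (\<sigma> *\<^sub>R e) x)) \<le> C i" ..
    have C: "(1 + \<sigma>) ^ M * norm (f (\<lambda>x. b i x * \<eta> i x * plane_wave (\<sigma> *\<^sub>R e) x)) \<le> C i"
      if "i \<in> I" "0 \<le> \<sigma>" for i \<sigma>
      using C'[rule_format, OF that] .
    have "(1 + \<sigma>) ^ M * norm (f (\<lambda>x. S x * plane_wave (\<sigma> *\<^sub>R e) x)) \<le> sum C I" if \<sigma>: "0 \<le> \<sigma>" for \<sigma>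
    proof -
      have "S x * plane_wave (\<sigma> *\<^sub>R e) x = (\<Sum>i\<in>I. b i x * \<eta> i x * plane_wave (\<sigma> *\<^sub>R e) x)" for x
        unfolding S_def B_def b_def of_real_sum complex_norm_square sum_divide_distrib sum_distrib_right
        by (simp add: mult_ac)
      then have "f (\<lambda>x. S x * plane_wave (\<sigma> *\<^sub>R e) x) =
          f (\<lambda>x. \<Sum>i\<in>I. b i x * \<eta> i x * plane_wave (\<sigma> *\<^sub>R e) x)" by (simp only:)
      also have "\<dots> = (\<Sum>i\<in>I. f (\<lambda>x. b i x * \<eta> i x * plane_wave (\<sigma> *\<^sub>R e) x))"
        using I(1) \<eta>sm bsm by (intro linear_on_smooth_sum[OF lin] smooth_mult smooth_plane_wave) auto
      finally have "(1 + \<sigma>) ^ M * norm (f (\<lambda>x. S x * plane_wave (\<sigma> *\<^sub>R e) x)) \<le>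
          (1 + \<sigma>) ^ M * (\<Sum>i\<in>I. norm (f (\<lambda>x. b i x * \<eta> i x * plane_wave (\<sigma> *\<^sub>R e) x)))"
        using \<sigma> by (simp only:) (intro mult_left_mono norm_sum; simp)
      also have "\<dots> \<le> sum C I"
        unfolding sum_distrib_left by (intro sum_mono C \<sigma>)
      finally show ?thesis .
    qed
    then show ?thesis by blast
  qed
  show ?thesis
  proof (rule exI[of _ \<delta>], rule conjI[OF \<delta>(1)], rule exI[of _ S], intro conjI)
    show "smooth S" by (rule Ssm)
    show "\<forall>x. norm x \<le> R + 1 \<longrightarrow> \<bar>x \<bullet> e - p\<bar> \<le> \<delta> \<longrightarrow> S x = 1" by (intro allI impI S1)
    show "\<forall>M. \<exists>C. \<forall>\<sigma>\<ge>0. (1 + \<sigma>) ^ M * norm (f (\<lambda>x. S x * plane_wave (\<sigma> *\<^sub>R e) x)) \<le> C"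
      by (intro allI Sdecay)
  qed
qed

section \<open>Radon transforms of modulated cutoffs\<close>

lemma sequence_zero_on_open:
  assumes "\<And>k t. (g k has_vector_derivative g (Suc k) t) (at t)"
    and "open U" "\<And>t. t \<in> U \<Longrightarrow> g 0 t = (0::complex)" "t \<in> U"
  shows "g k t = 0"
  using assms(4)
proof (induction k arbitrary: t)
  case (Suc k)
  have "((\<lambda>t. 0) has_vector_derivative (0::complex)) (at t)" by simp
  then have "(g k has_vector_derivative 0) (at t)"
    by (rule has_vector_derivative_transform_within_open[OF _ assms(2) Suc.prems]) (simp add: Suc.IH)
  then show ?case using assms(1) vector_derivative_unique_at by metis
qed (use assms(3) in simp)

text \<open>Transposing the Hilbert transform and the derivative gives one minus sign each; they
  cancel, and the filter acts on the Radon transform of the test function.\<close>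

lemma pullback_filter_radon:
  assumes "radon \<phi> \<omega> = h"
  shows "pullback_dist \<omega> (filter_dist (radon_dist f \<omega>)) \<phi> = complex_of_real (1 / (4 * pi)) *
    radon_dist f \<omega> (\<lambda>p. vector_derivative (hilbert h) (at p))"
  by (simp add: pullback_dist_def filter_dist_def hilbert_dist_def deriv_dist_def assms)

context frame
begin

context
  fixes L \<rho> :: real
  assumes L: "0 < L" "\<rho> < L"
begin

text \<open>The factor \<open>2 * L\<close> undoes the normalization of \<open>mean\<close>, so that
  \<open>k = 0\<close> gives the modulated line integral itself; \<open>k\<close> counts derivatives
  in \<open>p\<close>.\<close>

definition profile :: "(real^2 \<Rightarrow> complex) \<Rightarrow> real \<Rightarrow> nat \<Rightarrow> real \<Rightarrow> complex" where
  "profile \<eta> \<tau> k p = of_real (2 * L) * X L ((partial_deriv \<omega> ^^ k) \<eta>) \<tau> p"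

text \<open>On the line \<open>x \<bullet> \<omega> = p\<close> the phase is \<open>p * (\<omega>
  \<bullet> \<xi>) + t * (perp \<omega> \<bullet> \<xi>)\<close>; its first term is constant there
  and leaves the integral.\<close>

lemma radon_profile:
  assumes "supp_in \<rho> \<eta>"
  shows "radon (\<lambda>x. \<eta> x * plane_wave \<xi> x) \<omega> = (\<lambda>p. mode (\<omega> \<bullet> \<xi>) p * profile \<eta> (perp \<omega> \<bullet> \<xi>) 0 p)"
proof
  fix p
  have sm: "smooth \<eta>" using assms by (simp add: supp_in_def)
  define A where "A t = \<eta> (pt p t) * plane_wave \<xi> (pt p t)" for t
  have "continuous_on UNIV A"
    unfolding A_def by (intro continuous_intros smooth_continuous_on_pt sm)
  moreover have "A t = 0" if "L \<le> \<bar>t\<bar>" for t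
  proof -
    have "\<rho> < norm (pt p t)" using abs_le_norm_pt(2)[of t p] that L by linarith
    then show ?thesis using assms by (simp add: A_def supp_in_def)
  qed
  ultimately have "integral\<^sup>L lborel A = of_real (2 * L) * mean L A"
    using L(1) by (rule continuous_supp_integral(2))
  moreover have "A = (\<lambda>t. mode (\<omega> \<bullet> \<xi>) p * (\<eta> (pt p t) * mode (perp \<omega> \<bullet> \<xi>) t))"
  proof
    fix t
    have "plane_wave \<xi> (pt p t) = mode (\<omega> \<bullet> \<xi>) p * mode (perp \<omega> \<bullet> \<xi>) t"
      unfolding pt_inner_left by (simp add: algebra_simps flip: exp_add)
    then show "A t = mode (\<omega> \<bullet> \<xi>) p * (\<eta> (pt p t) * mode (perp \<omega> \<bullet> \<xi>) t)"
      unfolding A_def by (simp only: mult_ac)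
  qed
  then have "mean L A = mode (\<omega> \<bullet> \<xi>) p * X L \<eta> (perp \<omega> \<bullet> \<xi>) p"
    unfolding X_def by (simp only: mean_cmult[OF L(1)])
  ultimately show "radon (\<lambda>x. \<eta> x * plane_wave \<xi> x) \<omega> p = mode (\<omega> \<bullet> \<xi>) p * profile \<eta> (perp \<omega> \<bullet> \<xi>) 0 p"
    unfolding radon_def A_def[abs_def] pt_def[symmetric] profile_def by simp
qed

lemma profile_bump_sequence:
  assumes "supp_in \<rho> \<eta>"
  shows "bump_sequence L (profile \<eta> \<tau>)"
proof -
  interpret x: bump_sequence L "\<lambda>k. X L ((partial_deriv \<omega> ^^ k) \<eta>) \<tau>"
    by (rule X_bump_sequence[OF L assms])
  show ?thesis
  proof
    show "(profile \<eta> \<tau> k has_vector_derivative profile \<eta> \<tau> (Suc k) t) (at t)" for k t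
      unfolding profile_def by (intro has_vector_derivative_mult_right x.deriv)
    show "profile \<eta> \<tau> k t = 0" if "L \<le> \<bar>t\<bar>" for k t
      using x.supp[OF that] by (simp add: profile_def)
  qed (rule L(1))
qed

lemma profile_decay:
  assumes "supp_in \<rho> \<eta>"
  shows "\<exists>B>0. \<forall>k\<le>K. \<forall>\<tau> p. norm (profile \<eta> \<tau> k p) * (1 + \<bar>\<tau>\<bar>) ^ M \<le> B"
proof -
  obtain B where B: "\<And>k. 0 < B k" "\<And>k \<tau> p. norm (X L ((partial_deriv \<omega> ^^ k) \<eta>) \<tau> p) * (1 + \<bar>\<tau>\<bar>) ^ M \<le> B k"
    using X_decay[OF L supp_in_iterate[OF assms], of _ \<omega> M] by metis
  have "norm (profile \<eta> \<tau> k p) * (1 + \<bar>\<tau>\<bar>) ^ M \<le> 2 * L * (\<Sum>k\<le>K. B k)" if "k \<le> K" for k \<tau> p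
  proof -
    have "norm (profile \<eta> \<tau> k p) * (1 + \<bar>\<tau>\<bar>) ^ M =
        2 * L * (norm (X L ((partial_deriv \<omega> ^^ k) \<eta>) \<tau> p) * (1 + \<bar>\<tau>\<bar>) ^ M)"
      using L(1) by (simp add: profile_def norm_mult)
    also have "\<dots> \<le> 2 * L * B k" using L(1) B(2) by (intro mult_left_mono) auto
    also have "\<dots> \<le> 2 * L * (\<Sum>k\<le>K. B k)"
      using L(1) B(1) that by (intro mult_left_mono member_le_sum) (auto intro: less_imp_le)
    finally show ?thesis .
  qed
  moreover have "0 < 2 * L * (\<Sum>k\<le>K. B k)" using L(1) B(1) by (intro mult_pos_pos sum_pos) auto
  ultimately show ?thesis by blast
qed

text \<open>Projection to the axis of \<open>\<omega>\<close> does not increase distances, and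
  vanishing on an open set passes to all derivatives.\<close>

lemma profile_supp:
  assumes "supp_in \<rho> \<eta>" "\<And>x. r < norm (x - x\<^sub>0) \<Longrightarrow> \<eta> x = 0" "r < \<bar>p - x\<^sub>0 \<bullet> \<omega>\<bar>"
  shows "profile \<eta> \<tau> k p = 0"
proof -
  interpret g: bump_sequence L "profile \<eta> \<tau>" by (rule profile_bump_sequence[OF assms(1)])
  show ?thesis
  proof (rule sequence_zero_on_open[of "profile \<eta> \<tau>" "{q. r < \<bar>q - x\<^sub>0 \<bullet> \<omega>\<bar>}", OF g.deriv])
    show "open {q. r < \<bar>q - x\<^sub>0 \<bullet> \<omega>\<bar>}" by (intro open_Collect_less continuous_intros)
    show "p \<in> {q. r < \<bar>q - x\<^sub>0 \<bullet> \<omega>\<bar>}" using assms(3) by simp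
    fix q assume "q \<in> {q. r < \<bar>q - x\<^sub>0 \<bullet> \<omega>\<bar>}"
    then have q: "r < \<bar>q - x\<^sub>0 \<bullet> \<omega>\<bar>" by simp
    have "\<eta> (pt q t) = 0" for t
    proof -
      have "\<bar>(pt q t - x\<^sub>0) \<bullet> \<omega>\<bar> \<le> norm (pt q t - x\<^sub>0)"
        using Cauchy_Schwarz_ineq2[of "pt q t - x\<^sub>0" \<omega>] unit by simp
      then show ?thesis using q by (intro assms(2)) (simp add: inner_diff_left)
    qed
    then show "profile \<eta> \<tau> 0 q = 0" by (simp add: profile_def X_def mean_def)
  qed
qed

end

end

section \<open>Decay of the filtered backprojection\<close>

context frame
begin

definition fbp_fourier :: "((real^2 \<Rightarrow> complex) \<Rightarrow> complex) \<Rightarrow> (real^2 \<Rightarrow> complex) \<Rightarrow> real^2 \<Rightarrow> complex" where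
  "fbp_fourier f \<eta> \<xi> =
     pullback_dist \<omega> (filter_dist (radon_dist f \<omega>)) (\<lambda>x. \<eta> x * plane_wave \<xi> x)"

text \<open>The width \<open>\<epsilon>\<close> is free: every positive value splits the same
  operator, so each case of the argument can choose its own.\<close>

lemma norm_fbp_fourier_le:
  fixes L \<rho> \<epsilon> :: real and \<xi> :: "real^2" and \<eta> :: "real^2 \<Rightarrow> complex"
  defines "g \<equiv> profile L \<eta> (perp \<omega> \<bullet> \<xi>)"
  assumes lin: "linear_on_smooth f" and L: "0 < L" "\<rho> < L" and \<eta>: "supp_in \<rho> \<eta>" and \<epsilon>: "0 < \<epsilon>"
  shows "norm (fbp_fourier f \<eta> \<xi>) \<le>
    2 * \<epsilon> * norm (radon_dist f \<omega> (\<lambda>p. mode (\<omega> \<bullet> \<xi>) p * near_part \<epsilon> (\<omega> \<bullet> \<xi>) g 0 p)) +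
    2 * L * norm (radon_dist f \<omega> (far_part L \<epsilon> (\<omega> \<bullet> \<xi>) g 0 1))" (is "_ \<le> ?r")
proof -
  let ?u = "radon_dist f \<omega>" and ?\<alpha> = "\<omega> \<bullet> \<xi>"
  have g: "bump_sequence L g" unfolding g_def by (rule profile_bump_sequence[OF L \<eta>])
  have eq: "fbp_fourier f \<eta> \<xi> = complex_of_real (1 / (4 * pi)) * (complex_of_real (1 / pi) *
     (- of_real (2 * \<epsilon>) * ?u (\<lambda>p. mode ?\<alpha> p * near_part \<epsilon> ?\<alpha> g 0 p) + of_real (2 * L) * ?u (far_part L \<epsilon> ?\<alpha> g 0 1)))"
    unfolding fbp_fourier_def pullback_filter_radon[OF radon_profile[OF L \<eta>]] g_def[symmetric]
      distribution_hilbert[OF g \<epsilon> linear_on_smooth_radon_dist[OF lin]] ..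
  have "norm (- of_real (2 * \<epsilon>) * ?u (\<lambda>p. mode ?\<alpha> p * near_part \<epsilon> ?\<alpha> g 0 p) + of_real (2 * L) * ?u (far_part L \<epsilon> ?\<alpha> g 0 1)) \<le> ?r"
    by (rule order_trans[OF norm_triangle_ineq]) (use \<epsilon> L(1) in \<open>simp add: norm_mult\<close>)
  moreover have "norm (complex_of_real (1 / (4 * pi))) * norm (complex_of_real (1 / pi)) \<le> 1"
  proof -
    have "1 / (4 * pi) \<le> 1" "1 / pi \<le> 1" using pi_ge_two by simp_all
    then have "1 / (4 * pi) * (1 / pi) \<le> 1" by (intro mult_le_one) auto
    then show ?thesis by (simp add: norm_divide)
  qed
  ultimately have "norm (complex_of_real (1 / (4 * pi))) * norm (complex_of_real (1 / pi)) *
     norm (- of_real (2 * \<epsilon>) * ?u (\<lambda>p. mode ?\<alpha> p * near_part \<epsilon> ?\<alpha> g 0 p) + of_real (2 * L) * ?u (far_part L \<epsilon> ?\<alpha> g 0 1)) \<le> 1 * ?r"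
    by (intro mult_mono) auto
  then show ?thesis unfolding eq norm_mult by (simp add: mult.assoc)
qed

text \<open>\<open>M\<close> is arbitrary while the exponent on the right is fixed by
  \<open>N\<close>, so the left side wins wherever the transversal frequency is comparable with
  \<open>norm \<xi>\<close>. A bounded far part suffices here, and the kernel is split at width
  \<open>1\<close>.\<close>

lemma transversal_decay:
  assumes lin: "linear_on_smooth f" and sb: "seminorm_bound f R C N" and \<eta>: "supp_in \<rho> \<eta>"
  shows "\<exists>D. \<forall>\<xi>. (1 + \<bar>perp \<omega> \<bullet> \<xi>\<bar>) ^ M * norm (fbp_fourier f \<eta> \<xi>) \<le> D * (1 + \<bar>\<omega> \<bullet> \<xi>\<bar>) ^ (N + 2)"
proof -
  define L where "L = max 0 \<rho> + 1"
  have L: "0 < L" "\<rho> < L" by (auto simp: L_def)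
  let ?u = "radon_dist f \<omega>"
  have u: "linear_on_smooth ?u" "seminorm_bound ?u R C N"
    using linear_on_smooth_radon_dist[OF lin] seminorm_bound_radon_dist[OF sb] unit by auto
  have C: "0 < C" using sb by (simp add: seminorm_bound_def)
  obtain B0 where B0: "0 < B0" "\<And>k \<tau> p. k \<le> N + 2 \<Longrightarrow> norm (profile L \<eta> \<tau> k p) * (1 + \<bar>\<tau>\<bar>) ^ M \<le> B0"
    using profile_decay[OF L \<eta>, of "N + 2" M] by metis
  obtain C' where C': "0 < C'" "\<And>g \<alpha> B. bump_sequence L g \<Longrightarrow> (\<forall>k s. k \<le> 0 \<longrightarrow> norm (g k s) \<le> B) \<Longrightarrow>
    \<bar>\<alpha>\<bar> ^ 0 * norm (?u (far_part L 1 \<alpha> g 0 1)) \<le> C' * B"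
    using distribution_far_part[OF u L(1), of 1 0] by auto
  have "(1 + \<bar>perp \<omega> \<bullet> \<xi>\<bar>) ^ M * norm (fbp_fourier f \<eta> \<xi>) \<le> (2 * C + 2 * L * C') * B0 * (1 + \<bar>\<omega> \<bullet> \<xi>\<bar>) ^ (N + 2)" for \<xi>
  proof -
    let ?\<alpha> = "\<omega> \<bullet> \<xi>" and ?\<tau> = "perp \<omega> \<bullet> \<xi>"
    let ?T = "(1 + \<bar>?\<tau>\<bar>) ^ M" and ?A = "(1 + \<bar>?\<alpha>\<bar>) ^ (N + 2)"
    define g where "g = profile L \<eta> ?\<tau>"
    have g: "bump_sequence L g" unfolding g_def by (rule profile_bump_sequence[OF L \<eta>])
    have T: "0 < ?T" by (intro zero_less_power) auto
    have A: "1 \<le> ?A" by (intro one_le_power) auto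
    have B: "norm (g k s) \<le> B0 / ?T" if "k \<le> N + 2" for k s
      using B0(2)[OF that, of ?\<tau> s] T by (simp add: g_def pos_le_divide_eq)
    have n: "norm (?u (\<lambda>p. mode ?\<alpha> p * near_part 1 ?\<alpha> g 0 p)) \<le> C * ?A * (B0 / ?T)"
      using distribution_near_part[OF g zero_less_one u(2) B] .
    have "norm (?u (far_part L 1 ?\<alpha> g 0 1)) \<le> C' * (B0 / ?T)"
      using C'(2)[OF g, of "B0 / ?T" ?\<alpha>] B by simp
    also have "\<dots> \<le> C' * (B0 / ?T) * ?A"
      using mult_left_mono[OF A, of "C' * (B0 / ?T)"] C'(1) B0(1) T by simp
    finally have f: "norm (?u (far_part L 1 ?\<alpha> g 0 1)) \<le> C' * ?A * (B0 / ?T)" by (simp only: mult_ac)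
    have "norm (fbp_fourier f \<eta> \<xi>) \<le> 2 * 1 * (C * ?A * (B0 / ?T)) + 2 * L * (C' * ?A * (B0 / ?T))"
      using norm_fbp_fourier_le[OF lin L \<eta> zero_less_one, of \<xi>] L(1)
        mult_left_mono[OF n, of 2] mult_left_mono[OF f, of "2 * L"] unfolding g_def by simp
    also have "\<dots> = (2 * C + 2 * L * C') * B0 * ?A / ?T"
      by (simp add: algebra_simps add_divide_distrib)
    finally show ?thesis
      unfolding pos_le_divide_eq[OF T] by (simp only: mult.commute)
  qed
  then show ?thesis by blast
qed

text \<open>Only frequencies on the side selected by \<open>s\<close> are controlled, in accordance
  with an assumption on one of the two conormal directions. The radius is fixed before
  \<open>\<eta>\<close> and \<open>M\<close>, so one cutoff can serve all orders of decay.\<close>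

lemma parallel_decay:
  assumes lin: "linear_on_smooth f" and sb: "seminorm_bound f R C N"
    and s: "s = 1 \<or> s = -1"
    and WF: "\<And>y. y \<bullet> \<omega> = x\<^sub>0 \<bullet> \<omega> \<Longrightarrow> (y, s *\<^sub>R \<omega>) \<notin> WF f"
  shows "\<exists>r>0. \<forall>\<eta> \<rho> M. supp_in \<rho> \<eta> \<longrightarrow> (\<forall>x. r < norm (x - x\<^sub>0) \<longrightarrow> \<eta> x = 0) \<longrightarrow>
    (\<exists>D. \<forall>\<xi>. 0 \<le> (\<omega> \<bullet> \<xi>) * s \<longrightarrow> (1 + \<bar>\<omega> \<bullet> \<xi>\<bar>) ^ M * norm (fbp_fourier f \<eta> \<xi>) \<le> D)"
proof -
  let ?e = "s *\<^sub>R \<omega>"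
  have e: "norm ?e = 1" using s unit by auto
  have ss: "s * s = 1" using s by auto
  have WF': "\<forall>y. y \<bullet> ?e = s * (x\<^sub>0 \<bullet> \<omega>) \<longrightarrow> (y, ?e) \<notin> WF f"
    using s by (intro allI impI WF) auto
  obtain \<delta> S where \<delta>: "0 < \<delta>" and S: "smooth S"
    "\<forall>x. norm x \<le> R + 1 \<longrightarrow> \<bar>x \<bullet> ?e - s * (x\<^sub>0 \<bullet> \<omega>)\<bar> \<le> \<delta> \<longrightarrow> S x = 1"
    "\<forall>M. \<exists>C. \<forall>\<sigma>\<ge>0. (1 + \<sigma>) ^ M * norm (f (\<lambda>x. S x * plane_wave (\<sigma> *\<^sub>R ?e) x)) \<le> C"
    using microlocal_cutoff[OF lin sb e WF'] by (elim exE conjE) (rule that; assumption)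
  \<comment> \<open>Half of \<open>\<delta>\<close> is spent on the support of
    \<open>\<eta>\<close>, half on the near kernel: the near part then stays in the strip where
    \<open>S\<close> is \<open>1\<close>.\<close>
  define \<epsilon> where "\<epsilon> = \<delta> / 2"
  have \<epsilon>: "0 < \<epsilon>" using \<delta> by (simp add: \<epsilon>_def)
  have S1: "S x = 1" if "norm x \<le> R + 1" "\<bar>x \<bullet> \<omega> - x\<^sub>0 \<bullet> \<omega>\<bar> \<le> \<delta>" for x
  proof (rule S(2)[rule_format, OF that(1)])
    have "x \<bullet> ?e - s * (x\<^sub>0 \<bullet> \<omega>) = s * (x \<bullet> \<omega> - x\<^sub>0 \<bullet> \<omega>)" by (simp add: algebra_simps)
    then show "\<bar>x \<bullet> ?e - s * (x\<^sub>0 \<bullet> \<omega>)\<bar> \<le> \<delta>" using that(2) s by (auto simp: abs_mult)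
  qed
  let ?u = "radon_dist f \<omega>"
  have u: "linear_on_smooth ?u" "seminorm_bound ?u R C N"
    using linear_on_smooth_radon_dist[OF lin] seminorm_bound_radon_dist[OF sb] unit by auto
  define v where "v = radon_dist (\<lambda>\<phi>. f (\<lambda>x. S x * \<phi> x)) \<omega>"
  obtain C1 where "seminorm_bound (\<lambda>\<phi>. f (\<lambda>x. S x * \<phi> x)) R C1 N"
    using seminorm_bound_mult[OF sb S(1)] by metis
  then have v: "linear_on_smooth v" "seminorm_bound v R C1 N"
    unfolding v_def using linear_on_smooth_radon_dist[OF linear_on_smooth_mult[OF lin S(1)]]
      seminorm_bound_radon_dist unit by auto
  have v_wave: "v (plane_wave (\<sigma> * s)) = f (\<lambda>x. S x * plane_wave (\<sigma> *\<^sub>R ?e) x)" for \<sigma>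
    by (simp add: v_def radon_dist_def mult_ac)
  have v_decay: "\<exists>C. \<forall>\<sigma>\<ge>0. (1 + \<sigma>) ^ M * norm (v (plane_wave (\<sigma> * s))) \<le> C" for M :: nat
    unfolding v_wave by (rule S(3)[rule_format])
  have "\<exists>D. \<forall>\<xi>. 0 \<le> (\<omega> \<bullet> \<xi>) * s \<longrightarrow> (1 + \<bar>\<omega> \<bullet> \<xi>\<bar>) ^ M * norm (fbp_fourier f \<eta> \<xi>) \<le> D"
    if \<eta>: "supp_in \<rho> \<eta>" and small: "\<forall>x. \<epsilon> < norm (x - x\<^sub>0) \<longrightarrow> \<eta> x = 0" for \<eta> \<rho> M
  proof -
    define L where "L = max 0 \<rho> + 1"
    have L: "0 < L" "\<rho> < L" by (auto simp: L_def)
    \<comment> \<open>The near kernel enlarges supports by \<open>\<epsilon>\<close>, hence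
      \<open>L + \<epsilon>\<close>; exceeding \<open>R\<close> is needed for the expansion under
      \<open>v\<close>.\<close>
    define L' where "L' = max (L + \<epsilon>) R + 1"
    have L': "0 < L'" "L + \<epsilon> < L'" "R < L'" using L \<epsilon> by (auto simp: L'_def)
    \<comment> \<open>The exponent \<open>M + 2\<close> makes up for the two powers lost in
      \<open>near_part_bound\<close>.\<close>
    obtain D1 M1 where D1: "0 < D1" "\<forall>G \<alpha> B. bump_sequence L' G \<longrightarrow> 0 \<le> \<alpha> * s \<longrightarrow>
      (\<forall>p. norm (G 0 p) \<le> B) \<longrightarrow> (\<forall>p. norm (G M1 p) \<le> B) \<longrightarrow>
      (1 + \<bar>\<alpha>\<bar>) ^ (M + 2) * norm (v (\<lambda>p. mode \<alpha> p * G 0 p)) \<le> D1 * B"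
      using mode_mult_decay[OF v L'(3) s v_decay, of "M + 2"] by (elim exE conjE) (rule that; assumption)
    obtain B where B: "0 < B" "\<And>k \<tau> p. k \<le> M1 + 2 + M \<Longrightarrow> norm (profile L \<eta> \<tau> k p) * (1 + \<bar>\<tau>\<bar>) ^ 0 \<le> B"
      using profile_decay[OF L \<eta>, of "M1 + 2 + M" 0] by metis
    \<comment> \<open>The far part is estimated with the exponents \<open>M\<close> and
      \<open>0\<close>, which together yield the weight
      \<open>(1 + \<bar>\<alpha>\<bar>) ^ M\<close>.\<close>
    obtain D2 where D2: "0 < D2" "\<And>g \<alpha> B. bump_sequence L g \<Longrightarrow> (\<forall>k s. k \<le> M \<longrightarrow> norm (g k s) \<le> B) \<Longrightarrow>
      \<bar>\<alpha>\<bar> ^ M * norm (?u (far_part L \<epsilon> \<alpha> g 0 1)) \<le> D2 * B"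
      using distribution_far_part[OF u L(1) \<epsilon>, of M] by auto
    obtain D3 where D3: "0 < D3" "\<And>g \<alpha> B. bump_sequence L g \<Longrightarrow> (\<forall>k s. k \<le> 0 \<longrightarrow> norm (g k s) \<le> B) \<Longrightarrow>
      \<bar>\<alpha>\<bar> ^ 0 * norm (?u (far_part L \<epsilon> \<alpha> g 0 1)) \<le> D3 * B"
      using distribution_far_part[OF u L(1) \<epsilon>, of 0] by auto
    have "(1 + \<bar>\<omega> \<bullet> \<xi>\<bar>) ^ M * norm (fbp_fourier f \<eta> \<xi>) \<le> 2 * \<epsilon> * (D1 * B) + 2 * L * (2 ^ M * (D3 * B + D2 * B))"
      if \<xi>: "0 \<le> (\<omega> \<bullet> \<xi>) * s" for \<xi>
    proof -
      let ?\<alpha> = "\<omega> \<bullet> \<xi>" and ?\<tau> = "perp \<omega> \<bullet> \<xi>"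
      let ?A = "1 + \<bar>?\<alpha>\<bar>"
      have A: "0 < ?A" by simp
      define g where "g = profile L \<eta> ?\<tau>"
      have g: "bump_sequence L g" unfolding g_def by (rule profile_bump_sequence[OF L \<eta>])
      have gB: "norm (g k p) \<le> B" if "k \<le> M1 + 2 + M" for k p
        using B(2)[OF that, of ?\<tau> p] by (simp add: g_def)
      define G where "G = near_part \<epsilon> ?\<alpha> g"
      have G: "bump_sequence L' G"
      proof
        show "0 < L'" by (rule L')
        show "(G k has_vector_derivative G (Suc k) t) (at t)" for k t
          unfolding G_def by (rule near_part_deriv[OF g \<epsilon>])
        show "G k t = 0" if "L' \<le> \<bar>t\<bar>" for k t
          unfolding G_def
          by (rule near_part_supp[OF g \<epsilon>, of L 0]) (use bump_sequence.supp[OF g] that L' in auto)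
      qed
      have GB: "norm (G k p) \<le> ?A ^ 2 * B" if "k \<le> M1" for k p
        unfolding G_def by (rule near_part_bound[OF g \<epsilon>]) (use that gB in auto)
      have "?A ^ (M + 2) * norm (v (\<lambda>p. mode ?\<alpha> p * G 0 p)) \<le> D1 * (?A ^ 2 * B)"
        by (rule D1(2)[rule_format, OF G \<xi>]) (use GB in auto)
      then have "?A ^ 2 * (?A ^ M * norm (v (\<lambda>p. mode ?\<alpha> p * G 0 p))) \<le> ?A ^ 2 * (D1 * B)"
        by (simp only: power_add mult_ac)
      then have vG: "?A ^ M * norm (v (\<lambda>p. mode ?\<alpha> p * G 0 p)) \<le> D1 * B"
        by (rule mult_left_le_imp_le) (use A in \<open>intro zero_less_power\<close>)
      \<comment> \<open>It suffices to compare on the ball of radius \<open>R + 1\<close>: a point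
        there lies in the strip, where \<open>S\<close> is \<open>1\<close>, or outside it, where
        \<open>G\<close> vanishes.\<close>
      have uv: "?u (\<lambda>p. mode ?\<alpha> p * G 0 p) = v (\<lambda>p. mode ?\<alpha> p * G 0 p)"
        unfolding v_def radon_dist_def
      proof (rule seminorm_bound_local[OF lin sb])
        have sm: "smooth (\<lambda>p. mode ?\<alpha> p * G 0 p)"
          unfolding G_def by (rule smooth_mode_near_part[OF g \<epsilon>])
        show "smooth (\<lambda>x. mode ?\<alpha> (x \<bullet> \<omega>) * G 0 (x \<bullet> \<omega>))"
          by (rule smooth_radon_pullback[OF sm])
        then show "smooth (\<lambda>x. S x * (mode ?\<alpha> (x \<bullet> \<omega>) * G 0 (x \<bullet> \<omega>)))"
          by (rule smooth_mult[OF S(1)])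
        show "R < R + 1" by simp
        fix x :: "real^2" assume x: "norm x < R + 1"
        show "mode ?\<alpha> (x \<bullet> \<omega>) * G 0 (x \<bullet> \<omega>) = S x * (mode ?\<alpha> (x \<bullet> \<omega>) * G 0 (x \<bullet> \<omega>))"
        proof (cases "\<bar>x \<bullet> \<omega> - x\<^sub>0 \<bullet> \<omega>\<bar> \<le> \<delta>")
          case True
          then show ?thesis using S1[of x] x by simp
        next
          case False
          have "G 0 (x \<bullet> \<omega>) = 0"
            unfolding G_def
          proof (rule near_part_supp[OF g \<epsilon>])
            show "g k q = 0" if "\<epsilon> < \<bar>q - x\<^sub>0 \<bullet> \<omega>\<bar>" for k q
              unfolding g_def using small that by (intro profile_supp[OF L \<eta>]) auto
            show "\<epsilon> + \<epsilon> < \<bar>x \<bullet> \<omega> - x\<^sub>0 \<bullet> \<omega>\<bar>" using False by (simp add: \<epsilon>_def)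
          qed
          then show ?thesis by simp
        qed
      qed
      let ?F = "norm (?u (far_part L \<epsilon> ?\<alpha> g 0 1))"
      have F2: "\<bar>?\<alpha>\<bar> ^ M * ?F \<le> D2 * B" by (rule D2(2)[OF g]) (use gB in auto)
      have F3: "?F \<le> D3 * B" using D3(2)[OF g, of B ?\<alpha>] gB by simp
      have "?A ^ M * ?F \<le> 2 ^ M * (1 + \<bar>?\<alpha>\<bar> ^ M) * ?F"
        by (intro mult_right_mono one_plus_power_le) auto
      also have "\<dots> = 2 ^ M * (?F + \<bar>?\<alpha>\<bar> ^ M * ?F)" by (simp only: algebra_simps)
      also have "\<dots> \<le> 2 ^ M * (D3 * B + D2 * B)" using F2 F3 by (intro mult_left_mono add_mono) auto
      finally have F: "?A ^ M * ?F \<le> 2 ^ M * (D3 * B + D2 * B)" .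
      have "?A ^ M * norm (fbp_fourier f \<eta> \<xi>) \<le>
          ?A ^ M * (2 * \<epsilon> * norm (?u (\<lambda>p. mode ?\<alpha> p * G 0 p)) + 2 * L * ?F)"
        unfolding G_def g_def
        by (intro mult_left_mono norm_fbp_fourier_le[OF lin L \<eta> \<epsilon>] zero_le_power) simp
      also have "\<dots> = 2 * \<epsilon> * (?A ^ M * norm (v (\<lambda>p. mode ?\<alpha> p * G 0 p))) + 2 * L * (?A ^ M * ?F)"
        unfolding uv by (simp only: algebra_simps)
      also have "\<dots> \<le> 2 * \<epsilon> * (D1 * B) + 2 * L * (2 ^ M * (D3 * B + D2 * B))"
        using vG F \<epsilon> L(1) by (intro add_mono mult_left_mono) auto
      finally show ?thesis .
    qed
    then show ?thesis by blast
  qed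
  then show ?thesis using \<epsilon> by blast
qed

text \<open>Both cases end with the same kind of cone around \<open>e\<close>, so that finitely many
  directions can be intersected. Information on \<open>f\<close> is required only when
  \<open>e\<close> is parallel to \<open>\<omega>\<close>.\<close>

lemma direction_decay:
  fixes e x\<^sub>0 :: "real^2"
  assumes lin: "linear_on_smooth f" and sb: "seminorm_bound f R C N" and e: "norm e = 1"
    and WF: "\<And>s y. s = 1 \<or> s = -1 \<Longrightarrow> e = s *\<^sub>R \<omega> \<Longrightarrow> y \<bullet> \<omega> = x\<^sub>0 \<bullet> \<omega> \<Longrightarrow> (y, s *\<^sub>R \<omega>) \<notin> WF f"
  shows "\<exists>r>0. \<exists>c>0. \<forall>\<eta> \<rho> M. supp_in \<rho> \<eta> \<longrightarrow> (\<forall>x. r < norm (x - x\<^sub>0) \<longrightarrow> \<eta> x = 0) \<longrightarrow>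
    (\<exists>D. \<forall>\<xi>. norm (\<xi> - norm \<xi> *\<^sub>R e) < c * norm \<xi> \<longrightarrow> (1 + norm \<xi>) ^ M * norm (fbp_fourier f \<eta> \<xi>) \<le> D)"
proof (cases "perp \<omega> \<bullet> e = 0")
  case False
  \<comment> \<open>Half of the transversal component of \<open>e\<close>: a deviation smaller than
    \<open>c\<close> uses up at most one half, so the other half bounds the transversal frequency
    from below.\<close>
  define c where "c = min (\<bar>perp \<omega> \<bullet> e\<bar> / 2) 1"
  have c: "0 < c" "c \<le> \<bar>perp \<omega> \<bullet> e\<bar> / 2" "c \<le> 1" using False by (auto simp: c_def)
  have "\<exists>D. \<forall>\<xi>. norm (\<xi> - norm \<xi> *\<^sub>R e) < c * norm \<xi> \<longrightarrow> (1 + norm \<xi>) ^ M * norm (fbp_fourier f \<eta> \<xi>) \<le> D"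
    if \<eta>: "supp_in \<rho> \<eta>" for \<eta> \<rho> M
  proof -
    \<comment> \<open>The additional \<open>N + 2\<close> powers absorb the growth allowed on the
      right side.\<close>
    obtain D where D: "\<And>\<xi>. (1 + \<bar>perp \<omega> \<bullet> \<xi>\<bar>) ^ (M + (N + 2)) * norm (fbp_fourier f \<eta> \<xi>) \<le> D * (1 + \<bar>\<omega> \<bullet> \<xi>\<bar>) ^ (N + 2)"
      using transversal_decay[OF lin sb \<eta>, of "M + (N + 2)"] by metis
    have "(1 + norm \<xi>) ^ M * norm (fbp_fourier f \<eta> \<xi>) \<le> \<bar>D\<bar> / c ^ (M + (N + 2))"
      if \<xi>: "norm (\<xi> - norm \<xi> *\<^sub>R e) < c * norm \<xi>" for \<xi>
    proof -
      have "\<bar>perp \<omega> \<bullet> (\<xi> - norm \<xi> *\<^sub>R e)\<bar> \<le> 1 * norm (\<xi> - norm \<xi> *\<^sub>R e)"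
        using Cauchy_Schwarz_ineq2[of "perp \<omega>" "\<xi> - norm \<xi> *\<^sub>R e"] perp_simps(5)[OF unit] by simp
      then have "\<bar>perp \<omega> \<bullet> \<xi> - norm \<xi> * (perp \<omega> \<bullet> e)\<bar> \<le> c * norm \<xi>"
        using \<xi> by (simp add: inner_diff_right)
      moreover have "\<bar>norm \<xi> * (perp \<omega> \<bullet> e)\<bar> \<ge> 2 * c * norm \<xi>"
        using mult_left_mono[OF c(2), of "2 * norm \<xi>"] by (simp add: abs_mult mult_ac)
      ultimately have \<tau>: "c * norm \<xi> \<le> \<bar>perp \<omega> \<bullet> \<xi>\<bar>" by linarith
      then have "c * (1 + norm \<xi>) \<le> 1 + \<bar>perp \<omega> \<bullet> \<xi>\<bar>" using c by (simp add: distrib_left)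
      then have le: "(c * (1 + norm \<xi>)) ^ (M + (N + 2)) \<le> (1 + \<bar>perp \<omega> \<bullet> \<xi>\<bar>) ^ (M + (N + 2))"
        using c by (intro power_mono) auto
      have \<alpha>: "\<bar>\<omega> \<bullet> \<xi>\<bar> \<le> norm \<xi>" using Cauchy_Schwarz_ineq2[of \<omega> \<xi>] unit by simp
      let ?P = "norm (fbp_fourier f \<eta> \<xi>)" and ?n = "1 + norm \<xi>"
      have n: "0 < ?n" by (simp add: add_pos_nonneg)
      have "c ^ (M + (N + 2)) * (?n ^ M * ?P) * ?n ^ (N + 2) = (c * ?n) ^ (M + (N + 2)) * ?P"
        by (simp only: power_mult_distrib power_add mult_ac)
      also have "\<dots> \<le> (1 + \<bar>perp \<omega> \<bullet> \<xi>\<bar>) ^ (M + (N + 2)) * ?P"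
        using le by (rule mult_right_mono) simp
      also have "\<dots> \<le> D * (1 + \<bar>\<omega> \<bullet> \<xi>\<bar>) ^ (N + 2)" by (rule D)
      also have "\<dots> \<le> \<bar>D\<bar> * ?n ^ (N + 2)" using \<alpha> by (intro mult_mono power_mono) auto
      finally have "c ^ (M + (N + 2)) * (?n ^ M * ?P) \<le> \<bar>D\<bar>"
        by (rule mult_right_le_imp_le) (use n in \<open>intro zero_less_power\<close>)
      then show ?thesis using c(1) by (simp add: pos_le_divide_eq mult.commute)
    qed
    then show ?thesis by blast
  qed
  then show ?thesis using c(1) by (intro exI[of _ 1] conjI exI[of _ c]) auto
next
  case True
  define s where "s = e \<bullet> \<omega>"
  have e_eq: "e = s *\<^sub>R \<omega>"
    using perp_simps(6)[OF unit, of e] True by (simp add: s_def inner_commute)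
  then have "\<bar>s\<bar> = 1" using e unit by (metis norm_scaleR mult.right_neutral)
  then have s: "s = 1 \<or> s = -1" by auto
  obtain r where r: "0 < r" "\<And>\<eta> \<rho> M. supp_in \<rho> \<eta> \<Longrightarrow> (\<forall>x. r < norm (x - x\<^sub>0) \<longrightarrow> \<eta> x = 0) \<Longrightarrow>
    (\<exists>D. \<forall>\<xi>. 0 \<le> (\<omega> \<bullet> \<xi>) * s \<longrightarrow> (1 + \<bar>\<omega> \<bullet> \<xi>\<bar>) ^ M * norm (fbp_fourier f \<eta> \<xi>) \<le> D)"
    using parallel_decay[OF lin sb s WF[OF s e_eq]] by metis
  \<comment> \<open>With aperture \<open>1 / 2\<close> the product of
    \<open>\<omega> \<bullet> \<xi>\<close> with \<open>s\<close> is at least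
    \<open>norm \<xi> / 2\<close>: its sign is right, and it controls
    \<open>norm \<xi>\<close>.\<close>
  have "\<exists>D. \<forall>\<xi>. norm (\<xi> - norm \<xi> *\<^sub>R e) < 1 / 2 * norm \<xi> \<longrightarrow> (1 + norm \<xi>) ^ M * norm (fbp_fourier f \<eta> \<xi>) \<le> D"
    if \<eta>: "supp_in \<rho> \<eta>" "\<forall>x. r < norm (x - x\<^sub>0) \<longrightarrow> \<eta> x = 0" for \<eta> \<rho> M
  proof -
    obtain D where D: "\<And>\<xi>. 0 \<le> (\<omega> \<bullet> \<xi>) * s \<Longrightarrow> (1 + \<bar>\<omega> \<bullet> \<xi>\<bar>) ^ M * norm (fbp_fourier f \<eta> \<xi>) \<le> D"
      using r(2)[OF \<eta>, of M] by metis
    have "(1 + norm \<xi>) ^ M * norm (fbp_fourier f \<eta> \<xi>) \<le> 2 ^ M * D"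
      if \<xi>: "norm (\<xi> - norm \<xi> *\<^sub>R e) < 1 / 2 * norm \<xi>" for \<xi>
    proof -
      have "\<bar>\<omega> \<bullet> (\<xi> - norm \<xi> *\<^sub>R e)\<bar> \<le> 1 * norm (\<xi> - norm \<xi> *\<^sub>R e)"
        using Cauchy_Schwarz_ineq2[of \<omega> "\<xi> - norm \<xi> *\<^sub>R e"] unit by simp
      moreover have "\<omega> \<bullet> (\<xi> - norm \<xi> *\<^sub>R e) = \<omega> \<bullet> \<xi> - s * norm \<xi>"
        by (simp add: inner_diff_right s_def inner_commute mult.commute)
      ultimately have "\<bar>\<omega> \<bullet> \<xi> - s * norm \<xi>\<bar> \<le> norm \<xi> / 2" using \<xi> by simp
      then have "norm \<xi> / 2 \<le> (\<omega> \<bullet> \<xi>) * s" using s by (auto simp: abs_if split: if_splits)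
      then have 1: "0 \<le> (\<omega> \<bullet> \<xi>) * s" and 2: "norm \<xi> / 2 \<le> \<bar>\<omega> \<bullet> \<xi>\<bar>"
        using s order_trans[of 0 "norm \<xi> / 2"] by auto
      have "(1 + norm \<xi>) ^ M \<le> (2 * (1 + \<bar>\<omega> \<bullet> \<xi>\<bar>)) ^ M" using 2 by (intro power_mono) auto
      then have "(1 + norm \<xi>) ^ M * norm (fbp_fourier f \<eta> \<xi>) \<le>
          2 ^ M * ((1 + \<bar>\<omega> \<bullet> \<xi>\<bar>) ^ M * norm (fbp_fourier f \<eta> \<xi>))"
        unfolding power_mult_distrib mult.assoc[symmetric] by (rule mult_right_mono) simp
      also have "\<dots> \<le> 2 ^ M * D" by (intro mult_left_mono D 1) auto
      finally show ?thesis .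
    qed
    then show ?thesis by blast
  qed
  then show ?thesis using r(1) by (intro exI[of _ r] conjI exI[of _ "1/2"]) auto
qed

end

section \<open>Combination of the finitely many directions\<close>

lemma norm_unit_vec: "norm (unit_vec t) = 1"
proof -
  have "(cos t)\<^sup>2 + (sin t)\<^sup>2 = 1" by simp
  then show ?thesis by (simp add: norm_vec_def L2_set_def sum_2 unit_vec_def)
qed

lemma frame_direction: "frame (direction m j)"
  by unfold_locales (simp add: direction_def norm_unit_vec)

text \<open>Covectors opposite to one of the \<open>m\<close> directions of the sum are accounted
  for by the indices above \<open>m\<close>.\<close>

lemma direction_add_period:
  assumes "1 \<le> m"
  shows "direction m (j + int m) = - direction m j"
proof -
  have "pi * real_of_int (j + int m) / real m = pi * real_of_int j / real m + pi"
    using assms by (simp add: field_simps)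
  then show ?thesis by (simp add: direction_def unit_vec_def vec_eq_iff forall_2)
qed

lemma exists_test_function:
  fixes x\<^sub>0 :: "'a::euclidean_space"
  assumes "0 < r"
  obtains \<eta> where "test_function \<eta>" "\<eta> x\<^sub>0 \<noteq> 0" "\<And>x. r < norm (x - x\<^sub>0) \<Longrightarrow> \<eta> x = 0"
proof -
  define \<eta> where "\<eta> x = complex_of_real (bump (r\<^sup>2 - (norm (x - x\<^sub>0))\<^sup>2))" for x
  have "smooth (\<lambda>x. complex_of_real (r\<^sup>2) - complex_of_real ((norm (x - x\<^sub>0))\<^sup>2))"
    by (intro smooth_diff smooth_const smooth_norm_power2)
  then have sm: "smooth \<eta>" unfolding \<eta>_def by (intro smooth_bump_compose) simp
  have z: "\<eta> x = 0" if "r < norm (x - x\<^sub>0)" for x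
  proof -
    have "r\<^sup>2 \<le> (norm (x - x\<^sub>0))\<^sup>2" using that assms by (intro power_mono) auto
    then show ?thesis by (simp add: \<eta>_def bump_zero)
  qed
  have "{x. \<eta> x \<noteq> 0} \<subseteq> cball x\<^sub>0 r"
    using z by (force simp: dist_norm norm_minus_commute not_less)
  then have "compact (closure {x. \<eta> x \<noteq> 0})"
    using bounded_subset[OF bounded_cball] by (simp add: compact_closure)
  with sm have "test_function \<eta>" by (simp add: test_function_def)
  moreover have "\<eta> x\<^sub>0 \<noteq> 0" using bump_pos[of "r\<^sup>2"] assms by (simp add: \<eta>_def)
  ultimately show thesis using z by (rule that)
qed

lemma open_cone_around:
  assumes "norm e = 1" "0 < c" "0 < t"
  shows "open_cone {\<xi>. norm (\<xi> - norm \<xi> *\<^sub>R e) < c * norm \<xi>}" "t *\<^sub>R e \<in> {\<xi>. norm (\<xi> - norm \<xi> *\<^sub>R e) < c * norm \<xi>}"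
proof -
  have "norm (t *\<^sub>R \<xi> - norm (t *\<^sub>R \<xi>) *\<^sub>R e) = t * norm (\<xi> - norm \<xi> *\<^sub>R e)" if "0 < t" for t \<xi>
  proof -
    have "t *\<^sub>R \<xi> - norm (t *\<^sub>R \<xi>) *\<^sub>R e = t *\<^sub>R (\<xi> - norm \<xi> *\<^sub>R e)" using that by (simp add: algebra_simps)
    then show ?thesis using that by simp
  qed
  moreover have "open {\<xi>. norm (\<xi> - norm \<xi> *\<^sub>R e) < c * norm \<xi>}"
    by (intro open_Collect_less continuous_intros)
  ultimately show "open_cone {\<xi>. norm (\<xi> - norm \<xi> *\<^sub>R e) < c * norm \<xi>}"
    unfolding open_cone_def by (auto simp: mult_ac)
  show "t *\<^sub>R e \<in> {\<xi>. norm (\<xi> - norm \<xi> *\<^sub>R e) < c * norm \<xi>}" using assms by simp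
qed

theorem theorem3p1:
  fixes m :: nat
    and \<psi> :: "real^2 \<Rightarrow> complex"
    and f :: "(real^2 \<Rightarrow> complex) \<Rightarrow> complex"
  assumes "1 \<le> m"
    and "smooth_on_circle \<psi>"
    and "\<forall>\<omega>\<in>sphere 0 1. \<psi> (- \<omega>) = \<psi> \<omega>"
    and "compact_distribution f"
  shows "WF (discrete_fbp m \<psi> f) \<subseteq>
    \<Union> {conormal_bundle {x. (x - x\<^sub>0) \<bullet> direction m j = 0} - UNIV \<times> {0} | x\<^sub>0 j.
         j \<in> {1..2 * int m} \<and> (x\<^sub>0, direction m j) \<in> WF f}"
proof (rule subrelI, rule ccontr)
  fix x \<xi>\<^sub>0
  assume wf: "(x, \<xi>\<^sub>0) \<in> WF (discrete_fbp m \<psi> f)"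
    and not: "(x, \<xi>\<^sub>0) \<notin> \<Union> {conormal_bundle {x. (x - x\<^sub>0) \<bullet> direction m j = 0} - UNIV \<times> {0} | x\<^sub>0 j.
         j \<in> {1..2 * int m} \<and> (x\<^sub>0, direction m j) \<in> WF f}"
  obtain R C N where lin: "linear_on_smooth f" and sb: "seminorm_bound f R C N"
    using compact_distributionE[OF assms(4)] by metis
  have \<xi>0: "\<xi>\<^sub>0 \<noteq> 0" using wf by (simp add: WF_def)
  define e where "e = (1 / norm \<xi>\<^sub>0) *\<^sub>R \<xi>\<^sub>0"
  have e: "norm e = 1" "norm \<xi>\<^sub>0 *\<^sub>R e = \<xi>\<^sub>0" using \<xi>0 by (simp_all add: e_def)
  \<comment> \<open>If \<open>e\<close> were a singular direction of \<open>f\<close> at a point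
    \<open>y\<close> of the line through \<open>x\<close> orthogonal to \<open>e\<close>, the
    covector at \<open>x\<close> would be conormal to that very line, contrary to
    \<open>not\<close>.\<close>
  have notWF: "(y, direction m j) \<notin> WF f"
    if j: "j \<in> {1..2 * int m}" "e = direction m j" "y \<bullet> direction m j = x \<bullet> direction m j" for y j
  proof
    assume y: "(y, direction m j) \<in> WF f"
    have "(x, \<xi>\<^sub>0) \<in> conormal_bundle {x. (x - y) \<bullet> direction m j = 0} - UNIV \<times> {0}"
    proof -
      have 1: "(z - x) \<bullet> \<xi>\<^sub>0 = 0" if "(z - y) \<bullet> direction m j = 0" for z
      proof -
        have "(z - x) \<bullet> direction m j = 0" using that j(3) by (simp add: inner_diff_left)
        then have "(z - x) \<bullet> (norm \<xi>\<^sub>0 *\<^sub>R e) = 0" unfolding j(2) by simp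
        then show ?thesis unfolding e(2) .
      qed
      have "(x - y) \<bullet> direction m j = 0" using j(3) by (simp add: inner_diff_left)
      then have "(x, \<xi>\<^sub>0) \<in> conormal_bundle {x. (x - y) \<bullet> direction m j = 0}"
        unfolding conormal_bundle_def mem_Collect_eq case_prod_conv by (intro conjI ballI 1) auto
      then show ?thesis using \<xi>0 by simp
    qed
    then show False using not y j(1) by blast
  qed
  define J where "J = {1..int m}"
  define decays where "decays j r c \<longleftrightarrow> (\<forall>\<eta> \<rho> M. supp_in \<rho> \<eta> \<longrightarrow> (\<forall>y. r < norm (y - x) \<longrightarrow> \<eta> y = 0) \<longrightarrow>
    (\<exists>D. \<forall>\<xi>. norm (\<xi> - norm \<xi> *\<^sub>R e) < c * norm \<xi> \<longrightarrow>
      (1 + norm \<xi>) ^ M * norm (frame.fbp_fourier (direction m j) f \<eta> \<xi>) \<le> D))" for j r c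
  have "\<exists>r>0. \<exists>c>0. \<forall>\<eta> \<rho> M. supp_in \<rho> \<eta> \<longrightarrow> (\<forall>y. r < norm (y - x) \<longrightarrow> \<eta> y = 0) \<longrightarrow>
    (\<exists>D. \<forall>\<xi>. norm (\<xi> - norm \<xi> *\<^sub>R e) < c * norm \<xi> \<longrightarrow>
      (1 + norm \<xi>) ^ M * norm (frame.fbp_fourier (direction m j) f \<eta> \<xi>) \<le> D)"
    if j: "j \<in> {1..int m}" for j
  proof (rule frame.direction_decay[OF frame_direction lin sb e(1)])
    fix s :: real and y
    assume s: "s = 1 \<or> s = -1" and es: "e = s *\<^sub>R direction m j"
      and y: "y \<bullet> direction m j = x \<bullet> direction m j"
    \<comment> \<open>A covector opposite to \<open>direction m j\<close> is the direction with
      index \<open>j + int m\<close>, which is still in the range of the claim.\<close>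
    obtain j' where j': "j' \<in> {1..2 * int m}" "s *\<^sub>R direction m j = direction m j'"
    proof (cases "s = 1")
      case True
      then show thesis using j by (intro that[of j]) auto
    next
      case False
      then show thesis
        using j s direction_add_period[OF assms(1), of j] by (intro that[of "j + int m"]) auto
    qed
    have "y \<bullet> direction m j' = x \<bullet> direction m j'"
      unfolding j'(2)[symmetric] using y by simp
    then show "(y, s *\<^sub>R direction m j) \<notin> WF f"
      using notWF[of j' y] j' es by simp
  qed
  then have "\<exists>r>0. \<exists>c>0. decays j r c" if "j \<in> J" for j
    using that unfolding decays_def J_def .
  then obtain r c where r: "\<And>j. j \<in> J \<Longrightarrow> 0 < r j" and c: "\<And>j. j \<in> J \<Longrightarrow> 0 < c j"
    and decay: "\<And>j. j \<in> J \<Longrightarrow> decays j (r j) (c j)"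
    by metis
  have J: "finite J" "J \<noteq> {}" using assms(1) by (auto simp: J_def)
  \<comment> \<open>The smallest radius and aperture serve all directions; one cutoff and one cone
    are thus fixed before the order \<open>M\<close>, as \<open>WF\<close> demands.\<close>
  define r0 where "r0 = Min (r ` J)"
  define c0 where "c0 = Min (c ` J)"
  have r0: "0 < r0" "\<And>j. j \<in> J \<Longrightarrow> r0 \<le> r j" and c0: "0 < c0" "\<And>j. j \<in> J \<Longrightarrow> c0 \<le> c j"
    using J r c by (auto simp: r0_def c0_def J_def[symmetric])
  obtain \<eta> where \<eta>: "test_function \<eta>" "\<eta> x \<noteq> 0" "\<And>y. r0 < norm (y - x) \<Longrightarrow> \<eta> y = 0"
    using exists_test_function[OF r0(1), of x] by metis
  obtain \<rho> where \<rho>: "supp_in \<rho> \<eta>" using test_function_supp_in[OF \<eta>(1)] by metis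
  define \<Gamma> where "\<Gamma> = {\<xi>. norm (\<xi> - norm \<xi> *\<^sub>R e) < c0 * norm \<xi>}"
  have \<Gamma>: "open_cone \<Gamma>" "\<xi>\<^sub>0 \<in> \<Gamma>"
    using open_cone_around[OF e(1) c0(1), of "norm \<xi>\<^sub>0"] \<xi>0 unfolding \<Gamma>_def e(2) by simp_all
  have "\<exists>D. \<forall>\<xi>\<in>\<Gamma>. (1 + norm \<xi>) ^ M * norm (localized_fourier (discrete_fbp m \<psi> f) \<eta> \<xi>) \<le> D" for M
  proof -
    have "\<exists>D. \<forall>\<xi>\<in>\<Gamma>. (1 + norm \<xi>) ^ M * norm (frame.fbp_fourier (direction m j) f \<eta> \<xi>) \<le> D" if j: "j \<in> J" for j
    proof -
      have z: "\<eta> y = 0" if "r j < norm (y - x)" for y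
        using that r0(2)[OF j] by (intro \<eta>(3)) linarith
      have "\<exists>D. \<forall>\<xi>. norm (\<xi> - norm \<xi> *\<^sub>R e) < c j * norm \<xi> \<longrightarrow>
          (1 + norm \<xi>) ^ M * norm (frame.fbp_fourier (direction m j) f \<eta> \<xi>) \<le> D"
        by (rule decay[OF j, unfolded decays_def, rule_format, OF \<rho> z])
      then obtain D where
        D: "\<forall>\<xi>. norm (\<xi> - norm \<xi> *\<^sub>R e) < c j * norm \<xi> \<longrightarrow>
          (1 + norm \<xi>) ^ M * norm (frame.fbp_fourier (direction m j) f \<eta> \<xi>) \<le> D" ..
      have "norm (\<xi> - norm \<xi> *\<^sub>R e) < c j * norm \<xi>" if "\<xi> \<in> \<Gamma>" for \<xi>
        using that mult_right_mono[OF c0(2)[OF j], of "norm \<xi>"] by (simp add: \<Gamma>_def)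
      then show ?thesis using D by blast
    qed
    then have "\<forall>j\<in>J. \<exists>D. \<forall>\<xi>\<in>\<Gamma>. (1 + norm \<xi>) ^ M * norm (frame.fbp_fourier (direction m j) f \<eta> \<xi>) \<le> D"
      by (intro ballI)
    from bchoice[OF this] obtain D where D: "\<forall>j\<in>J. \<forall>\<xi>\<in>\<Gamma>.
        (1 + norm \<xi>) ^ M * norm (frame.fbp_fourier (direction m j) f \<eta> \<xi>) \<le> D j" ..
    let ?k = "norm (complex_of_real (2 * pi / real m))"
    have "(1 + norm \<xi>) ^ M * norm (localized_fourier (discrete_fbp m \<psi> f) \<eta> \<xi>) \<le>
        ?k * (\<Sum>j\<in>J. norm (\<psi> (direction m j)) * D j)" if \<xi>: "\<xi> \<in> \<Gamma>" for \<xi>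
    proof -
      have "localized_fourier (discrete_fbp m \<psi> f) \<eta> \<xi> = complex_of_real (2 * pi / real m) *
          (\<Sum>j\<in>J. \<psi> (direction m j) * frame.fbp_fourier (direction m j) f \<eta> \<xi>)"
        unfolding localized_fourier_def discrete_fbp_def J_def frame.fbp_fourier_def[OF frame_direction] ..
      then have "(1 + norm \<xi>) ^ M * norm (localized_fourier (discrete_fbp m \<psi> f) \<eta> \<xi>) =
          ?k * ((1 + norm \<xi>) ^ M * norm (\<Sum>j\<in>J. \<psi> (direction m j) * frame.fbp_fourier (direction m j) f \<eta> \<xi>))"
        by (simp only: norm_mult mult_ac)
      also have "\<dots> \<le> ?k * ((1 + norm \<xi>) ^ M * (\<Sum>j\<in>J. norm (\<psi> (direction m j)) * norm (frame.fbp_fourier (direction m j) f \<eta> \<xi>)))"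
        unfolding norm_mult[symmetric] by (intro mult_left_mono norm_sum) auto
      also have "\<dots> = ?k * (\<Sum>j\<in>J. norm (\<psi> (direction m j)) * ((1 + norm \<xi>) ^ M * norm (frame.fbp_fourier (direction m j) f \<eta> \<xi>)))"
        by (simp only: sum_distrib_left mult_ac)
      also have "\<dots> \<le> ?k * (\<Sum>j\<in>J. norm (\<psi> (direction m j)) * D j)"
        using D \<xi> by (intro mult_left_mono sum_mono) auto
      finally show ?thesis .
    qed
    then show ?thesis by blast
  qed
  then show False using wf \<eta>(1,2) \<Gamma> unfolding WF_def by blast
qed

end
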